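(* Let $\Omega\subset\mathbb{R}^n$ ($n\ge 2$) be a bounded open domain, let $0<p<1$, and let $F,G:[0,\infty)\to\mathbb{R}$ be locally Lipschitz functions such that: (1) $F(0)=0$; (2) $-\infty<\liminf_{s\to 0^+}\frac{F(s)}{s^2}$ and $\limsup_{s\to 0^+}\frac{F(s)}{s^2}=+\infty$; (3) $l_0:=\liminf_{s\to 0^+}\frac{\max\{\xi:\xi\in\partial F(s)\}}{s}<0$ (the value $-\infty$ is allowed); (4) $G(0)=0$; (5) there are $\underline c,\overline c\in\mathbb{R}$ such that $$\underline c=\liminf_{s\to 0^+}\frac{\min\{\xi:\xi\in\partial G(s)\}}{s^p}\le\limsup_{s\to 0^+}\frac{\max\{\xi:\xi\in\partial G(s)\}}{s^p}=\overline c .$$ Then for every $k\in\mathbb{N}=\{1,2,\dots\}$ there exists $\lambda_k>0$ such that for every $\lambda\in[0,\lambda_k]$ the differential inclusion problem $$-\Delta u(x)\in\partial F(u(x))+\lambda\,\partial G(u(x))\ \text{ in }\Omega,\qquad u\ge 0\ \text{ in }\Omega,\qquad u=0\ \text{ on }\partial\Omega$$ has at least $k$ distinct weak solutions $u_{1,\lambda},\dots,u_{k,\lambda}\in H_0^1(\Omega)$. Moreover, these satisfy $$\|u_{i,\lambda}\|_{H_0^1}<i^{-1}\quad\text{and}\quad\|u_{i,\lambda}\|_{L^\infty}<i^{-1}\qquad\text{for all } i\in\{1,\dots,k\},\ \lambda\in[0,\lambda_k].$$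
   Context: For a locally Lipschitz function $f$ on $\mathbb{R}$, $\partial f(s)$ denotes the Clarke generalized gradient: $\partial f(s)=\{\xi\in\mathbb{R}:\ \xi v\le f^\circ(s;v)\ \text{for all } v\in\mathbb{R}\}$, where $f^\circ(s;v)=\limsup_{z\to s,\ \tau\to 0^+}\frac{f(z+\tau v)-f(z)}{\tau}$; it is a nonempty compact interval. Functions defined on $[0,\infty)$ and vanishing at $0$ are extended by $0$ to $(-\infty,0)$, which gives meaning to the generalized gradient at $0$. $\|u\|_{H_0^1}^2=\int_\Omega|\nabla u|^2dx$. A weak solution of the inclusion problem is a function $u\in H_0^1(\Omega)$ with $u\ge 0$ a.e. in $\Omega$ for which there is a measurable function $\xi:\Omega\to\mathbb{R}$ with $\xi(x)\in\partial F(u(x))+\lambda\,\partial G(u(x))$ for a.e. $x\in\Omega$ and $\int_\Omega\nabla u\cdot\nabla v\,dx=\int_\Omega \xi v\,dx$ for all $v\in H_0^1(\Omega)$. *)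

theory Defs
  imports "HOL-Analysis.Analysis" "HOL-Probability.Essential_Supremum"
begin

section \<open>Clarke generalized gradients of functions on the real line\<close>

definition locally_lipschitz_on :: "real set \<Rightarrow> (real \<Rightarrow> real) \<Rightarrow> bool" where
  "locally_lipschitz_on X f \<longleftrightarrow>
     (\<forall>s\<in>X. \<exists>r>0. \<exists>L. L-lipschitz_on (X \<inter> cball s r) f)"

text \<open>A function on \<open>[0,\<infinity>)\<close> vanishing at \<open>0\<close> is represented by a total function whose values
  on the negative axis are irrelevant; this is its extension by \<open>0\<close>.\<close>

definition zero_ext :: "(real \<Rightarrow> real) \<Rightarrow> real \<Rightarrow> real" where
  "zero_ext f s = (if s < 0 then 0 else f s)"

definition clarke_deriv :: "(real \<Rightarrow> real) \<Rightarrow> real \<Rightarrow> real \<Rightarrow> ereal" where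
  "clarke_deriv f s v =
     Limsup (nhds s \<times>\<^sub>F at_right 0) (\<lambda>(z, \<tau>). ereal ((f (z + \<tau> * v) - f z) / \<tau>))"

definition clarke_gradient :: "(real \<Rightarrow> real) \<Rightarrow> real \<Rightarrow> real set" where
  "clarke_gradient f s = {\<xi>. \<forall>v. ereal (\<xi> * v) \<le> clarke_deriv f s v}"

text \<open>For locally Lipschitz \<open>f\<close> the set \<open>clarke_gradient f s\<close> is nonempty and compact, so the
  following supremum and infimum are its maximum and minimum.\<close>

definition max_clarke :: "(real \<Rightarrow> real) \<Rightarrow> real \<Rightarrow> real" where
  "max_clarke f s = Sup (clarke_gradient f s)"

definition min_clarke :: "(real \<Rightarrow> real) \<Rightarrow> real \<Rightarrow> real" where
  "min_clarke f s = Inf (clarke_gradient f s)"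


section \<open>The Sobolev space \<open>H\<^sub>0\<^sup>1\<close>\<close>

text \<open>Functions on an open set \<open>\<Omega>\<close> are represented by total functions, of which only the
  values on \<open>\<Omega>\<close> matter; they are not quotiented by equality almost everywhere.\<close>

primrec iter_partial :: "'a::euclidean_space list \<Rightarrow> ('a \<Rightarrow> real) \<Rightarrow> 'a \<Rightarrow> real" where
  "iter_partial [] f = f"
| "iter_partial (b # bs) f = (\<lambda>x. frechet_derivative (iter_partial bs f) (at x) b)"

text \<open>All iterated partial derivatives exist and are differentiable (hence continuous), that
  is, \<open>f\<close> is of class \<open>C\<^sup>\<infinity>\<close>.\<close>

definition smooth :: "('a::euclidean_space \<Rightarrow> real) \<Rightarrow> bool" where
  "smooth f \<longleftrightarrow> (\<forall>bs\<in>lists Basis. \<forall>x. iter_partial bs f differentiable (at x))"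

definition test_function :: "'a::euclidean_space set \<Rightarrow> ('a \<Rightarrow> real) \<Rightarrow> bool" where
  "test_function \<Omega> \<phi> \<longleftrightarrow>
     smooth \<phi> \<and> compact (closure {x. \<phi> x \<noteq> 0}) \<and> closure {x. \<phi> x \<noteq> 0} \<subseteq> \<Omega>"

definition grad :: "('a::euclidean_space \<Rightarrow> real) \<Rightarrow> 'a \<Rightarrow> 'a" where
  "grad \<phi> x = (\<Sum>b\<in>Basis. frechet_derivative \<phi> (at x) b *\<^sub>R b)"

definition L2 :: "'a::euclidean_space set \<Rightarrow> ('a \<Rightarrow> 'b::euclidean_space) set" where
  "L2 \<Omega> = {f \<in> borel_measurable (lebesgue_on \<Omega>).
             integrable (lebesgue_on \<Omega>) (\<lambda>x. (norm (f x))\<^sup>2)}"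

definition locally_integrable_on :: "('a::euclidean_space \<Rightarrow> 'b::euclidean_space) \<Rightarrow> 'a set \<Rightarrow> bool"
  where
  "locally_integrable_on f \<Omega> \<longleftrightarrow> (\<forall>K. compact K \<and> K \<subseteq> \<Omega> \<longrightarrow> integrable (lebesgue_on K) f)"

definition has_weak_gradient ::
    "'a::euclidean_space set \<Rightarrow> ('a \<Rightarrow> real) \<Rightarrow> ('a \<Rightarrow> 'a) \<Rightarrow> bool" where
  "has_weak_gradient \<Omega> u g \<longleftrightarrow>
     locally_integrable_on u \<Omega> \<and> locally_integrable_on g \<Omega> \<and>
     (\<forall>\<phi>. test_function \<Omega> \<phi> \<longrightarrow> (\<forall>b\<in>Basis.
        (LINT x|lebesgue_on \<Omega>. u x * (grad \<phi> x \<bullet> b))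
          = - (LINT x|lebesgue_on \<Omega>. (g x \<bullet> b) * \<phi> x)))"

text \<open>The weak gradient is unique only up to equality almost everywhere on \<open>\<Omega>\<close>; an arbitrary
  representative is chosen. It is meaningless for functions without a weak gradient.\<close>

definition weak_grad :: "'a::euclidean_space set \<Rightarrow> ('a \<Rightarrow> real) \<Rightarrow> 'a \<Rightarrow> 'a" where
  "weak_grad \<Omega> u = (SOME g. has_weak_gradient \<Omega> u g)"

definition H1 :: "'a::euclidean_space set \<Rightarrow> ('a \<Rightarrow> real) set" where
  "H1 \<Omega> = {u \<in> L2 \<Omega>. (\<exists>g. has_weak_gradient \<Omega> u g) \<and> weak_grad \<Omega> u \<in> L2 \<Omega>}"

text \<open>The closure of the test functions in \<open>H1 \<Omega>\<close>.\<close>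

definition H10 :: "'a::euclidean_space set \<Rightarrow> ('a \<Rightarrow> real) set" where
  "H10 \<Omega> = {u \<in> H1 \<Omega>. \<exists>\<phi> :: nat \<Rightarrow> 'a \<Rightarrow> real.
      (\<forall>m. test_function \<Omega> (\<phi> m)) \<and>
      (\<lambda>m. LINT x|lebesgue_on \<Omega>. (u x - \<phi> m x)\<^sup>2) \<longlonglongrightarrow> 0 \<and>
      (\<lambda>m. LINT x|lebesgue_on \<Omega>. (norm (weak_grad \<Omega> u x - grad (\<phi> m) x))\<^sup>2) \<longlonglongrightarrow> 0}"

definition H10_norm :: "'a::euclidean_space set \<Rightarrow> ('a \<Rightarrow> real) \<Rightarrow> real" where
  "H10_norm \<Omega> u = sqrt (LINT x|lebesgue_on \<Omega>. (norm (weak_grad \<Omega> u x))\<^sup>2)"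

definition Linf_norm :: "'a::euclidean_space set \<Rightarrow> ('a \<Rightarrow> real) \<Rightarrow> ereal" where
  "Linf_norm \<Omega> u = esssup (lebesgue_on \<Omega>) (\<lambda>x. ereal \<bar>u x\<bar>)"


section \<open>The differential inclusion\<close>

text \<open>Weak solutions of \<open>- \<Delta>u \<in> \<partial>F(u) + \<mu> \<partial>G(u)\<close> in \<open>\<Omega>\<close>, \<open>u \<ge> 0\<close>, \<open>u = 0\<close> on the boundary.
  The integrability of \<open>\<xi> v\<close> is explicit because the Bochner integral of a non-integrable
  function is \<open>0\<close>.\<close>

definition weak_solution ::
    "'a::euclidean_space set \<Rightarrow> (real \<Rightarrow> real) \<Rightarrow> (real \<Rightarrow> real) \<Rightarrow> real \<Rightarrow> ('a \<Rightarrow> real) \<Rightarrow> bool" where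
  "weak_solution \<Omega> F G \<mu> u \<longleftrightarrow>
     u \<in> H10 \<Omega> \<and> (AE x in lebesgue_on \<Omega>. 0 \<le> u x) \<and>
     (\<exists>\<xi> \<in> borel_measurable (lebesgue_on \<Omega>).
        (AE x in lebesgue_on \<Omega>.
           \<exists>a \<in> clarke_gradient (zero_ext F) (u x).
           \<exists>b \<in> clarke_gradient (zero_ext G) (u x). \<xi> x = a + \<mu> * b) \<and>
        (\<forall>v \<in> H10 \<Omega>. integrable (lebesgue_on \<Omega>) (\<lambda>x. \<xi> x * v x) \<and>
           (LINT x|lebesgue_on \<Omega>. weak_grad \<Omega> u x \<bullet> weak_grad \<Omega> v x)
             = (LINT x|lebesgue_on \<Omega>. \<xi> x * v x)))"

end

theory Submission
  imports Defs
begin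

text \<open>Where \<open>max \<partial>F < 0\<close> at a point, upper semicontinuity makes \<open>F + \<mu>G\<close> nonincreasing on a small interval
  \<open>[\<delta>, \<eta>]\<close> for all small \<open>\<mu>\<close>. Freezing \<open>F + \<mu>G\<close> beyond \<open>\<eta>\<close> gives a functional on \<open>H\<^sub>0\<^sup>1\<close> that does not increase
  under clamping to \<open>[0, \<delta>]\<close>; its minimizer therefore takes values in \<open>[0, \<delta>]\<close> and solves the inclusion, by
  comparing difference quotients. The oscillation \<open>limsup F(s)/s\<^sup>2 = \<infinity>\<close> makes the minimal energies negative, and they
  tend to \<open>0\<close> with \<open>\<delta>\<close>, so intervals chosen successively closer to \<open>0\<close> give solutions with different energies.
  Weak compactness and compact embeddings are avoided: limits in \<open>H\<^sub>0\<^sup>1\<close> come from the parallelogram law, and minimizing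
  sequences converge because the energy is submodular for \<open>max\<close> and \<open>min\<close>.\<close>

section \<open>Smooth functions\<close>

text \<open>The potential is only Lipschitz, so the energy has no derivative and the multiplier
  \<xi> must be constructed. The Lipschitz bound alone makes the pairing of grad u with grad v
  continuous in the L2 norm of v, which gives \<xi> in L2; its pointwise position is read off from
  difference quotients at fixed scales. Quotients of F and G are bounded separately, because the
  inclusion asks for a sum of two gradients, not for the gradient of a sum. The two summands are
  split off pointwise; only \<xi> has to be measurable, so no measurable selection occurs. The
  interval [\<delta>, \<eta>] leaves a gap: values of the minimizer stay at or below \<delta>,
  freezing acts beyond \<eta>, and quotients at scales below \<eta> - \<delta> see the unfrozen
  potential. Distinctness needs a level that is uniform in the parameter: each interval yields
  \<kappa> > 0 with energy at most -\<kappa> for all small \<mu>, and the next interval is so short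
  that its energies lie above -\<kappa>. F and G are cut off at 1, which makes them globally
  Lipschitz and does not affect solutions with values below 1.\<close>

lemma iter_partial_snoc:
  "iter_partial (bs @ [b]) f = iter_partial bs (\<lambda>x. frechet_derivative f (at x) b)"
  by (induction bs) auto

text \<open>Smoothness up to a finite order, with the recursion removing the derivative that is
  applied first. Sums, products, reciprocals and compositions are then handled by induction on the
  order with the function generalized, at one product or chain rule per step and with no Leibniz
  formula over lists of directions.\<close>

primrec ck :: "nat \<Rightarrow> ('a::euclidean_space \<Rightarrow> real) \<Rightarrow> bool" where
  "ck 0 f \<longleftrightarrow> (\<forall>x. f differentiable (at x))"
| "ck (Suc n) f \<longleftrightarrow> (\<forall>x. f differentiable (at x)) \<and>
     (\<forall>b\<in>Basis. ck n (\<lambda>x. frechet_derivative f (at x) b))"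

lemma ck_iff_iter_partial:
  "ck n f \<longleftrightarrow> (\<forall>bs\<in>lists Basis. length bs \<le> n \<longrightarrow> (\<forall>x. iter_partial bs f differentiable (at x)))"
proof (induction n arbitrary: f)
  case 0
  then show ?case by auto
next
  case (Suc n)
  show ?case
  proof
    assume L: "ck (Suc n) f"
    show "\<forall>bs\<in>lists Basis. length bs \<le> Suc n \<longrightarrow> (\<forall>x. iter_partial bs f differentiable (at x))"
    proof (intro ballI impI)
      fix bs :: "'a list" assume bs: "bs \<in> lists Basis" "length bs \<le> Suc n"
      show "\<forall>x. iter_partial bs f differentiable (at x)"
      proof (cases bs rule: rev_cases)
        case Nil then show ?thesis using L by simp
      next
        case (snoc cs b)
        then have "b \<in> Basis" "cs \<in> lists Basis" "length cs \<le> n" using bs by auto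
        then show ?thesis using L Suc.IH unfolding snoc iter_partial_snoc by simp
      qed
    qed
  next
    assume R: "\<forall>bs\<in>lists Basis. length bs \<le> Suc n \<longrightarrow> (\<forall>x. iter_partial bs f differentiable (at x))"
    have "ck n (\<lambda>x. frechet_derivative f (at x) b)" if "b \<in> Basis" for b
      unfolding Suc.IH
    proof (intro ballI impI)
      fix bs :: "'a list" assume "bs \<in> lists Basis" "length bs \<le> n"
      then show "\<forall>x. iter_partial bs (\<lambda>x. frechet_derivative f (at x) b) differentiable (at x)"
        using R[rule_format, of "bs @ [b]"] that by (simp add: iter_partial_snoc)
    qed
    moreover have "f differentiable (at x)" for x
      using R[rule_format, of "[]"] by simp
    ultimately show "ck (Suc n) f" by simp
  qed
qed

lemma smooth_iff_ck: "smooth f \<longleftrightarrow> (\<forall>n. ck n f)"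
  unfolding smooth_def ck_iff_iter_partial by blast

lemma ck_differentiable: "ck n f \<Longrightarrow> f differentiable (at x)"
  by (cases n) auto

lemma ck_Suc_imp: "ck (Suc n) f \<Longrightarrow> ck n f"
  unfolding ck_iff_iter_partial by auto

lemma ck_SucI:
  assumes "\<And>x. (f has_derivative (f' x)) (at x)" "\<And>b. b \<in> Basis \<Longrightarrow> ck n (\<lambda>x. f' x b)"
  shows "ck (Suc n) f"
proof -
  have "frechet_derivative f (at x) = f' x" for x
    using frechet_derivative_at[OF assms(1)] by simp
  then show ?thesis using assms by (auto simp: differentiable_def)
qed

lemma ck_0I: "(\<And>x. (f has_derivative (f' x)) (at x)) \<Longrightarrow> ck 0 f"
  by (auto simp: differentiable_def)

lemma ck_has_derivative:
  "ck n f \<Longrightarrow> (f has_derivative frechet_derivative f (at x)) (at x)"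
  using ck_differentiable frechet_derivative_works by blast

lemma ckI:
  assumes "\<And>x. (f has_derivative (f' x)) (at x)" "\<And>n b. b \<in> Basis \<Longrightarrow> ck n (\<lambda>x. f' x b)"
  shows "ck n f"
  using ck_0I[OF assms(1)] ck_SucI[OF assms] by (cases n) blast+

lemma ck_const: "ck n (\<lambda>x. c)"
proof (induction n arbitrary: c)
  case 0 show ?case by (rule ck_0I) (rule has_derivative_const)
next
  case (Suc n)
  then show ?case by (intro ck_SucI[where f'="\<lambda>x h. 0"]) auto
qed

lemma ck_add: "ck n f \<Longrightarrow> ck n g \<Longrightarrow> ck n (\<lambda>x. f x + g x)"
proof (induction n arbitrary: f g)
  case 0 then show ?case by auto
next
  case (Suc n)
  show ?case
  proof (rule ck_SucI)
    show "((\<lambda>x. f x + g x) has_derivative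
       (\<lambda>h. frechet_derivative f (at x) h + frechet_derivative g (at x) h)) (at x)" for x
      by (intro has_derivative_add ck_has_derivative[OF Suc.prems(1)] ck_has_derivative[OF Suc.prems(2)])
  qed (use Suc in auto)
qed

lemma ck_mult: "ck n f \<Longrightarrow> ck n g \<Longrightarrow> ck n (\<lambda>x. f x * g x)"
proof (induction n arbitrary: f g)
  case 0 then show ?case by auto
next
  case (Suc n)
  show ?case
  proof (rule ck_SucI)
    show "((\<lambda>x. f x * g x) has_derivative
       (\<lambda>h. f x * frechet_derivative g (at x) h + frechet_derivative f (at x) h * g x)) (at x)" for x
      by (intro has_derivative_mult ck_has_derivative[OF Suc.prems(1)] ck_has_derivative[OF Suc.prems(2)])
    show "ck n (\<lambda>x. f x * frechet_derivative g (at x) b + frechet_derivative f (at x) b * g x)"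
      if "b \<in> Basis" for b
      using Suc.prems that
      by (intro ck_add Suc.IH ck_Suc_imp[OF Suc.prems(1)] ck_Suc_imp[OF Suc.prems(2)]) auto
  qed
qed

lemma ck_inverse:
  assumes "ck n f" "\<And>x. f x \<noteq> 0"
  shows "ck n (\<lambda>x. inverse (f x))"
  using assms
proof (induction n arbitrary: f)
  case 0 then show ?case by (auto intro!: differentiable_inverse)
next
  case (Suc n)
  show ?case
  proof (rule ck_SucI)
    show "((\<lambda>x. inverse (f x)) has_derivative
       (\<lambda>h. (- 1) * (inverse (f x) * frechet_derivative f (at x) h * inverse (f x)))) (at x)" for x
      using Deriv.has_derivative_inverse[OF Suc.prems(2) ck_has_derivative[OF Suc.prems(1)]] by simp
    show "ck n (\<lambda>x. (- 1) * (inverse (f x) * frechet_derivative f (at x) b * inverse (f x)))"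
      if "b \<in> Basis" for b
      using Suc.IH[OF ck_Suc_imp] Suc.prems that
      by (intro ck_mult ck_const) auto
  qed
qed

text \<open>The derivative \<open>f' / (2 sqrt f)\<close> contains only the same square root again,
  one order lower. The result serves to regularize the absolute value.\<close>

lemma ck_sqrt:
  assumes "ck n f" "\<And>x. f x > 0"
  shows "ck n (\<lambda>x. sqrt (f x))"
  using assms
proof (induction n arbitrary: f)
  case 0
  have "((\<lambda>x. sqrt (f x)) has_derivative (\<lambda>h. frechet_derivative f (at x) h * (inverse (sqrt (f x)) / 2))) (at x)" for x
    using has_derivative_compose[OF ck_has_derivative[OF 0(1)] DERIV_real_sqrt[OF 0(2), unfolded has_field_derivative_def]]
    by (simp add: mult.commute)
  then show ?case by (rule ck_0I)
next
  case (Suc n)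
  show ?case
  proof (rule ck_SucI)
    show "((\<lambda>x. sqrt (f x)) has_derivative (\<lambda>h. frechet_derivative f (at x) h * ((1/2) * inverse (sqrt (f x))))) (at x)" for x
      using has_derivative_compose[OF ck_has_derivative[OF Suc.prems(1)]
          DERIV_real_sqrt[OF Suc.prems(2), unfolded has_field_derivative_def]]
      by (simp add: mult.commute)
    have "ck n (\<lambda>x. inverse (sqrt (f x)))"
      using Suc.IH[OF ck_Suc_imp] Suc.prems
      by (intro ck_inverse) (auto simp: less_le)
    then show "ck n (\<lambda>x. frechet_derivative f (at x) b * ((1/2) * inverse (sqrt (f x))))"
      if "b \<in> Basis" for b
      using Suc.prems that by (intro ck_mult ck_const) auto
  qed
qed

text \<open>The functions \<open>t\<^sup>-\<^sup>m exp (-1/t)\<close> on \<open>t > 0\<close>, extended by \<open>0\<close>: a family closed under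
  differentiation up to linear combinations.\<close>

definition flat :: "nat \<Rightarrow> real \<Rightarrow> real" where
  "flat m t = (if t \<le> 0 then 0 else inverse t ^ m * exp (- inverse t))"

lemma flat_tendsto_0: "((\<lambda>t. flat m t) \<longlongrightarrow> 0) (at_right 0)"
proof -
  have "((\<lambda>y::real. y ^ m / exp y) \<longlongrightarrow> 0) at_top"
    by (rule tendsto_power_div_exp_0)
  then have "((\<lambda>t::real. inverse t ^ m / exp (inverse t)) \<longlongrightarrow> 0) (at_right 0)"
    using filterlim_compose[OF _ filterlim_inverse_at_top_right] by blast
  then show ?thesis
    by (rule Lim_transform_eventually)
      (auto simp: eventually_at_filter flat_def exp_minus divide_inverse)
qed

lemma flat_has_field_derivative:
  "(flat m has_real_derivative (- real m * flat (m + 1) t + flat (m + 2) t)) (at t)"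
proof (cases "t < 0" "t = 0" rule: bool.exhaust[case_product bool.exhaust])
  case True_True then show ?thesis by simp
next
  case True_False
  have "((\<lambda>t. 0) has_real_derivative 0) (at t)" by simp
  then have "(flat m has_real_derivative 0) (at t)"
    by (rule has_field_derivative_transform_within[where d="-t"])
      (use True_False in \<open>auto simp: flat_def dist_real_def\<close>)
  then show ?thesis using True_False by (simp add: flat_def)
next
  case False_True
  \<comment> \<open>At 0 both one-sided quotients are explicit: 0 on the left and
    \<open>flat (Suc m)\<close> itself on the right, which tends to 0.\<close>
  have "((\<lambda>h. (flat m (0 + h) - flat m 0) / h) \<longlongrightarrow> 0) (at 0)"
  proof (rule filterlim_split_at)
    show "((\<lambda>h. (flat m (0 + h) - flat m 0) / h) \<longlongrightarrow> 0) (at_left 0)"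
      by (rule Lim_transform_eventually[OF tendsto_const])
        (auto simp: eventually_at_filter flat_def)
    show "((\<lambda>h. (flat m (0 + h) - flat m 0) / h) \<longlongrightarrow> 0) (at_right 0)"
      by (rule Lim_transform_eventually[OF flat_tendsto_0[of "Suc m"]])
        (auto simp: eventually_at_filter flat_def divide_inverse)
  qed
  then have "(flat m has_real_derivative 0) (at 0)" by (simp add: DERIV_def)
  then show ?thesis using False_True by (simp add: flat_def)
next
  case False_False
  then have t: "t > 0" by simp
  have "((\<lambda>t. inverse t ^ m * exp (- inverse t)) has_real_derivative
      (- real m * flat (m + 1) t + flat (m + 2) t)) (at t)"
    using t
    by (auto intro!: derivative_eq_intros simp: flat_def power2_eq_square)
      (cases m; simp add: field_simps)
  then show ?thesis
    by (rule has_field_derivative_transform_within[where d=t]) (use t in \<open>auto simp: flat_def dist_real_def\<close>)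
qed

lemma ck_flat_compose:
  assumes "\<And>n. ck n q"
  shows "ck n (\<lambda>x. flat m (q x))"
proof (induction n arbitrary: m)
  have d: "((\<lambda>x. flat m (q x)) has_derivative
     (\<lambda>h. frechet_derivative q (at x) h * (- real m * flat (m + 1) (q x) + flat (m + 2) (q x)))) (at x)" for x m
    using has_derivative_compose[OF ck_has_derivative[OF assms]
        flat_has_field_derivative[unfolded has_field_derivative_def]]
    by (simp add: mult.commute)
  {
    case 0
    show ?case by (rule ck_0I) (rule d)
  next
    case (Suc n)
    have "ck n (\<lambda>x. frechet_derivative q (at x) b * (- real m * flat (m + 1) (q x) + flat (m + 2) (q x)))"
      if "b \<in> Basis" for b
      using assms[of "Suc n"] that Suc by (intro ck_mult ck_add ck_const) auto
    with d show ?case by (intro ck_SucI)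
  }
qed

lemma ck_dist_sq: "ck n (\<lambda>x. r - (x - a) \<bullet> (x - a))"
proof -
  have lin: "ck n (\<lambda>x. (- 2) * ((x - a) \<bullet> b))" for n b
  proof -
    have "((\<lambda>x. (x - a) \<bullet> b) has_derivative (\<lambda>h. h \<bullet> b)) (at x)" for x
      by (auto intro!: derivative_eq_intros)
    then have "ck n (\<lambda>x. (x - a) \<bullet> b)" by (rule ckI) (rule ck_const)
    then show ?thesis by (intro ck_mult ck_const)
  qed
  have d: "((\<lambda>x. r - (x - a) \<bullet> (x - a)) has_derivative (\<lambda>h. (- 2) * ((x - a) \<bullet> h))) (at x)" for x
    by (auto intro!: derivative_eq_intros simp: inner_commute)
  show ?thesis by (rule ckI[OF d lin])
qed

lemma smooth_const: "smooth (\<lambda>x. c)"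
  and smooth_add: "smooth f \<Longrightarrow> smooth g \<Longrightarrow> smooth (\<lambda>x. f x + g x)"
  and smooth_mult: "smooth f \<Longrightarrow> smooth g \<Longrightarrow> smooth (\<lambda>x. f x * g x)"
  and smooth_inverse: "smooth f \<Longrightarrow> (\<And>x. f x \<noteq> 0) \<Longrightarrow> smooth (\<lambda>x. inverse (f x))"
  and smooth_sqrt: "smooth f \<Longrightarrow> (\<And>x. f x > 0) \<Longrightarrow> smooth (\<lambda>x. sqrt (f x))"
  by (simp_all add: smooth_iff_ck ck_const ck_add ck_mult ck_inverse ck_sqrt)

lemma smooth_bump: "smooth (\<lambda>x. flat 0 (r - (x - a) \<bullet> (x - a)))"
  by (simp add: smooth_iff_ck ck_flat_compose ck_dist_sq)

lemma smooth_diff: "smooth f \<Longrightarrow> smooth g \<Longrightarrow> smooth (\<lambda>x. f x - g x)"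
  using smooth_add[of f "\<lambda>x. (-1) * g x"] smooth_mult[OF smooth_const, of g "-1"] by simp

lemma smooth_differentiable: "smooth f \<Longrightarrow> f differentiable (at x)"
  using ck_differentiable smooth_iff_ck by blast

lemma smooth_has_derivative:
  "smooth f \<Longrightarrow> (f has_derivative frechet_derivative f (at x)) (at x)"
  using smooth_differentiable frechet_derivative_works by blast

lemma smooth_partial: "smooth f \<Longrightarrow> b \<in> Basis \<Longrightarrow> smooth (\<lambda>x. frechet_derivative f (at x) b)"
  unfolding smooth_iff_ck using ck.simps(2) by blast

lemma smooth_continuous_on: "smooth f \<Longrightarrow> continuous_on S f"
  by (meson continuous_at_imp_continuous_on differentiable_imp_continuous_within smooth_differentiable)

section \<open>Test functions\<close>

lemma test_function_iff:
  "test_function \<Omega> \<phi> \<longleftrightarrow> smooth \<phi> \<and> (\<exists>K. compact K \<and> K \<subseteq> \<Omega> \<and> (\<forall>x. x \<notin> K \<longrightarrow> \<phi> x = 0))"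
proof
  assume "test_function \<Omega> \<phi>"
  then show "smooth \<phi> \<and> (\<exists>K. compact K \<and> K \<subseteq> \<Omega> \<and> (\<forall>x. x \<notin> K \<longrightarrow> \<phi> x = 0))"
    unfolding test_function_def using closure_subset[of "{x. \<phi> x \<noteq> 0}"] by blast
next
  assume "smooth \<phi> \<and> (\<exists>K. compact K \<and> K \<subseteq> \<Omega> \<and> (\<forall>x. x \<notin> K \<longrightarrow> \<phi> x = 0))"
  then obtain K where K: "smooth \<phi>" "compact K" "K \<subseteq> \<Omega>" "\<And>x. x \<notin> K \<Longrightarrow> \<phi> x = 0" by blast
  then have "closure {x. \<phi> x \<noteq> 0} \<subseteq> K"
    by (intro closure_minimal compact_imp_closed) auto
  moreover from this have "compact (closure {x. \<phi> x \<noteq> 0})"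
    using compact_Int_closed[OF K(2) closed_closure, of "{x. \<phi> x \<noteq> 0}"] by (simp add: inf.absorb2)
  ultimately show "test_function \<Omega> \<phi>"
    using K unfolding test_function_def by auto
qed

lemma test_function_smooth: "test_function \<Omega> \<phi> \<Longrightarrow> smooth \<phi>"
  by (simp add: test_function_def)

lemma test_function_mono: "test_function A \<phi> \<Longrightarrow> A \<subseteq> B \<Longrightarrow> test_function B \<phi>"
  unfolding test_function_def by blast

lemma test_function_support: "test_function \<Omega> \<phi> \<Longrightarrow> x \<notin> \<Omega> \<Longrightarrow> \<phi> x = 0"
  unfolding test_function_iff by blast

lemma test_function_0: "test_function \<Omega> (\<lambda>x. 0)"
  unfolding test_function_iff using smooth_const by (intro conjI exI[of _ "{}"]) auto

lemma test_function_supportI: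
  assumes "test_function \<Omega> \<phi>" "smooth \<psi>" "\<And>x. \<phi> x = 0 \<Longrightarrow> \<psi> x = 0"
  shows "test_function \<Omega> \<psi>"
  using assms unfolding test_function_iff by blast

lemma test_function_mult: "test_function \<Omega> \<phi> \<Longrightarrow> smooth \<psi> \<Longrightarrow> test_function \<Omega> (\<lambda>x. \<psi> x * \<phi> x)"
  by (rule test_function_supportI) (auto intro: smooth_mult test_function_smooth)

lemma test_function_cmult: "test_function \<Omega> \<phi> \<Longrightarrow> test_function \<Omega> (\<lambda>x. c * \<phi> x)"
  by (intro test_function_mult smooth_const)

lemma test_function_add:
  assumes "test_function \<Omega> \<phi>" "test_function \<Omega> \<psi>" shows "test_function \<Omega> (\<lambda>x. \<phi> x + \<psi> x)"
proof -
  obtain K L where "compact K" "K \<subseteq> \<Omega>" "\<And>x. x \<notin> K \<Longrightarrow> \<phi> x = 0"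
    "compact L" "L \<subseteq> \<Omega>" "\<And>x. x \<notin> L \<Longrightarrow> \<psi> x = 0"
    using assms unfolding test_function_iff by metis
  then have "compact (K \<union> L) \<and> K \<union> L \<subseteq> \<Omega> \<and> (\<forall>x. x \<notin> K \<union> L \<longrightarrow> \<phi> x + \<psi> x = 0)" by auto
  then show ?thesis
    using assms smooth_add test_function_smooth unfolding test_function_iff by blast
qed

lemma test_function_sum:
  "finite A \<Longrightarrow> (\<And>i. i \<in> A \<Longrightarrow> test_function \<Omega> (\<phi> i)) \<Longrightarrow> test_function \<Omega> (\<lambda>x. \<Sum>i\<in>A. \<phi> i x)"
  by (induction A rule: finite_induct) (auto intro: test_function_0 test_function_add)

lemma bump_pos_iff: "flat 0 t > 0 \<longleftrightarrow> t > 0" and bump_nonneg: "flat 0 t \<ge> 0"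
  by (auto simp: flat_def)

lemma test_function_bump:
  fixes a :: "'a::euclidean_space"
  assumes "cball a r \<subseteq> \<Omega>" "r > 0"
  shows "\<exists>\<phi>. test_function \<Omega> \<phi> \<and> (\<forall>x. \<phi> x \<ge> 0) \<and> (\<forall>x. \<phi> x > 0 \<longleftrightarrow> x \<in> ball a r)"
proof (intro exI conjI allI)
  let ?\<phi> = "\<lambda>x. flat 0 (r\<^sup>2 - (x - a) \<bullet> (x - a))"
  have eq: "r\<^sup>2 - (x - a) \<bullet> (x - a) > 0 \<longleftrightarrow> x \<in> ball a r" for x
    using assms(2) abs_le_square_iff[of r "norm (x - a)"]
    unfolding power2_norm_eq_inner[symmetric] mem_ball dist_norm norm_minus_commute[of a]
    by (simp add: not_le[symmetric])
  show "?\<phi> x > 0 \<longleftrightarrow> x \<in> ball a r" for x unfolding bump_pos_iff by (rule eq)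
  show "?\<phi> x \<ge> 0" for x by (rule bump_nonneg)
  have "?\<phi> x = 0" if "x \<notin> cball a r" for x
  proof -
    have "x \<notin> ball a r" using that by auto
    then show ?thesis using eq[of x] by (simp add: flat_def)
  qed
  then show "test_function \<Omega> ?\<phi>"
    unfolding test_function_iff using assms(1)
    by (intro conjI smooth_bump exI[of _ "cball a r"]) auto
qed

section \<open>Gradients and integration by parts for test functions\<close>

lemma frechet_derivative_eq_grad:
  assumes "f differentiable (at x)" shows "frechet_derivative f (at x) h = grad f x \<bullet> h"
proof -
  interpret linear "frechet_derivative f (at x)" by (rule linear_frechet_derivative[OF assms])
  have "frechet_derivative f (at x) h = frechet_derivative f (at x) (\<Sum>b\<in>Basis. (h \<bullet> b) *\<^sub>R b)"
    by (simp add: euclidean_representation)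
  also have "\<dots> = grad f x \<bullet> h"
    unfolding grad_def inner_sum_left sum by (intro sum.cong) (auto simp: scale inner_commute mult.commute)
  finally show ?thesis .
qed

lemma grad_has_derivative: "smooth f \<Longrightarrow> (f has_derivative (\<lambda>h. grad f x \<bullet> h)) (at x)"
proof -
  assume f: "smooth f"
  have "frechet_derivative f (at x) = (\<lambda>h. grad f x \<bullet> h)"
    using frechet_derivative_eq_grad[OF smooth_differentiable[OF f]] by blast
  then show ?thesis using smooth_has_derivative[OF f, of x] by simp
qed

lemma grad_unique:
  assumes "(f has_derivative (\<lambda>h. g \<bullet> h)) (at x)" shows "grad f x = g"
proof -
  have "frechet_derivative f (at x) = (\<lambda>h. g \<bullet> h)" using frechet_derivative_at[OF assms] by simp
  then show ?thesis unfolding grad_def by (simp add: euclidean_representation)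
qed

lemma grad_add: "smooth f \<Longrightarrow> smooth g \<Longrightarrow> grad (\<lambda>x. f x + g x) x = grad f x + grad g x"
  by (intro grad_unique) (auto intro!: derivative_eq_intros grad_has_derivative simp: inner_add_left)

lemma grad_cmult: "smooth f \<Longrightarrow> grad (\<lambda>x. c * f x) x = c *\<^sub>R grad f x"
  by (intro grad_unique) (auto intro!: derivative_eq_intros grad_has_derivative)

lemma grad_mult: "smooth f \<Longrightarrow> smooth g \<Longrightarrow>
    grad (\<lambda>x. f x * g x) x = f x *\<^sub>R grad g x + g x *\<^sub>R grad f x"
  by (intro grad_unique)
    (auto intro!: derivative_eq_intros grad_has_derivative simp: inner_add_left algebra_simps)

lemma grad_compose:
  assumes "smooth f" "(T has_real_derivative T') (at (f x))"
  shows "grad (\<lambda>x. T (f x)) x = T' *\<^sub>R grad f x"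
  by (intro grad_unique)
    (use has_derivative_compose[OF grad_has_derivative[OF assms(1)] assms(2)[unfolded has_field_derivative_def]]
      in simp)

lemma continuous_on_grad: "smooth f \<Longrightarrow> continuous_on S (grad f)"
  unfolding grad_def by (intro continuous_intros smooth_continuous_on smooth_partial) auto

lemma grad_support:
  assumes "smooth f" "compact K" "\<And>x. x \<notin> K \<Longrightarrow> f x = 0" "x \<notin> K"
  shows "grad f x = 0"
proof (rule grad_unique)
  have "open (- K)" using assms(2) compact_imp_closed by auto
  moreover have "((\<lambda>x. 0) has_derivative (\<lambda>h. 0 \<bullet> h)) (at x)" by simp
  ultimately show "(f has_derivative (\<lambda>h. 0 \<bullet> h)) (at x)"
    using has_derivative_transform_within_open[of "\<lambda>x. 0" "\<lambda>h. 0 \<bullet> h" x UNIV "- K" f] assms by auto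
qed

lemma bounded_compact_support:
  fixes f :: "'a::euclidean_space \<Rightarrow> 'b::euclidean_space"
  assumes "continuous_on UNIV f" "compact K" "\<And>x. x \<notin> K \<Longrightarrow> f x = 0"
  shows "\<exists>C\<ge>0. \<forall>x. norm (f x) \<le> C"
proof -
  have "bounded (f ` K)"
    using assms continuous_on_subset compact_continuous_image compact_imp_bounded by blast
  then obtain C where "\<And>x. x \<in> K \<Longrightarrow> norm (f x) \<le> C" unfolding bounded_iff by blast
  then have "norm (f x) \<le> max C 0" for x using assms(3)[of x] by (cases "x \<in> K") fastforce+
  then show ?thesis by (intro exI[of _ "max C 0"]) auto
qed

lemma integrable_compact_support:
  fixes f :: "'a::euclidean_space \<Rightarrow> 'b::euclidean_space"
  assumes "continuous_on UNIV f" "compact K" "\<And>x. x \<notin> K \<Longrightarrow> f x = 0"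
  shows "integrable lborel f"
proof -
  have "integrable lborel (\<lambda>x. indicator K x *\<^sub>R f x)"
    using assms by (intro borel_integrable_compact) (auto intro: continuous_on_subset)
  also have "(\<lambda>x. indicator K x *\<^sub>R f x) = f" using assms(3) by (force simp: indicator_def)
  finally show ?thesis .
qed

lemma lebesgue_on_compact_support:
  fixes f :: "'a::euclidean_space \<Rightarrow> 'b::euclidean_space"
  assumes "continuous_on UNIV f" "compact K" "\<And>x. x \<notin> K \<Longrightarrow> f x = 0" "K \<subseteq> \<Omega>" "\<Omega> \<in> sets lebesgue"
  shows "integrable (lebesgue_on \<Omega>) f" "integral\<^sup>L (lebesgue_on \<Omega>) f = integral\<^sup>L lborel f"
proof -
  have m: "f \<in> borel_measurable lborel" using assms(1) borel_measurable_continuous_onI by auto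
  have eq: "(\<lambda>x. indicator \<Omega> x *\<^sub>R f x) = f" using assms(3,4) by (force simp: indicator_def)
  show "integrable (lebesgue_on \<Omega>) f"
    using integrable_restrict_space[of \<Omega> lebesgue f] assms(5) eq integrable_completion[OF m]
      integrable_compact_support[OF assms(1-3)] by simp
  show "integral\<^sup>L (lebesgue_on \<Omega>) f = integral\<^sup>L lborel f"
    using integral_restrict_space[of \<Omega> lebesgue f] assms(5) eq integral_completion[OF m] by simp
qed

lemma integral_translate:
  fixes f :: "'a::euclidean_space \<Rightarrow> real"
  assumes "f \<in> borel_measurable borel"
  shows "(LINT x|lborel. f (c + x)) = (LINT x|lborel. f x)"
  by (subst (2) lborel_distr_plus[symmetric, of c]) (use assms in \<open>auto intro!: integral_distr[symmetric]\<close>)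

text \<open>The integral of \<open>f (x + t b)\<close> does not depend on \<open>t\<close>, so
  difference quotients in direction \<open>b\<close> integrate to 0, and dominated convergence
  passes this on to the derivative. Translation invariance takes the place of Fubini and the
  one-dimensional fundamental theorem.\<close>

lemma integral_partial_0:
  fixes f :: "'a::euclidean_space \<Rightarrow> real"
  assumes sm: "smooth f" and K: "compact K" "\<And>x. x \<notin> K \<Longrightarrow> f x = 0"
  shows "(LINT x|lborel. grad f x \<bullet> b) = 0"
proof -
  obtain C where C: "C \<ge> 0" "\<And>x. norm (grad f x) \<le> C"
    using bounded_compact_support[OF continuous_on_grad[OF sm] K(1) grad_support[OF sm K]] by blast
  obtain R where R: "\<And>x. x \<in> K \<Longrightarrow> norm x \<le> R"
    using compact_imp_bounded[OF K(1)] unfolding bounded_iff by blast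
  have lip: "\<bar>f y - f x\<bar> \<le> C * norm (y - x)" for x y
  proof -
    have "norm (f y - f x) \<le> C * norm (y - x)"
    proof (rule differentiable_bound[of UNIV f "\<lambda>x h. grad f x \<bullet> h"])
      show "onorm (\<lambda>h. grad f x \<bullet> h) \<le> C" for x
        using C(2)[of x] by (intro onorm_bound C(1))
          (metis Cauchy_Schwarz_ineq2 mult_right_mono norm_ge_zero order_trans real_norm_def)
    qed (auto intro: grad_has_derivative[OF sm])
    then show ?thesis by simp
  qed
  have cont: "continuous_on UNIV f" using sm by (rule smooth_continuous_on)
  then have m[measurable]: "f \<in> borel_measurable borel" by (rule borel_measurable_continuous_onI)
  have mg[measurable]: "(\<lambda>x. grad f x \<bullet> b) \<in> borel_measurable borel"
    by (intro borel_measurable_continuous_onI continuous_intros continuous_on_grad sm)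
  have int: "integrable lborel f" by (rule integrable_compact_support[OF cont K])
  define t :: "nat \<Rightarrow> real" where "t n = inverse (real (Suc n))" for n
  have t: "t n > 0" "t n \<le> 1" for n by (auto simp: t_def inverse_le_1_iff)
  have t0: "t \<longlonglongrightarrow> 0" unfolding t_def by (rule LIMSEQ_inverse_real_of_nat)
  define q where "q n x = (f (t n *\<^sub>R b + x) - f x) / t n" for n x
  have "(\<lambda>n. LINT x|lborel. q n x) \<longlonglongrightarrow> (LINT x|lborel. grad f x \<bullet> b)"
  proof (rule integral_dominated_convergence)
    show "(\<lambda>x. grad f x \<bullet> b) \<in> borel_measurable lborel" by simp
    show "q n \<in> borel_measurable lborel" for n unfolding q_def by simp
    \<comment> \<open>Since \<open>t n \<le> 1\<close>, all quotients vanish outside the ball of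
      radius \<open>R + norm b\<close>; inside it the Lipschitz constant \<open>C\<close> bounds
      them by \<open>C * norm b\<close>.\<close>
    show "integrable lborel (\<lambda>x::'a. indicator (cball 0 (R + norm b)) x *\<^sub>R (C * norm b))"
      by (intro borel_integrable_compact) auto
    show "AE x in lborel. (\<lambda>n. q n x) \<longlonglongrightarrow> grad f x \<bullet> b"
    proof (rule AE_I2)
      fix x
      have "((\<lambda>s. f (x + s *\<^sub>R b)) has_derivative (\<lambda>h. grad f x \<bullet> (h *\<^sub>R b))) (at 0)"
        by (rule has_derivative_compose[of "\<lambda>s. x + s *\<^sub>R b"])
          (auto intro!: derivative_eq_intros grad_has_derivative sm)
      then have "((\<lambda>s. f (x + s *\<^sub>R b)) has_real_derivative (grad f x \<bullet> b)) (at 0)"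
        by (simp add: has_field_derivative_def mult.commute[of _ "grad f x \<bullet> b"])
      then have "((\<lambda>s. (f (x + s *\<^sub>R b) - f x) / s) \<longlongrightarrow> grad f x \<bullet> b) (at 0)"
        by (simp add: DERIV_def)
      moreover have "filterlim t (at 0) sequentially"
        unfolding filterlim_at using t0 t(1) by (auto simp: less_le)
      ultimately show "(\<lambda>n. q n x) \<longlonglongrightarrow> grad f x \<bullet> b"
        unfolding q_def using filterlim_compose by (fastforce simp: add.commute)
    qed
    show "AE x in lborel. norm (q n x) \<le> indicator (cball 0 (R + norm b)) x *\<^sub>R (C * norm b)" for n
    proof (rule AE_I2)
      fix x :: 'a
      show "norm (q n x) \<le> indicator (cball 0 (R + norm b)) x *\<^sub>R (C * norm b)"
      proof (cases "x \<in> cball 0 (R + norm b)")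
        case True
        have "\<bar>f (t n *\<^sub>R b + x) - f x\<bar> \<le> C * norm b * t n"
          using lip[of "t n *\<^sub>R b + x" x] t(1)[of n] by (simp add: mult_ac)
        then show ?thesis using True t(1)[of n] by (simp add: q_def field_simps)
      next
        case False
        then have x: "norm x > R + norm b" by simp
        have "t n * norm b \<le> norm b" using t[of n] by (simp add: mult_left_le_one_le)
        then have "norm (t n *\<^sub>R b) \<le> norm b" using t(1)[of n] by simp
        then have "norm (t n *\<^sub>R b + x) > R" using x norm_diff_ineq[of x "t n *\<^sub>R b"] by (simp add: add.commute)
        then have "f (t n *\<^sub>R b + x) = 0" "f x = 0"
          using R x norm_ge_zero[of b] by (intro K(2); fastforce)+
        then show ?thesis using False by (simp add: q_def)
      qed
    qed
  qed
  moreover have "(LINT x|lborel. q n x) = 0" for n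
  proof -
    have "integrable lborel (\<lambda>x. f (t n *\<^sub>R b + x))"
      using int by (subst (asm) lborel_distr_plus[symmetric, of "t n *\<^sub>R b"])
        (subst (asm) integrable_distr_eq, auto)
    then show ?thesis unfolding q_def using int integral_translate[OF m, of "t n *\<^sub>R b"]
      by simp
  qed
  ultimately show ?thesis by (simp add: LIMSEQ_const_iff)
qed

lemma test_function_continuous:
  "test_function \<Omega> \<phi> \<Longrightarrow> continuous_on S \<phi>" "test_function \<Omega> \<phi> \<Longrightarrow> continuous_on S (grad \<phi>)"
  by (auto intro: smooth_continuous_on continuous_on_grad test_function_smooth)

lemma test_function_bounded:
  assumes "test_function \<Omega> \<phi>"
  obtains C where "C \<ge> 0" "\<And>x. \<bar>\<phi> x\<bar> \<le> C" "\<And>x. norm (grad \<phi> x) \<le> C"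
proof -
  obtain K where K': "smooth \<phi>" "compact K" "\<forall>x. x \<notin> K \<longrightarrow> \<phi> x = 0"
    using assms unfolding test_function_iff by blast
  note K = K'(1,2) K'(3)[rule_format]
  obtain C where C: "\<And>x. norm (\<phi> x) \<le> C"
    using bounded_compact_support[OF test_function_continuous(1)[OF assms] K(2,3)] by blast
  obtain D where D: "D \<ge> 0" "\<And>x. norm (grad \<phi> x) \<le> D"
    using bounded_compact_support[OF test_function_continuous(2)[OF assms] K(2) grad_support[OF K]] by blast
  show ?thesis
    using C D by (intro that[of "max C D"]) (auto simp: le_max_iff_disj)
qed

lemma test_function_integral_by_parts:
  fixes \<Omega> :: "'a::euclidean_space set"
  assumes "\<Omega> \<in> sets lebesgue" "test_function \<Omega> \<phi>" "test_function \<Omega> \<psi>"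
  shows "(LINT x|lebesgue_on \<Omega>. \<phi> x * (grad \<psi> x \<bullet> b)) = - (LINT x|lebesgue_on \<Omega>. (grad \<phi> x \<bullet> b) * \<psi> x)"
proof -
  have sm: "smooth \<phi>" "smooth \<psi>" using assms test_function_smooth by auto
  obtain K where K0: "compact K" "K \<subseteq> \<Omega>" "\<forall>x. x \<notin> K \<longrightarrow> \<phi> x = 0"
    using assms(2) unfolding test_function_iff by blast
  note K = K0(1,2) K0(3)[rule_format]
  have K': "\<And>x. x \<notin> K \<Longrightarrow> grad \<phi> x = 0" using grad_support[OF sm(1) K(1,3)] by blast
  have c: "continuous_on UNIV (\<lambda>x. \<phi> x * (grad \<psi> x \<bullet> b))"
     "continuous_on UNIV (\<lambda>x. (grad \<phi> x \<bullet> b) * \<psi> x)"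
    by (intro continuous_intros smooth_continuous_on continuous_on_grad sm)+
  note 1 = lebesgue_on_compact_support[OF c(1) K(1) _ K(2) assms(1)]
  note 2 = lebesgue_on_compact_support[OF c(2) K(1) _ K(2) assms(1)]
  have "(LINT x|lborel. grad (\<lambda>x. \<phi> x * \<psi> x) x \<bullet> b) = 0"
    by (rule integral_partial_0[OF smooth_mult[OF sm] K(1)]) (use K in auto)
  also have "(\<lambda>x. grad (\<lambda>x. \<phi> x * \<psi> x) x \<bullet> b) = (\<lambda>x. \<phi> x * (grad \<psi> x \<bullet> b) + (grad \<phi> x \<bullet> b) * \<psi> x)"
    using grad_mult[OF sm] by (simp add: inner_add_left mult.commute)
  finally have "(LINT x|lborel. \<phi> x * (grad \<psi> x \<bullet> b) + (grad \<phi> x \<bullet> b) * \<psi> x) = 0" .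
  moreover have "integrable lborel (\<lambda>x. \<phi> x * (grad \<psi> x \<bullet> b))" "integrable lborel (\<lambda>x. (grad \<phi> x \<bullet> b) * \<psi> x)"
    using K K' by (auto intro!: integrable_compact_support[OF _ K(1)] c)
  ultimately have "(LINT x|lborel. \<phi> x * (grad \<psi> x \<bullet> b)) = - (LINT x|lborel. (grad \<phi> x \<bullet> b) * \<psi> x)"
    by simp
  then show ?thesis using 1(2) 2(2) K K' by simp
qed

section \<open>Square integrable functions\<close>

abbreviation sqn :: "'a::euclidean_space set \<Rightarrow> ('a \<Rightarrow> 'b::euclidean_space) \<Rightarrow> real" where
  "sqn \<Omega> f \<equiv> LINT x|lebesgue_on \<Omega>. (norm (f x))\<^sup>2"

lemma L2_measurable: "f \<in> L2 \<Omega> \<Longrightarrow> f \<in> borel_measurable (lebesgue_on \<Omega>)"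
  and L2_integrable: "f \<in> L2 \<Omega> \<Longrightarrow> integrable (lebesgue_on \<Omega>) (\<lambda>x. (norm (f x))\<^sup>2)"
  by (auto simp: L2_def)

lemma sqn_nonneg: "sqn \<Omega> f \<ge> 0"
  by simp

lemma L2_bound:
  assumes "f \<in> borel_measurable (lebesgue_on \<Omega>)" "integrable (lebesgue_on \<Omega>) g"
    "AE x in lebesgue_on \<Omega>. (norm (f x))\<^sup>2 \<le> g x"
  shows "f \<in> L2 \<Omega>"
proof -
  note [measurable] = assms(1)
  have "integrable (lebesgue_on \<Omega>) (\<lambda>x. (norm (f x))\<^sup>2)"
    by (rule Bochner_Integration.integrable_bound[OF assms(2)])
      (measurable, use assms(3) in \<open>auto intro: abs_ge_self order_trans\<close>)
  then show ?thesis using assms(1) by (simp add: L2_def)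
qed

lemma L2_scaleR: "f \<in> L2 \<Omega> \<Longrightarrow> (\<lambda>x. c *\<^sub>R f x) \<in> L2 \<Omega>"
  by (auto simp: L2_def power_mult_distrib)

lemma norm_add_sq_le: "(norm (a + b))\<^sup>2 \<le> 2 * (norm a)\<^sup>2 + 2 * (norm (b::'b::real_inner))\<^sup>2"
proof -
  have "(norm (a + b))\<^sup>2 + (norm (a - b))\<^sup>2 = 2 * (norm a)\<^sup>2 + 2 * (norm b)\<^sup>2"
    by (simp add: power2_norm_eq_inner inner_add_left inner_add_right inner_diff_left inner_diff_right)
  then show ?thesis by (smt (verit) zero_le_power2)
qed

lemma L2_add:
  assumes "f \<in> L2 \<Omega>" "g \<in> L2 \<Omega>" shows "(\<lambda>x. f x + g x) \<in> L2 \<Omega>"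
proof (rule L2_bound)
  show "integrable (lebesgue_on \<Omega>) (\<lambda>x. 2 * (norm (f x))\<^sup>2 + 2 * (norm (g x))\<^sup>2)"
    using assms by (simp add: L2_def)
qed (use assms norm_add_sq_le in \<open>auto intro: borel_measurable_add L2_measurable\<close>)

lemma L2_diff: "f \<in> L2 \<Omega> \<Longrightarrow> g \<in> L2 \<Omega> \<Longrightarrow> (\<lambda>x. f x - g x) \<in> L2 \<Omega>"
  using L2_add[of f \<Omega> "\<lambda>x. (-1) *\<^sub>R g x"] L2_scaleR[of g \<Omega> "-1"] by simp

lemma L2_inner_integrable:
  assumes "f \<in> L2 \<Omega>" "g \<in> L2 \<Omega>" shows "integrable (lebesgue_on \<Omega>) (\<lambda>x. f x \<bullet> g x)"
proof (rule Bochner_Integration.integrable_bound)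
  note [measurable] = assms[THEN L2_measurable]
  show "integrable (lebesgue_on \<Omega>) (\<lambda>x. (norm (f x))\<^sup>2 + (norm (g x))\<^sup>2)"
    using assms by (simp add: L2_def)
  show "(\<lambda>x. f x \<bullet> g x) \<in> borel_measurable (lebesgue_on \<Omega>)" by measurable
  have "\<bar>a \<bullet> b\<bar> \<le> (norm a)\<^sup>2 + (norm b)\<^sup>2" for a b :: 'b
    using Cauchy_Schwarz_ineq2[of a b] sum_squares_bound[of "norm a" "norm b"]
      mult_nonneg_nonneg[OF norm_ge_zero norm_ge_zero, of a b] by linarith
  then show "AE x in lebesgue_on \<Omega>. norm (f x \<bullet> g x) \<le> norm ((norm (f x))\<^sup>2 + (norm (g x))\<^sup>2)"
    by (auto simp: abs_of_nonneg)
qed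

lemma sqn_scaleR: "sqn \<Omega> (\<lambda>x. c *\<^sub>R f x) = c\<^sup>2 * sqn \<Omega> f"
  by (simp add: power_mult_distrib)

lemma sqn_add:
  assumes "f \<in> L2 \<Omega>" "g \<in> L2 \<Omega>"
  shows "sqn \<Omega> (\<lambda>x. f x + g x) = sqn \<Omega> f + 2 * (LINT x|lebesgue_on \<Omega>. f x \<bullet> g x) + sqn \<Omega> g"
proof -
  have "(norm (f x + g x))\<^sup>2 = (norm (f x))\<^sup>2 + 2 * (f x \<bullet> g x) + (norm (g x))\<^sup>2" for x
    by (simp add: power2_norm_eq_inner inner_add_left inner_add_right inner_commute)
  then show ?thesis
    using L2_integrable[OF assms(1)] L2_integrable[OF assms(2)] L2_inner_integrable[OF assms] by simp
qed

lemma sqn_parallelogram: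
  assumes "f \<in> L2 \<Omega>" "g \<in> L2 \<Omega>"
  shows "sqn \<Omega> (\<lambda>x. f x + g x) + sqn \<Omega> (\<lambda>x. f x - g x) = 2 * sqn \<Omega> f + 2 * sqn \<Omega> g"
  using sqn_add[OF assms] sqn_add[OF assms(1) L2_scaleR[OF assms(2), of "-1"]] by simp

lemma sqn_add_le:
  "f \<in> L2 \<Omega> \<Longrightarrow> g \<in> L2 \<Omega> \<Longrightarrow> sqn \<Omega> (\<lambda>x. f x + g x) \<le> 2 * sqn \<Omega> f + 2 * sqn \<Omega> g"
  using sqn_parallelogram[of f \<Omega> g] sqn_nonneg[of \<Omega> "\<lambda>x. f x - g x"] by linarith

lemma L2_Cauchy_Schwarz:
  assumes "f \<in> L2 \<Omega>" "g \<in> L2 \<Omega>"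
  shows "\<bar>LINT x|lebesgue_on \<Omega>. f x \<bullet> g x\<bar> \<le> sqrt (sqn \<Omega> f) * sqrt (sqn \<Omega> g)"
proof -
  define a b c where "a = sqn \<Omega> f" and "b = (LINT x|lebesgue_on \<Omega>. f x \<bullet> g x)" and "c = sqn \<Omega> g"
  have q: "a + 2 * t * b + t\<^sup>2 * c \<ge> 0" for t
    using sqn_add[OF assms(1) L2_scaleR[OF assms(2), of t]]
      sqn_nonneg[of \<Omega> "\<lambda>x. f x + t *\<^sub>R g x"] sqn_scaleR[of \<Omega> t g]
    by (simp add: a_def b_def c_def)
  have c: "c \<ge> 0" and a: "a \<ge> 0" by (simp_all add: a_def c_def)
  have "b\<^sup>2 \<le> a * c"
  proof (cases "c = 0")
    case True
    have "b = 0"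
    proof (rule ccontr)
      assume "b \<noteq> 0"
      \<comment> \<open>With \<open>c = 0\<close> the expression is affine in \<open>t\<close>, and
        this \<open>t\<close> gives it the value -1.\<close>
      then show False using q[of "- (a + 1) / (2 * b)"] True by (simp add: field_simps)
    qed
    then show ?thesis using True by simp
  next
    case False
    then show ?thesis using q[of "- b / c"] c
      by (simp add: field_simps power2_eq_square)
  qed
  then have "\<bar>b\<bar> \<le> sqrt (a * c)" by (rule real_le_rsqrt[of "\<bar>b\<bar>", simplified])
  then show ?thesis by (simp add: a_def b_def c_def real_sqrt_mult)
qed

lemma L2_tendsto_inner:
  fixes F :: "nat \<Rightarrow> 'a::euclidean_space \<Rightarrow> 'b::euclidean_space"
  assumes "\<And>n. F n \<in> L2 \<Omega>" "f \<in> L2 \<Omega>" "\<And>n. G n \<in> L2 \<Omega>" "g \<in> L2 \<Omega>"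
    and F: "(\<lambda>n. sqn \<Omega> (\<lambda>x. F n x - f x)) \<longlonglongrightarrow> 0" and G: "(\<lambda>n. sqn \<Omega> (\<lambda>x. G n x - g x)) \<longlonglongrightarrow> 0"
  shows "(\<lambda>n. LINT x|lebesgue_on \<Omega>. F n x \<bullet> G n x) \<longlonglongrightarrow> (LINT x|lebesgue_on \<Omega>. f x \<bullet> g x)"
proof (rule LIM_zero_cancel, rule Lim_null_comparison)
  let ?s = "\<lambda>f. sqrt (sqn \<Omega> f)"
  show "\<forall>\<^sub>F n in sequentially. norm ((LINT x|lebesgue_on \<Omega>. F n x \<bullet> G n x) - (LINT x|lebesgue_on \<Omega>. f x \<bullet> g x))
     \<le> ?s (\<lambda>x. F n x - f x) * ?s (\<lambda>x. G n x - g x) + ?s (\<lambda>x. F n x - f x) * ?s g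
       + ?s f * ?s (\<lambda>x. G n x - g x)"
  proof (intro always_eventually allI)
    fix n
    note d = L2_diff[OF assms(1,2), of n] L2_diff[OF assms(3,4), of n]
    have "(LINT x|lebesgue_on \<Omega>. F n x \<bullet> G n x) - (LINT x|lebesgue_on \<Omega>. f x \<bullet> g x)
      = (LINT x|lebesgue_on \<Omega>. F n x \<bullet> G n x - f x \<bullet> g x)"
      by (intro Bochner_Integration.integral_diff[symmetric] L2_inner_integrable assms)
    also have "\<dots> = (LINT x|lebesgue_on \<Omega>. (F n x - f x) \<bullet> (G n x - g x) + (F n x - f x) \<bullet> g x + f x \<bullet> (G n x - g x))"
      by (simp add: inner_diff_left inner_diff_right algebra_simps)
    also have "\<dots> = (LINT x|lebesgue_on \<Omega>. (F n x - f x) \<bullet> (G n x - g x)) + (LINT x|lebesgue_on \<Omega>. (F n x - f x) \<bullet> g x)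
       + (LINT x|lebesgue_on \<Omega>. f x \<bullet> (G n x - g x))"
      by (subst Bochner_Integration.integral_add;
          (intro Bochner_Integration.integrable_add L2_inner_integrable d assms)?)+ simp
    finally show "norm ((LINT x|lebesgue_on \<Omega>. F n x \<bullet> G n x) - (LINT x|lebesgue_on \<Omega>. f x \<bullet> g x))
     \<le> ?s (\<lambda>x. F n x - f x) * ?s (\<lambda>x. G n x - g x) + ?s (\<lambda>x. F n x - f x) * ?s g
       + ?s f * ?s (\<lambda>x. G n x - g x)"
      using L2_Cauchy_Schwarz[OF d] L2_Cauchy_Schwarz[OF d(1) assms(4)] L2_Cauchy_Schwarz[OF assms(2) d(2)]
      by simp
  qed
  have "(\<lambda>n. ?s (\<lambda>x. F n x - f x)) \<longlonglongrightarrow> 0" "(\<lambda>n. ?s (\<lambda>x. G n x - g x)) \<longlonglongrightarrow> 0"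
    using tendsto_real_sqrt[OF F] tendsto_real_sqrt[OF G] by simp_all
  then show "(\<lambda>n. ?s (\<lambda>x. F n x - f x) * ?s (\<lambda>x. G n x - g x) + ?s (\<lambda>x. F n x - f x) * ?s g
       + ?s f * ?s (\<lambda>x. G n x - g x)) \<longlonglongrightarrow> 0"
    by (auto intro!: tendsto_add_zero tendsto_mult_zero tendsto_mult_left_zero tendsto_mult_right_zero)
qed

lemma L2_tendsto_sqn:
  assumes "\<And>n. F n \<in> L2 \<Omega>" "f \<in> L2 \<Omega>" "(\<lambda>n. sqn \<Omega> (\<lambda>x. F n x - f x)) \<longlonglongrightarrow> 0"
  shows "(\<lambda>n. sqn \<Omega> (F n)) \<longlonglongrightarrow> sqn \<Omega> f"
  unfolding power2_norm_eq_inner by (rule L2_tendsto_inner) (use assms in auto)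

text \<open>The subsequence is chosen so fast that \<open>\<Sum>k. 2\<^sup>k |d\<^sub>k|\<^sup>2\<close> is integrable for the increments
  \<open>d\<^sub>k\<close>; since \<open>2 |d\<^sub>k| \<le> 2\<^sup>k |d\<^sub>k|\<^sup>2 + 2\<^sup>-\<^sup>k\<close> it converges almost everywhere.\<close>

lemma L2_complete:
  fixes F :: "nat \<Rightarrow> 'a::euclidean_space \<Rightarrow> 'b::euclidean_space"
  assumes F: "\<And>n. F n \<in> L2 \<Omega>"
    and Cauchy: "\<And>e. e > 0 \<Longrightarrow> \<exists>N. \<forall>m\<ge>N. \<forall>n\<ge>N. sqn \<Omega> (\<lambda>x. F m x - F n x) < e"
  obtains f where "f \<in> L2 \<Omega>" "(\<lambda>n. sqn \<Omega> (\<lambda>x. F n x - f x)) \<longlonglongrightarrow> 0"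
proof -
  let ?M = "lebesgue_on \<Omega>"
  note [measurable] = L2_measurable[OF F]
  have "\<forall>k. \<exists>N. \<forall>m\<ge>N. \<forall>n\<ge>N. sqn \<Omega> (\<lambda>x. F m x - F n x) < (1/4)^k"
    using Cauchy by simp
  then obtain N where N: "\<And>k m n. m \<ge> N k \<Longrightarrow> n \<ge> N k \<Longrightarrow> sqn \<Omega> (\<lambda>x. F m x - F n x) < (1/4)^k"
    by metis
  \<comment> \<open>The partial sums make \<open>r\<close> monotone although \<open>N\<close> need
    not be, and the summand \<open>k\<close> gives \<open>r j \<ge> N k\<close> as soon as
    \<open>j \<ge> N k\<close>.\<close>
  define r where "r k = k + (\<Sum>i\<le>k. N i)" for k
  have r: "r k \<ge> N k" "r (Suc k) \<ge> r k" "r k \<ge> k" for k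
    unfolding r_def by (auto intro: trans_le_add2 member_le_sum)
  define d where "d k x = F (r (Suc k)) x - F (r k) x" for k x
  have [measurable]: "d k \<in> borel_measurable ?M" for k unfolding d_def by measurable
  have d2: "d k \<in> L2 \<Omega>" for k unfolding d_def by (intro L2_diff F)
  have "(\<integral>\<^sup>+x. (\<Sum>k. ennreal (2^k * (norm (d k x))\<^sup>2)) \<partial>?M) = (\<Sum>k. \<integral>\<^sup>+x. ennreal (2^k * (norm (d k x))\<^sup>2) \<partial>?M)"
    by (rule nn_integral_suminf) measurable
  also have "\<dots> \<le> (\<Sum>k. ennreal ((1/2)^k))"
  proof (rule suminf_le)
    fix k
    have "(\<integral>\<^sup>+x. ennreal (2^k * (norm (d k x))\<^sup>2) \<partial>?M) = ennreal (2^k * sqn \<Omega> (d k))"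
      using L2_integrable[OF d2, of k] by (subst nn_integral_eq_integral) auto
    also have "2^k * sqn \<Omega> (d k) \<le> 2^k * (1/4)^k"
      using N[OF order_trans[OF r(1) r(2)] r(1), of k] unfolding d_def by (intro mult_left_mono) auto
    also have "\<dots> = (1/2)^k" by (simp add: power_mult_distrib[symmetric])
    finally show "(\<integral>\<^sup>+x. ennreal (2^k * (norm (d k x))\<^sup>2) \<partial>?M) \<le> ennreal ((1/2)^k)"
      by (simp add: ennreal_leI)
  qed auto
  also have "\<dots> < \<infinity>"
    by (subst suminf_ennreal2) (auto simp: summable_geometric)
  finally have "AE x in ?M. (\<Sum>k. ennreal (2^k * (norm (d k x))\<^sup>2)) \<noteq> \<infinity>"
    by (intro nn_integral_PInf_AE) auto
  then have lim: "AE x in ?M. (\<lambda>k. F (r k) x) \<longlonglongrightarrow> lim (\<lambda>k. F (r k) x)"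
  proof (rule AE_mp, intro AE_I2 impI)
    fix x assume "(\<Sum>k. ennreal (2^k * (norm (d k x))\<^sup>2)) \<noteq> \<infinity>"
    then have "summable (\<lambda>k. 2^k * (norm (d k x))\<^sup>2)"
      by (intro summable_suminf_not_top) auto
    then have s: "summable (\<lambda>k. 2^k * (norm (d k x))\<^sup>2 + (1/2)^k)"
      by (intro summable_add summable_geometric) auto
    have "norm (d k x) \<le> 2^k * (norm (d k x))\<^sup>2 + (1/2)^k" for k
    proof -
      have "2 * (sqrt (2^k) * norm (d k x)) * sqrt ((1/2)^k) \<le> (sqrt (2^k) * norm (d k x))\<^sup>2 + (sqrt ((1/2)^k))\<^sup>2"
        by (rule sum_squares_bound)
      moreover have "sqrt (2^k) * sqrt ((1/2)^k) = 1"
        by (simp add: real_sqrt_mult[symmetric] power_mult_distrib[symmetric])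
      ultimately have "2 * norm (d k x) \<le> 2^k * (norm (d k x))\<^sup>2 + (1/2)^k"
        by (simp add: power_mult_distrib mult_ac)
      then show ?thesis using norm_ge_zero[of "d k x"] by linarith
    qed
    then have "summable (\<lambda>k. d k x)"
      by (intro summable_comparison_test[OF _ s]) auto
    then have "(\<lambda>n. F (r 0) x + (\<Sum>k<n. d k x)) \<longlonglongrightarrow> F (r 0) x + (\<Sum>k. d k x)"
      by (intro tendsto_intros summable_LIMSEQ)
    moreover have "F (r 0) x + (\<Sum>k<n. d k x) = F (r n) x" for n
      unfolding d_def using sum_lessThan_telescope[of "\<lambda>k. F (r k) x" n] by simp
    ultimately show "(\<lambda>k. F (r k) x) \<longlonglongrightarrow> lim (\<lambda>k. F (r k) x)"
      by (simp add: convergent_LIMSEQ_iff[symmetric] convergentI)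
  qed
  define f where "f x = lim (\<lambda>k. F (r k) x)" for x
  have [measurable]: "f \<in> borel_measurable ?M" unfolding f_def by measurable
  \<comment> \<open>Fatou's lemma along the subsequence bounds the distance to \<open>f\<close> by
    the Cauchy bound of the original sequence. It holds for every \<open>m \<ge> N k\<close>, so the
    whole sequence converges and not only the subsequence.\<close>
  have key: "(\<lambda>x. F m x - f x) \<in> L2 \<Omega> \<and> sqn \<Omega> (\<lambda>x. F m x - f x) \<le> (1/4)^k" if m: "m \<ge> N k" for m k
  proof -
    have "(\<integral>\<^sup>+x. ennreal ((norm (F m x - f x))\<^sup>2) \<partial>?M)
        = (\<integral>\<^sup>+x. liminf (\<lambda>j. ennreal ((norm (F m x - F (r j) x))\<^sup>2)) \<partial>?M)"
    proof (rule nn_integral_cong_AE, rule AE_mp[OF lim], intro AE_I2 impI)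
      fix x assume "(\<lambda>k. F (r k) x) \<longlonglongrightarrow> lim (\<lambda>k. F (r k) x)"
      then have "(\<lambda>j. ennreal ((norm (F m x - F (r j) x))\<^sup>2)) \<longlonglongrightarrow> ennreal ((norm (F m x - f x))\<^sup>2)"
        unfolding f_def by (intro tendsto_intros)
      then show "ennreal ((norm (F m x - f x))\<^sup>2) = liminf (\<lambda>j. ennreal ((norm (F m x - F (r j) x))\<^sup>2))"
        by (rule lim_imp_Liminf[OF trivial_limit_sequentially, symmetric])
    qed
    also have "\<dots> \<le> liminf (\<lambda>j. \<integral>\<^sup>+x. ennreal ((norm (F m x - F (r j) x))\<^sup>2) \<partial>?M)"
      by (rule nn_integral_liminf) measurable
    also have "\<dots> \<le> ennreal ((1/4)^k)"
    proof -
      have "\<forall>\<^sub>F j in sequentially. (\<integral>\<^sup>+x. ennreal ((norm (F m x - F (r j) x))\<^sup>2) \<partial>?M) \<le> ennreal ((1/4)^k)"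
      proof (rule eventually_sequentiallyI[of "N k"])
        fix j assume "j \<ge> N k"
        then have "r j \<ge> N k" using r(3)[of j] by simp
        then have "sqn \<Omega> (\<lambda>x. F m x - F (r j) x) \<le> (1/4)^k" using N[OF m] by (simp add: less_imp_le)
        then show "(\<integral>\<^sup>+x. ennreal ((norm (F m x - F (r j) x))\<^sup>2) \<partial>?M) \<le> ennreal ((1/4)^k)"
          using L2_integrable[OF L2_diff[OF F F], of m "r j"]
          by (subst nn_integral_eq_integral) (auto intro: ennreal_leI)
      qed
      then show ?thesis by (intro Liminf_le) auto
    qed
    finally have le: "(\<integral>\<^sup>+x. ennreal ((norm (F m x - f x))\<^sup>2) \<partial>?M) \<le> ennreal ((1/4)^k)" .
    then have int: "integrable ?M (\<lambda>x. (norm (F m x - f x))\<^sup>2)"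
      by (intro integrableI_bounded) (auto simp: le_less_trans)
    then have "(\<lambda>x. F m x - f x) \<in> L2 \<Omega>" by (simp add: L2_def)
    moreover have "ennreal (sqn \<Omega> (\<lambda>x. F m x - f x)) \<le> ennreal ((1/4)^k)"
      using le int by (subst (asm) nn_integral_eq_integral) auto
    ultimately show ?thesis by (simp add: ennreal_le_iff)
  qed
  show ?thesis
  proof
    have "(\<lambda>x. F (N 0) x - (F (N 0) x - f x)) \<in> L2 \<Omega>"
      by (rule L2_diff[OF F conjunct1[OF key[OF order_refl]]])
    then show "f \<in> L2 \<Omega>" by simp
    show "(\<lambda>n. sqn \<Omega> (\<lambda>x. F n x - f x)) \<longlonglongrightarrow> 0"
    proof (rule LIMSEQ_I)
      fix e :: real assume "e > 0"
      then obtain k where "(1/4::real)^k < e" using real_arch_pow_inv[of e "1/4"] by auto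
      then show "\<exists>no. \<forall>n\<ge>no. norm (sqn \<Omega> (\<lambda>x. F n x - f x) - 0) < e"
        using key by (intro exI[of _ "N k"]) fastforce
    qed
  qed
qed

section \<open>The fundamental lemma of the calculus of variations\<close>

text \<open>The closed balls are required to lie in \<open>U\<close>: bumps on the open balls then
  have compact support in \<open>U\<close>, and local integrability becomes integrability on each
  ball.\<close>

lemma countable_ball_cover:
  fixes U :: "'a::euclidean_space set"
  assumes "open U"
  shows "\<exists>\<F>. countable \<F> \<and> (\<forall>S\<in>\<F>. \<exists>a r. S = ball a r \<and> r > 0 \<and> cball a r \<subseteq> U) \<and> \<Union>\<F> = U"
proof -
  define \<F> where "\<F> = {ball a r | a r. r > 0 \<and> cball a r \<subseteq> U}"
  obtain \<F>' where F': "\<F>' \<subseteq> \<F>" "countable \<F>'" "\<Union>\<F>' = \<Union>\<F>"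
    using Lindelof[of \<F>] unfolding \<F>_def by blast
  have "\<Union>\<F> = U"
  proof
    show "\<Union>\<F> \<subseteq> U" unfolding \<F>_def using ball_subset_cball by blast
    show "U \<subseteq> \<Union>\<F>"
    proof
      fix x assume "x \<in> U"
      then obtain r where "r > 0" "cball x r \<subseteq> U" using assms open_contains_cball by blast
      then show "x \<in> \<Union>\<F>" unfolding \<F>_def by (intro UnionI[of "ball x r"]) auto
    qed
  qed
  then show ?thesis using F' unfolding \<F>_def by (intro exI[of _ \<F>']) auto
qed

text \<open>Here \<open>s n\<close> is \<open>n\<close> times the sum of the first bumps of a
  countable ball cover: it is 0 off \<open>U\<close> and tends to infinity on \<open>U\<close>. The
  quotient \<open>s / (1 + s)\<close> turns this into convergence to the indicator, has values in
  [0, 1] and stays smooth because \<open>1 + s \<ge> 1\<close>.\<close>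

lemma indicator_open_approx:
  fixes U :: "'a::euclidean_space set"
  assumes "open U"
  obtains v :: "nat \<Rightarrow> 'a \<Rightarrow> real" where "\<And>n. test_function U (v n)"
    "\<And>n x. 0 \<le> v n x" "\<And>n x. v n x \<le> 1" "\<And>x. (\<lambda>n. v n x) \<longlonglongrightarrow> indicator U x"
proof (cases "U = {}")
  case True
  then show ?thesis by (intro that[of "\<lambda>n x. 0"] test_function_0) auto
next
  case False
  obtain \<F>' where F': "countable \<F>'" "\<And>S. S \<in> \<F>' \<Longrightarrow> \<exists>a r. S = ball a r \<and> r > 0 \<and> cball a r \<subseteq> U" and U: "\<Union>\<F>' = U"
    using countable_ball_cover[OF assms] by blast
  have ne: "\<F>' \<noteq> {}" using U False by blast
  have "\<forall>n. \<exists>\<phi>. test_function U \<phi> \<and> (\<forall>x. \<phi> x \<ge> 0) \<and> (\<forall>x. \<phi> x > 0 \<longleftrightarrow> x \<in> from_nat_into \<F>' n)"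
  proof
    fix n
    obtain a r where ar: "from_nat_into \<F>' n = ball a r" "r > 0" "cball a r \<subseteq> U"
      using F'(2)[OF from_nat_into[OF ne]] by blast
    show "\<exists>\<phi>. test_function U \<phi> \<and> (\<forall>x. \<phi> x \<ge> 0) \<and> (\<forall>x. \<phi> x > 0 \<longleftrightarrow> x \<in> from_nat_into \<F>' n)"
      unfolding ar(1) using test_function_bump[OF ar(3,2)] .
  qed
  then obtain \<phi> where \<phi>: "\<And>n. test_function U (\<phi> n)" "\<And>n x. \<phi> n x \<ge> 0"
    "\<And>n x. \<phi> n x > 0 \<longleftrightarrow> x \<in> from_nat_into \<F>' n" by metis
  define s where "s n x = real n * (\<Sum>i\<le>n. \<phi> i x)" for n x
  have ts: "test_function U (s n)" for n
    unfolding s_def by (intro test_function_cmult test_function_sum) (auto intro: \<phi>)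
  have s0: "s n x \<ge> 0" for n x unfolding s_def by (intro mult_nonneg_nonneg sum_nonneg \<phi>) auto
  show ?thesis
  proof (rule that[of "\<lambda>n x. inverse (1 + s n x) * s n x"])
    show "test_function U (\<lambda>x. inverse (1 + s n x) * s n x)" for n
    proof (intro test_function_mult ts smooth_inverse smooth_add smooth_const)
      show "smooth (s n)" using ts test_function_smooth by blast
      show "1 + s n x \<noteq> 0" for x using s0[of n x] by linarith
    qed
    show "0 \<le> inverse (1 + s n x) * s n x" "inverse (1 + s n x) * s n x \<le> 1" for n x
      using s0[of n x] by (auto simp: field_simps)
    fix x
    show "(\<lambda>n. inverse (1 + s n x) * s n x) \<longlonglongrightarrow> indicator U x"
    proof (cases "x \<in> U")
      case False
      then show ?thesis using test_function_support[OF ts] by simp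
    next
      case True
      then obtain S where "S \<in> \<F>'" "x \<in> S" using U by blast
      then obtain i where "x \<in> from_nat_into \<F>' i" using F'(1) from_nat_into_surj by metis
      then have c: "\<phi> i x > 0" using \<phi>(3) by blast
      have "filterlim (\<lambda>n. 1 + real n * \<phi> i x) at_top sequentially"
        by (intro filterlim_tendsto_add_at_top[OF tendsto_const] filterlim_at_top_mult_tendsto_pos[OF tendsto_const c] filterlim_real_sequentially)
      then have "filterlim (\<lambda>n. 1 + s n x) at_top sequentially"
      proof (rule filterlim_at_top_mono, intro eventually_sequentiallyI[of i])
        fix n assume "n \<ge> i"
        then have "\<phi> i x \<le> (\<Sum>i\<le>n. \<phi> i x)" by (intro member_le_sum) (auto intro: \<phi>)
        then show "1 + real n * \<phi> i x \<le> 1 + s n x" unfolding s_def by (simp add: mult_left_mono)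
      qed
      then have "(\<lambda>n. inverse (1 + s n x)) \<longlonglongrightarrow> 0"
        by (rule filterlim_compose[OF tendsto_inverse_0_at_top[OF filterlim_ident]])
      then have "(\<lambda>n. 1 - inverse (1 + s n x)) \<longlonglongrightarrow> 1 - 0" by (intro tendsto_intros)
      moreover have "1 - inverse (1 + s n x) = inverse (1 + s n x) * s n x" for n
        using s0[of n x] by (simp add: field_simps)
      ultimately show ?thesis using True by simp
    qed
  qed
qed

lemma test_function_mult_integrable:
  assumes "integrable (lebesgue_on \<Omega>) h" "test_function \<Omega>' \<phi>"
  shows "integrable (lebesgue_on \<Omega>) (\<lambda>x. h x * \<phi> x)"
proof -
  obtain C where C: "C \<ge> 0" "\<And>x. \<bar>\<phi> x\<bar> \<le> C" using test_function_bounded[OF assms(2)] by metis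
  have [measurable]: "\<phi> \<in> borel_measurable borel"
    using borel_measurable_continuous_onI test_function_continuous(1)[OF assms(2)] by blast
  have "\<phi> \<in> borel_measurable (lebesgue_on \<Omega>)"
    by (intro measurable_restrict_space1 measurable_completion) simp
  then show ?thesis
    using borel_measurable_integrable[OF assms(1)] C
    by (intro Bochner_Integration.integrable_bound[OF integrable_mult_right[OF assms(1), of C]])
      (auto simp: abs_mult mult.commute[of C] intro!: AE_I2 mult_mono)
qed

text \<open>Approximating indicators of open sets by test functions gives \<open>\<integral>\<^sub>U h \<ge> 0\<close> for open \<open>U\<close>, hence for
  the \<open>G\<^sub>\<delta>\<close> hull of \<open>{h < 0}\<close>.\<close>

lemma AE_nonneg_if_test_nonneg:
  fixes \<Omega> :: "'a::euclidean_space set"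
  assumes "open \<Omega>" and h: "integrable (lebesgue_on \<Omega>) h"
    and nonneg: "\<And>\<phi>. test_function \<Omega> \<phi> \<Longrightarrow> (\<And>x. \<phi> x \<ge> 0) \<Longrightarrow> (LINT x|lebesgue_on \<Omega>. h x * \<phi> x) \<ge> 0"
  shows "AE x in lebesgue_on \<Omega>. h x \<ge> 0"
proof -
  let ?M = "lebesgue_on \<Omega>"
  note [measurable] = borel_measurable_integrable[OF h]
  have \<Omega>[measurable]: "\<Omega> \<in> sets lebesgue" using assms(1) by auto
  have bm: "f \<in> borel_measurable borel \<Longrightarrow> f \<in> borel_measurable ?M" for f :: "'a \<Rightarrow> real"
    by (intro measurable_restrict_space1 measurable_completion) simp
  have U: "(LINT x|?M. h x * indicator U x) \<ge> 0" if "open U" for U :: "'a set"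
  proof -
    obtain v :: "nat \<Rightarrow> 'a \<Rightarrow> real" where v: "\<And>n. test_function (U \<inter> \<Omega>) (v n)" "\<And>n x. 0 \<le> v n x" "\<And>n x. v n x \<le> 1"
      "\<And>x. (\<lambda>n. v n x) \<longlonglongrightarrow> indicator (U \<inter> \<Omega>) x"
      using indicator_open_approx[of "U \<inter> \<Omega>"] \<open>open U\<close> \<open>open \<Omega>\<close> by blast
    have "(\<lambda>n. LINT x|?M. h x * v n x) \<longlonglongrightarrow> (LINT x|?M. h x * indicator (U \<inter> \<Omega>) x)"
    proof (rule integral_dominated_convergence)
      show "(\<lambda>x. h x * indicator (U \<inter> \<Omega>) x) \<in> borel_measurable ?M"
        by (intro borel_measurable_times borel_measurable_integrable[OF h] bm borel_measurable_indicator
            borel_open open_Int \<open>open U\<close> \<open>open \<Omega>\<close>)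
      show "(\<lambda>x. h x * v n x) \<in> borel_measurable ?M" for n
        using borel_measurable_integrable[OF test_function_mult_integrable[OF h v(1)]] .
      show "integrable ?M (\<lambda>x. norm (h x))" using h by simp
      show "AE x in ?M. (\<lambda>n. h x * v n x) \<longlonglongrightarrow> h x * indicator (U \<inter> \<Omega>) x"
        using v(4) by (intro AE_I2 tendsto_intros)
      show "AE x in ?M. norm (h x * v n x) \<le> norm (h x)" for n
        using v(2,3) by (auto intro!: AE_I2 mult_right_le_one_le simp: abs_mult)
    qed
    moreover have "(LINT x|?M. h x * v n x) \<ge> 0" for n
      using nonneg[OF test_function_mono[OF v(1)] v(2)] by blast
    ultimately have "(LINT x|?M. h x * indicator (U \<inter> \<Omega>) x) \<ge> 0"
      by (intro LIMSEQ_le_const) auto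
    also have "(LINT x|?M. h x * indicator (U \<inter> \<Omega>) x) = (LINT x|?M. h x * indicator U x)"
      by (intro Bochner_Integration.integral_cong) (auto simp: indicator_def)
    finally show ?thesis .
  qed
  define A where "A = {x \<in> \<Omega>. h x < 0}"
  have "{x \<in> space ?M. h x < 0} \<in> sets ?M" by measurable
  then have "A \<in> sets lebesgue" using \<Omega> by (auto simp: A_def sets_restrict_space_iff)
  then obtain C T where C: "gdelta C" "T \<in> null_sets lebesgue" "A \<union> T = C"
    using lebesgue_set_almost_gdelta by metis
  from C(1) obtain F :: "nat \<Rightarrow> 'a set" where F: "\<And>n. open (F n)" "C = \<Inter>(range F)"
    by (auto elim!: gdelta.cases)
  \<comment> \<open>Finite intersections are open and decrease to \<open>C\<close>, so the
    inequality for open sets passes to \<open>C\<close> by dominated convergence.\<close>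
  define V where "V n = (\<Inter>i\<le>n. F i)" for n
  have V: "open (V n)" for n unfolding V_def by (intro open_INT) (auto simp: F)
  have "(\<lambda>n. LINT x|?M. h x * indicator (V n) x) \<longlonglongrightarrow> (LINT x|?M. h x * indicator C x)"
  proof (rule integral_dominated_convergence)
    have "C \<in> sets borel" unfolding F(2) using F(1) by (intro sets.countable_INT) auto
    then show "(\<lambda>x. h x * indicator C x) \<in> borel_measurable ?M" by (intro borel_measurable_times borel_measurable_integrable[OF h] bm) auto
    show "(\<lambda>x. h x * indicator (V n) x) \<in> borel_measurable ?M" for n
      using V by (intro borel_measurable_times borel_measurable_integrable[OF h] bm) auto
    show "integrable ?M (\<lambda>x. norm (h x))" using h by simp
    show "AE x in ?M. norm (h x * indicator (V n) x) \<le> norm (h x)" for n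
      by (auto simp: indicator_def)
    have "(\<lambda>n. indicator (V n) x :: real) \<longlonglongrightarrow> indicator C x" for x
    proof (cases "x \<in> C")
      case True
      then show ?thesis unfolding V_def F(2) by (auto simp: indicator_def)
    next
      case False
      then obtain i where "x \<notin> F i" using F(2) by blast
      then have "\<forall>\<^sub>F n in sequentially. (indicator (V n) x :: real) = 0"
        unfolding eventually_sequentially V_def by (intro exI[of _ i]) (auto simp: indicator_def)
      then show ?thesis using False by (simp add: tendsto_eventually)
    qed
    then show "AE x in ?M. (\<lambda>n. h x * indicator (V n) x) \<longlonglongrightarrow> h x * indicator C x"
      by (intro AE_I2 tendsto_intros)
  qed
  then have "(LINT x|?M. h x * indicator C x) \<ge> 0"
    using U[OF V] by (intro LIMSEQ_le_const) auto
  \<comment> \<open>Within the domain \<open>C\<close> differs from \<open>A\<close> by a null set,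
    so the integral over \<open>C\<close> is minus that of the negative part of \<open>h\<close>;
    being nonnegative, it forces the negative part to vanish.\<close>
  also have "(LINT x|?M. h x * indicator C x) = (LINT x|?M. - max 0 (- h x))"
  proof (rule integral_cong_AE)
    have "C \<in> sets borel" unfolding F(2) using F(1) by (intro sets.countable_INT) auto
    then show "(\<lambda>x. h x * indicator C x) \<in> borel_measurable ?M" by (intro borel_measurable_times borel_measurable_integrable[OF h] bm) auto
    have "AE x in lebesgue. x \<notin> T" using C(2) by (rule AE_not_in)
    then have "AE x in ?M. x \<in> \<Omega> \<and> x \<notin> T" using \<Omega> by (subst AE_restrict_space_iff) auto
    then show "AE x in ?M. h x * indicator C x = - max 0 (- h x)"
    proof eventually_elim
      case (elim x)
      then show ?case using C(3) by (auto simp: A_def indicator_def)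
    qed
  qed auto
  finally have "(LINT x|?M. max 0 (- h x)) \<le> 0" by simp
  moreover have i: "integrable ?M (\<lambda>x. max 0 (- h x))" using h by (intro integrable_max) auto
  ultimately have "(LINT x|?M. max 0 (- h x)) = 0"
    by (intro antisym) (auto intro!: integral_nonneg_AE)
  then have "AE x in ?M. max 0 (- h x) = 0"
    using integral_nonneg_eq_0_iff_AE[OF i] by auto
  then show ?thesis by eventually_elim (auto simp: max_def split: if_splits)
qed

lemma integrable_lebesgue_on_subset:
  fixes f :: "'a::euclidean_space \<Rightarrow> 'b::{banach, second_countable_topology}"
  assumes "integrable (lebesgue_on S) f" "T \<subseteq> S" "S \<in> sets lebesgue" "T \<in> sets lebesgue"
  shows "integrable (lebesgue_on T) f"
proof -
  have "integrable lebesgue (\<lambda>x. indicator T x *\<^sub>R (indicator S x *\<^sub>R f x))"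
    by (rule integrable_mult_indicator) (use assms in \<open>auto simp: integrable_restrict_space\<close>)
  also have "(\<lambda>x. indicator T x *\<^sub>R (indicator S x *\<^sub>R f x)) = (\<lambda>x. indicator T x *\<^sub>R f x)"
    using assms(2) by (force simp: indicator_def)
  finally show ?thesis using assms by (simp add: integrable_restrict_space)
qed

lemma lebesgue_on_integral_superset:
  fixes f :: "'a::euclidean_space \<Rightarrow> 'b::{banach, second_countable_topology}"
  assumes "T \<subseteq> S" "S \<in> sets lebesgue" "T \<in> sets lebesgue" "\<And>x. x \<notin> T \<Longrightarrow> f x = 0"
  shows "integral\<^sup>L (lebesgue_on S) f = integral\<^sup>L (lebesgue_on T) f"
proof -
  have "(\<lambda>x. indicator S x *\<^sub>R f x) = (\<lambda>x. indicator T x *\<^sub>R f x)"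
    using assms(1,4) by (force simp: indicator_def)
  then show ?thesis using assms(2,3) by (simp add: integral_restrict_space)
qed

lemma AE_lebesgue_on_ballsI:
  fixes \<Omega> :: "'a::euclidean_space set"
  assumes "open \<Omega>" "\<And>a r. r > 0 \<Longrightarrow> cball a r \<subseteq> \<Omega> \<Longrightarrow> AE x in lebesgue_on (ball a r). P x"
  shows "AE x in lebesgue_on \<Omega>. P x"
proof -
  obtain \<F> where F: "countable \<F>" "\<And>S. S \<in> \<F> \<Longrightarrow> \<exists>a r. S = ball a r \<and> r > 0 \<and> cball a r \<subseteq> \<Omega>" and U: "\<Union>\<F> = \<Omega>"
    using countable_ball_cover[OF assms(1)] by blast
  have "AE x in lebesgue. x \<in> S \<longrightarrow> P x" if S: "S \<in> \<F>" for S
  proof -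
    obtain a r where ar: "S = ball a r" "r > 0" "cball a r \<subseteq> \<Omega>" using F(2)[OF S] by blast
    show ?thesis using assms(2)[OF ar(2,3)] unfolding ar(1) by (subst (asm) AE_restrict_space_iff) auto
  qed
  then have "AE x in lebesgue. \<forall>S\<in>\<F>. x \<in> S \<longrightarrow> P x"
    by (subst AE_ball_countable[OF F(1)]) blast
  then have "AE x in lebesgue. x \<in> \<Omega> \<longrightarrow> P x"
    using U by (auto elim!: eventually_mono)
  then show ?thesis using assms(1) by (subst AE_restrict_space_iff) auto
qed

text \<open>The fundamental lemma concerns integrable functions, while weak gradients are integrable
  only on compact subsets. It is therefore applied on balls with closure in the domain, countably
  many of which exhaust it.\<close>

lemma weak_gradient_unique:
  fixes \<Omega> :: "'a::euclidean_space set"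
  assumes "open \<Omega>" "has_weak_gradient \<Omega> u g" "has_weak_gradient \<Omega> u g'"
  shows "AE x in lebesgue_on \<Omega>. g x = g' x"
proof (rule AE_lebesgue_on_ballsI[OF assms(1)])
  fix a :: 'a and r :: real assume r: "r > 0" "cball a r \<subseteq> \<Omega>"
  let ?B = "ball a r"
  have B: "?B \<subseteq> \<Omega>" "?B \<in> sets lebesgue" "\<Omega> \<in> sets lebesgue" "?B \<subseteq> cball a r" "cball a r \<in> sets lebesgue"
    using r assms(1) ball_subset_cball by auto
  have int: "integrable (lebesgue_on ?B) g" "integrable (lebesgue_on ?B) g'"
    using assms(2,3) r(2) B(2,4,5) unfolding has_weak_gradient_def locally_integrable_on_def
    by (meson compact_cball integrable_lebesgue_on_subset)+
  have eq: "(LINT x|lebesgue_on ?B. (g x \<bullet> b) * \<phi> x) = (LINT x|lebesgue_on ?B. (g' x \<bullet> b) * \<phi> x)"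
    if "b \<in> Basis" "test_function ?B \<phi>" for b \<phi>
  proof -
    have "(LINT x|lebesgue_on \<Omega>. (g x \<bullet> b) * \<phi> x) = (LINT x|lebesgue_on \<Omega>. (g' x \<bullet> b) * \<phi> x)"
    proof -
      have "(LINT x|lebesgue_on \<Omega>. u x * (grad \<phi> x \<bullet> b)) = - (LINT x|lebesgue_on \<Omega>. (h x \<bullet> b) * \<phi> x)"
        if "has_weak_gradient \<Omega> u h" for h
        using that \<open>b \<in> Basis\<close> test_function_mono[OF \<open>test_function ?B \<phi>\<close> B(1)]
        unfolding has_weak_gradient_def by blast
      from this[OF assms(2)] this[OF assms(3)] show ?thesis by simp
    qed
    moreover have "(LINT x|lebesgue_on \<Omega>. (g x \<bullet> b) * \<phi> x) = (LINT x|lebesgue_on ?B. (g x \<bullet> b) * \<phi> x)" for g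
      by (rule lebesgue_on_integral_superset[OF B(1,3,2)]) (use test_function_support[OF that(2)] in auto)
    ultimately show ?thesis by simp
  qed
  \<comment> \<open>Stated for arbitrary \<open>g\<close> and \<open>g'\<close>, so that exchanging
    the two gives the reverse inequality.\<close>
  have zero: "AE x in lebesgue_on ?B. g x \<bullet> b \<le> g' x \<bullet> b"
    if "b \<in> Basis" "integrable (lebesgue_on ?B) g" "integrable (lebesgue_on ?B) g'"
      "\<And>\<phi>. test_function ?B \<phi> \<Longrightarrow> (LINT x|lebesgue_on ?B. (g x \<bullet> b) * \<phi> x) = (LINT x|lebesgue_on ?B. (g' x \<bullet> b) * \<phi> x)"
    for b g g'
  proof -
    have i: "integrable (lebesgue_on ?B) (\<lambda>x. g x \<bullet> b)" "integrable (lebesgue_on ?B) (\<lambda>x. g' x \<bullet> b)"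
      using that(2,3) by auto
    have "AE x in lebesgue_on ?B. g' x \<bullet> b - g x \<bullet> b \<ge> 0"
    proof (rule AE_nonneg_if_test_nonneg)
      fix \<phi> assume \<phi>: "test_function ?B \<phi>"
      show "0 \<le> (LINT x|lebesgue_on ?B. (g' x \<bullet> b - g x \<bullet> b) * \<phi> x)"
        unfolding left_diff_distrib
        using that(4)[OF \<phi>] test_function_mult_integrable[OF i(1) \<phi>] test_function_mult_integrable[OF i(2) \<phi>]
        by simp
    qed (use i in auto)
    then show ?thesis by eventually_elim simp
  qed
  have "AE x in lebesgue_on ?B. \<forall>b\<in>Basis. g x \<bullet> b = g' x \<bullet> b"
  proof (subst AE_finite_all[OF finite_Basis], intro ballI)
    fix b :: 'a assume b: "b \<in> Basis"
    show "AE x in lebesgue_on ?B. g x \<bullet> b = g' x \<bullet> b"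
      using zero[OF b int] zero[OF b int(2,1)] eq[OF b] by (simp add: order_eq_iff)
  qed
  then show "AE x in lebesgue_on ?B. g x = g' x" by eventually_elim (auto intro: euclidean_eqI)
qed

section \<open>The Dirichlet energy\<close>

locale bounded_open =
  fixes \<Omega> :: "'a::euclidean_space set"
  assumes open_dom: "open \<Omega>" and bounded_dom: "bounded \<Omega>"
begin

abbreviation "M \<equiv> lebesgue_on \<Omega>"
abbreviation "test \<equiv> test_function \<Omega>"
abbreviation "nsq \<equiv> sqn \<Omega>"
abbreviation "wgrad \<equiv> weak_grad \<Omega>"
abbreviation "dirichlet u \<equiv> nsq (wgrad u)"

lemma dom_sets: "\<Omega> \<in> sets lebesgue"
  using open_dom by auto

sublocale finite_measure M
  using bounded_dom dom_sets by (intro finite_measure_lebesgue_on bounded_set_imp_lmeasurable)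

definition vol :: real where "vol = measure M (space M)"

lemma vol_nonneg: "vol \<ge> 0" by (simp add: vol_def)

lemma borel_measurable_domI: "f \<in> borel_measurable borel \<Longrightarrow> f \<in> borel_measurable M"
  by (intro measurable_restrict_space1 measurable_completion) simp

lemma L2_boundedI:
  assumes "f \<in> borel_measurable M" "AE x in M. norm (f x) \<le> C" shows "f \<in> L2 \<Omega>"
proof (rule L2_bound[OF assms(1)])
  show "AE x in M. (norm (f x))\<^sup>2 \<le> C\<^sup>2" using assms(2) by eventually_elim (auto intro: power_mono)
qed simp

lemma L2_imp_integrable:
  assumes "f \<in> L2 \<Omega>" shows "integrable M f"
proof (rule Bochner_Integration.integrable_bound)
  show "integrable M (\<lambda>x. 1 + (norm (f x))\<^sup>2)" using L2_integrable[OF assms] by simp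
  have "norm a \<le> 1 + (norm a)\<^sup>2" for a :: 'b
  proof -
    have "2 * norm a \<le> 1 + (norm a)\<^sup>2" using sum_squares_bound[of 1 "norm a"] by simp
    then show ?thesis using norm_ge_zero[of a] by linarith
  qed
  then show "AE x in M. norm (f x) \<le> norm (1 + (norm (f x))\<^sup>2)"
    by (auto simp: abs_of_nonneg)
qed (use assms L2_measurable in blast)

lemma L2_locally_integrable: "f \<in> L2 \<Omega> \<Longrightarrow> locally_integrable_on f \<Omega>"
  unfolding locally_integrable_on_def
  by (intro allI impI integrable_lebesgue_on_subset[OF L2_imp_integrable _ dom_sets])
    (auto intro: lmeasurable_compact fmeasurableD)

lemma L2_mult_integrable:
  fixes f g :: "'a \<Rightarrow> real" shows "f \<in> L2 \<Omega> \<Longrightarrow> g \<in> L2 \<Omega> \<Longrightarrow> integrable M (\<lambda>x. f x * g x)"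
  using L2_inner_integrable[of f \<Omega> g] by simp

lemma sqn_cong_AE:
  assumes "f \<in> L2 \<Omega>" "g \<in> L2 \<Omega>" "AE x in M. f x = g x" shows "nsq f = nsq g"
  by (rule integral_cong_AE)
    (use assms(1,2)[THEN L2_measurable] assms(3) in \<open>auto intro!: borel_measurable_power elim!: eventually_mono\<close>)

lemma test_L2:
  assumes "test \<phi>" shows "\<phi> \<in> L2 \<Omega>" "grad \<phi> \<in> L2 \<Omega>"
proof -
  obtain C where C: "\<And>x. \<bar>\<phi> x\<bar> \<le> C" "\<And>x. norm (grad \<phi> x) \<le> C" using test_function_bounded[OF assms] by metis
  show "\<phi> \<in> L2 \<Omega>" "grad \<phi> \<in> L2 \<Omega>"
    using C by (auto intro!: L2_boundedI[of _ C] borel_measurable_domI borel_measurable_continuous_onI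
        test_function_continuous[OF assms])
qed

text \<open>The way into \<open>H10\<close>: \<open>weak_grad\<close> is an arbitrary choice, so a
  concrete candidate \<open>g\<close> is supplied as a limit of gradients of test functions.
  Integration by parts survives the limit, and uniqueness identifies the choice with
  \<open>g\<close> almost everywhere.\<close>

lemma H10I:
  assumes "\<And>m. test (\<phi> m)" "u \<in> L2 \<Omega>" "g \<in> L2 \<Omega>"
    and u: "(\<lambda>m. nsq (\<lambda>x. \<phi> m x - u x)) \<longlonglongrightarrow> 0"
    and g: "(\<lambda>m. nsq (\<lambda>x. grad (\<phi> m) x - g x)) \<longlonglongrightarrow> 0"
  shows "u \<in> H10 \<Omega>" "AE x in M. wgrad u x = g x"
proof -
  have wg: "has_weak_gradient \<Omega> u g"
    unfolding has_weak_gradient_def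
  proof (intro conjI allI impI ballI L2_locally_integrable assms)
    fix \<psi> and b :: 'a assume \<psi>: "test \<psi>" and b: "b \<in> Basis"
    have db: "(\<lambda>x. grad \<psi> x \<bullet> b) \<in> L2 \<Omega>"
    proof (rule L2_bound[OF _ L2_integrable[OF test_L2(2)[OF \<psi>]]])
      show "(\<lambda>x. grad \<psi> x \<bullet> b) \<in> borel_measurable M"
        using L2_measurable[OF test_L2(2)[OF \<psi>]] by simp
      show "AE x in M. (norm (grad \<psi> x \<bullet> b))\<^sup>2 \<le> (norm (grad \<psi> x))\<^sup>2"
        using Basis_le_norm[OF b] by (intro AE_I2 power_mono) auto
    qed
    have pb: "(\<lambda>x. \<psi> x *\<^sub>R b) \<in> L2 \<Omega>"
    proof -
      obtain C where C: "\<And>x. \<bar>\<psi> x\<bar> \<le> C" using test_function_bounded[OF \<psi>] by metis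
      show ?thesis
        using C b L2_measurable[OF test_L2(1)[OF \<psi>]] by (intro L2_boundedI[of _ C]) auto
    qed
    have "(\<lambda>m. LINT x|M. \<phi> m x \<bullet> (grad \<psi> x \<bullet> b)) \<longlonglongrightarrow> (LINT x|M. u x \<bullet> (grad \<psi> x \<bullet> b))"
      by (rule L2_tendsto_inner[OF test_L2(1)[OF assms(1)] assms(2) db db u]) simp
    moreover have "(\<lambda>m. LINT x|M. grad (\<phi> m) x \<bullet> (\<psi> x *\<^sub>R b)) \<longlonglongrightarrow> (LINT x|M. g x \<bullet> (\<psi> x *\<^sub>R b))"
      by (rule L2_tendsto_inner[OF test_L2(2)[OF assms(1)] assms(3) pb pb g]) simp
    then have "(\<lambda>m. - (LINT x|M. grad (\<phi> m) x \<bullet> (\<psi> x *\<^sub>R b))) \<longlonglongrightarrow> - (LINT x|M. g x \<bullet> (\<psi> x *\<^sub>R b))"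
      by (rule tendsto_minus)
    moreover have "(LINT x|M. \<phi> m x \<bullet> (grad \<psi> x \<bullet> b)) = - (LINT x|M. grad (\<phi> m) x \<bullet> (\<psi> x *\<^sub>R b))" for m
      using test_function_integral_by_parts[OF dom_sets assms(1) \<psi>, of m b] by (simp add: mult.commute)
    ultimately have "(LINT x|M. u x \<bullet> (grad \<psi> x \<bullet> b)) = - (LINT x|M. g x \<bullet> (\<psi> x *\<^sub>R b))"
      using LIMSEQ_unique by (simp only:) blast
    then show "(LINT x|M. u x * (grad \<psi> x \<bullet> b)) = - (LINT x|M. (g x \<bullet> b) * \<psi> x)"
      by (simp add: mult.commute)
  qed
  then have "has_weak_gradient \<Omega> u (wgrad u)" unfolding weak_grad_def by (rule someI[of "has_weak_gradient \<Omega> u"])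
  then show ae: "AE x in M. wgrad u x = g x"
    by (rule weak_gradient_unique[OF open_dom _ wg])
  have gm: "g \<in> borel_measurable M" using assms(3) L2_measurable by blast
  \<comment> \<open>The chosen representative equals the measurable \<open>g\<close> only almost
    everywhere; completeness of Lebesgue measure transfers measurability. Extending both by 0 moves
    the argument from \<open>\<Omega>\<close> to the whole space.\<close>
  have "wgrad u \<in> borel_measurable M"
  proof -
    have "AE x in M. g x = wgrad u x" using ae by eventually_elim simp
    then have "AE x in lebesgue. x \<in> \<Omega> \<longrightarrow> g x = wgrad u x"
      by (subst (asm) AE_restrict_space_iff) (use dom_sets in auto)
    then have ae': "AE x in lebesgue. (if x \<in> \<Omega> then g x else 0) = (if x \<in> \<Omega> then wgrad u x else 0)"
      by eventually_elim auto
    have "(\<lambda>x. if x \<in> \<Omega> then g x else 0) \<in> borel_measurable lebesgue"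
      using gm borel_measurable_if[OF dom_sets] by blast
    then have "(\<lambda>x. if x \<in> \<Omega> then wgrad u x else 0) \<in> borel_measurable lebesgue"
      using ae' by (rule borel_measurable_AE)
    then show ?thesis using borel_measurable_if[OF dom_sets] by blast
  qed
  then have wl: "wgrad u \<in> L2 \<Omega>"
    by (rule L2_bound[OF _ L2_integrable[OF assms(3)]]) (use ae in eventually_elim, simp)
  have "nsq (\<lambda>x. wgrad u x - grad (\<phi> m) x) = nsq (\<lambda>x. grad (\<phi> m) x - g x)" for m
  proof -
    have "nsq (\<lambda>x. wgrad u x - grad (\<phi> m) x) = nsq (\<lambda>x. g x - grad (\<phi> m) x)"
      by (rule sqn_cong_AE)
        (use ae in \<open>auto intro!: L2_diff wl assms(3) test_L2(2) assms(1) elim!: eventually_mono\<close>)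
    then show ?thesis by (simp add: norm_minus_commute)
  qed
  with g have "(\<lambda>m. nsq (\<lambda>x. wgrad u x - grad (\<phi> m) x)) \<longlonglongrightarrow> 0" by simp
  moreover have "(\<lambda>m. LINT x|M. (u x - \<phi> m x)\<^sup>2) \<longlonglongrightarrow> 0"
    using u by (simp add: power2_commute)
  ultimately show "u \<in> H10 \<Omega>"
    unfolding H10_def H1_def using wl wg assms(1,2) by blast
qed

lemma H10_L2: "u \<in> H10 \<Omega> \<Longrightarrow> u \<in> L2 \<Omega>" "u \<in> H10 \<Omega> \<Longrightarrow> wgrad u \<in> L2 \<Omega>"
  unfolding H10_def H1_def by auto

lemma H10E:
  assumes "u \<in> H10 \<Omega>"
  obtains \<phi> where "\<And>m. test (\<phi> m)" "(\<lambda>m. nsq (\<lambda>x. \<phi> m x - u x)) \<longlonglongrightarrow> 0"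
    "(\<lambda>m. nsq (\<lambda>x. grad (\<phi> m) x - wgrad u x)) \<longlonglongrightarrow> 0"
proof -
  obtain \<phi> where "\<And>m. test (\<phi> m)" "(\<lambda>m. LINT x|M. (u x - \<phi> m x)\<^sup>2) \<longlonglongrightarrow> 0"
    "(\<lambda>m. nsq (\<lambda>x. wgrad u x - grad (\<phi> m) x)) \<longlonglongrightarrow> 0"
    using assms unfolding H10_def by blast
  then show ?thesis by (intro that[of \<phi>]) (simp_all add: power2_commute norm_minus_commute)
qed

lemma H10_add:
  assumes "u \<in> H10 \<Omega>" "v \<in> H10 \<Omega>"
  shows "(\<lambda>x. u x + v x) \<in> H10 \<Omega>" "AE x in M. wgrad (\<lambda>x. u x + v x) x = wgrad u x + wgrad v x"
proof -
  obtain \<phi> where \<phi>: "\<And>m. test (\<phi> m)" "(\<lambda>m. nsq (\<lambda>x. \<phi> m x - u x)) \<longlonglongrightarrow> 0"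
    "(\<lambda>m. nsq (\<lambda>x. grad (\<phi> m) x - wgrad u x)) \<longlonglongrightarrow> 0" using H10E[OF assms(1)] by blast
  obtain \<psi> where \<psi>: "\<And>m. test (\<psi> m)" "(\<lambda>m. nsq (\<lambda>x. \<psi> m x - v x)) \<longlonglongrightarrow> 0"
    "(\<lambda>m. nsq (\<lambda>x. grad (\<psi> m) x - wgrad v x)) \<longlonglongrightarrow> 0" using H10E[OF assms(2)] by blast
  have sum: "(\<lambda>m. nsq (\<lambda>x. (f m x + g m x) - (F x + G x))) \<longlonglongrightarrow> 0"
    if "\<And>m. f m \<in> L2 \<Omega>" "\<And>m. g m \<in> L2 \<Omega>" "F \<in> L2 \<Omega>" "G \<in> L2 \<Omega>"
      "(\<lambda>m. nsq (\<lambda>x. f m x - F x)) \<longlonglongrightarrow> 0" "(\<lambda>m. nsq (\<lambda>x. g m x - G x)) \<longlonglongrightarrow> 0"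
    for f g :: "nat \<Rightarrow> 'a \<Rightarrow> 'b::euclidean_space" and F G
  proof (rule Lim_null_comparison[OF always_eventually], intro allI)
    fix m
    show "norm (nsq (\<lambda>x. (f m x + g m x) - (F x + G x))) \<le>
        2 * nsq (\<lambda>x. f m x - F x) + 2 * nsq (\<lambda>x. g m x - G x)"
      using sqn_add_le[OF L2_diff[OF that(1,3)] L2_diff[OF that(2,4)], of m m]
      by (simp add: algebra_simps)
    show "(\<lambda>m. 2 * nsq (\<lambda>x. f m x - F x) + 2 * nsq (\<lambda>x. g m x - G x)) \<longlonglongrightarrow> 0"
      using tendsto_add[OF tendsto_mult_right_zero[OF that(5), of 2] tendsto_mult_right_zero[OF that(6), of 2]] by simp
  qed
  have sm: "smooth (\<phi> m)" "smooth (\<psi> m)" for m using \<phi> \<psi> test_function_smooth by auto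
  have "(\<lambda>m. nsq (\<lambda>x. grad (\<lambda>x. \<phi> m x + \<psi> m x) x - (wgrad u x + wgrad v x))) \<longlonglongrightarrow> 0"
    unfolding grad_add[OF sm] by (rule sum) (use \<phi> \<psi> assms test_L2 H10_L2 in auto)
  moreover have "(\<lambda>m. nsq (\<lambda>x. (\<phi> m x + \<psi> m x) - (u x + v x))) \<longlonglongrightarrow> 0"
    by (rule sum) (use \<phi> \<psi> assms test_L2 H10_L2 in auto)
  moreover note H10I[where \<phi>="\<lambda>m x. \<phi> m x + \<psi> m x" and u="\<lambda>x. u x + v x" and g="\<lambda>x. wgrad u x + wgrad v x",
      OF test_function_add[OF \<phi>(1) \<psi>(1)] L2_add[OF H10_L2(1)[OF assms(1)] H10_L2(1)[OF assms(2)]]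
        L2_add[OF H10_L2(2)[OF assms(1)] H10_L2(2)[OF assms(2)]]]
  ultimately show "(\<lambda>x. u x + v x) \<in> H10 \<Omega>" "AE x in M. wgrad (\<lambda>x. u x + v x) x = wgrad u x + wgrad v x"
    by simp_all
qed

lemma H10_cmult:
  assumes "u \<in> H10 \<Omega>"
  shows "(\<lambda>x. c * u x) \<in> H10 \<Omega>" "AE x in M. wgrad (\<lambda>x. c * u x) x = c *\<^sub>R wgrad u x"
proof -
  obtain \<phi> where \<phi>: "\<And>m. test (\<phi> m)" "(\<lambda>m. nsq (\<lambda>x. \<phi> m x - u x)) \<longlonglongrightarrow> 0"
    "(\<lambda>m. nsq (\<lambda>x. grad (\<phi> m) x - wgrad u x)) \<longlonglongrightarrow> 0" using H10E[OF assms(1)] by blast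
  have sm: "smooth (\<phi> m)" for m using \<phi> test_function_smooth by auto
  have "(\<lambda>m. nsq (\<lambda>x. grad (\<lambda>x. c * \<phi> m x) x - c *\<^sub>R wgrad u x)) \<longlonglongrightarrow> 0"
    unfolding grad_cmult[OF sm] scaleR_diff_right[symmetric] sqn_scaleR
    by (rule tendsto_mult_right_zero[OF \<phi>(3)])
  moreover have "(\<lambda>m. nsq (\<lambda>x. c * \<phi> m x - c * u x)) \<longlonglongrightarrow> 0"
    using tendsto_mult_right_zero[OF \<phi>(2), of "c\<^sup>2"]
    by (simp add: right_diff_distrib[symmetric] power_mult_distrib)
  moreover have "(\<lambda>x. c * u x) \<in> L2 \<Omega>" using L2_scaleR[OF H10_L2(1)[OF assms], of c] by simp
  moreover note H10I[where \<phi>="\<lambda>m x. c * \<phi> m x" and u="\<lambda>x. c * u x" and g="\<lambda>x. c *\<^sub>R wgrad u x",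
      OF test_function_cmult[OF \<phi>(1)] _ L2_scaleR[OF H10_L2(2)[OF assms]]]
  ultimately show "(\<lambda>x. c * u x) \<in> H10 \<Omega>" "AE x in M. wgrad (\<lambda>x. c * u x) x = c *\<^sub>R wgrad u x"
    by blast+
qed

lemma H10_test:
  assumes "test \<phi>" shows "\<phi> \<in> H10 \<Omega>" "AE x in M. wgrad \<phi> x = grad \<phi> x"
  using H10I[of "\<lambda>_. \<phi>" \<phi> "grad \<phi>"] test_L2[OF assms] assms by auto

text \<open>Functions equal almost everywhere are not identified, so invariance under such changes
  has to be proved; the same test functions approximate both.\<close>

lemma dirichlet_cong:
  assumes "u \<in> H10 \<Omega>" "v \<in> L2 \<Omega>" "AE x in M. u x = v x"
  shows "v \<in> H10 \<Omega>" "dirichlet v = dirichlet u"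
proof -
  obtain \<phi> where \<phi>: "\<And>m. test (\<phi> m)" "(\<lambda>m. nsq (\<lambda>x. \<phi> m x - u x)) \<longlonglongrightarrow> 0"
    "(\<lambda>m. nsq (\<lambda>x. grad (\<phi> m) x - wgrad u x)) \<longlonglongrightarrow> 0" using H10E[OF assms(1)] by blast
  have "nsq (\<lambda>x. \<phi> m x - u x) = nsq (\<lambda>x. \<phi> m x - v x)" for m
    by (rule sqn_cong_AE)
      (use assms(3) in \<open>auto intro!: L2_diff[OF test_L2(1)[OF \<phi>(1)] H10_L2(1)[OF assms(1)]]
          L2_diff[OF test_L2(1)[OF \<phi>(1)] assms(2)] elim!: eventually_mono\<close>)
  with \<phi>(2) have "(\<lambda>m. nsq (\<lambda>x. \<phi> m x - v x)) \<longlonglongrightarrow> 0" by (simp only:)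
  note * = H10I[OF \<phi>(1) assms(2) H10_L2(2)[OF assms(1)] this \<phi>(3)]
  show "v \<in> H10 \<Omega>" by (rule *(1))
  then show "dirichlet v = dirichlet u" by (intro sqn_cong_AE H10_L2(2) assms(1) *(2))
qed

lemma dirichlet_AE:
  assumes "u \<in> H10 \<Omega>" "g \<in> L2 \<Omega>" "AE x in M. wgrad u x = g x" shows "dirichlet u = nsq g"
  by (intro sqn_cong_AE H10_L2(2) assms)

lemma dirichlet_cmult: "u \<in> H10 \<Omega> \<Longrightarrow> dirichlet (\<lambda>x. c * u x) = c\<^sup>2 * dirichlet u"
  using dirichlet_AE[OF H10_cmult(1) L2_scaleR[OF H10_L2(2)] H10_cmult(2)] by (simp only: sqn_scaleR)

lemma H10_diff: "u \<in> H10 \<Omega> \<Longrightarrow> v \<in> H10 \<Omega> \<Longrightarrow> (\<lambda>x. u x - v x) \<in> H10 \<Omega>"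
  using H10_add(1)[of u "\<lambda>x. (-1) * v x"] H10_cmult(1)[of v "-1"] by simp

lemma dirichlet_add:
  assumes "u \<in> H10 \<Omega>" "v \<in> H10 \<Omega>"
  shows "dirichlet (\<lambda>x. u x + c * v x) = dirichlet u + 2 * c * (LINT x|M. wgrad u x \<bullet> wgrad v x) + c\<^sup>2 * dirichlet v"
proof -
  have "AE x in M. wgrad (\<lambda>x. u x + c * v x) x = wgrad u x + c *\<^sub>R wgrad v x"
    using H10_add(2)[OF assms(1) H10_cmult(1)[OF assms(2)], of c] H10_cmult(2)[OF assms(2), of c]
    by eventually_elim simp
  then have "dirichlet (\<lambda>x. u x + c * v x) = nsq (\<lambda>x. wgrad u x + c *\<^sub>R wgrad v x)"
    by (intro dirichlet_AE H10_add H10_cmult L2_add L2_scaleR H10_L2 assms)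
  then show ?thesis
    using sqn_add[OF H10_L2(2)[OF assms(1)] L2_scaleR[OF H10_L2(2)[OF assms(2)]], of c, unfolded sqn_scaleR]
    by simp
qed

lemma dirichlet_parallelogram:
  assumes "u \<in> H10 \<Omega>" "v \<in> H10 \<Omega>"
  shows "dirichlet (\<lambda>x. u x + v x) + dirichlet (\<lambda>x. u x - v x) = 2 * dirichlet u + 2 * dirichlet v"
  using dirichlet_add[OF assms, of 1] dirichlet_add[OF assms, of "-1"] by simp

text \<open>The weak limit of a sequence bounded in \<open>H\<^sub>0\<^sup>1\<close> is obtained without weak compactness: elements of
  almost minimal Dirichlet energy in the convex sets \<open>{\<phi>. \<parallel>\<phi> - u\<parallel>\<^sup>2 \<le> 1/(k+1)}\<close> form, by the parallelogram law,
  a Cauchy sequence in \<open>H\<^sub>0\<^sup>1\<close>.\<close>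

lemma H10_lower_semicontinuous:
  assumes u: "u \<in> L2 \<Omega>"
    and approx: "\<And>e. e > 0 \<Longrightarrow> \<exists>\<phi>. test \<phi> \<and> nsq (\<lambda>x. \<phi> x - u x) < e \<and> nsq (grad \<phi>) < C + e"
  shows "u \<in> H10 \<Omega>" "dirichlet u \<le> C"
proof -
  define c where "c k = 1 / (real k + 1)" for k
  have c: "c k > 0" for k by (simp add: c_def)
  have c_anti: "c k \<le> c j" if "j \<le> k" for j k using that by (simp add: c_def frac_le)
  have c0: "c \<longlonglongrightarrow> 0" unfolding c_def using LIMSEQ_inverse_real_of_nat by (simp add: inverse_eq_divide add.commute)
  define K where "K k = {\<phi>. test \<phi> \<and> nsq (\<lambda>x. \<phi> x - u x) \<le> c k}" for k
  define i where "i k = (INF \<phi>\<in>K k. nsq (grad \<phi>))" for k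
  have bdd: "bdd_below ((\<lambda>\<phi>. nsq (grad \<phi>)) ` K k)" for k by (rule bdd_belowI2[of _ 0]) simp
  have le: "i k \<le> nsq (grad \<phi>)" if "\<phi> \<in> K k" for k \<phi>
    unfolding i_def by (rule cINF_lower[OF bdd that])
  have ne: "\<exists>\<phi>\<in>K k. nsq (grad \<phi>) < C + e" if "e > 0" for k e
  proof -
    obtain \<phi> where "test \<phi>" "nsq (\<lambda>x. \<phi> x - u x) < min e (c k)" "nsq (grad \<phi>) < C + min e (c k)"
      using approx[of "min e (c k)"] c \<open>e > 0\<close> by auto
    then show ?thesis unfolding K_def by (intro bexI[of _ \<phi>]) auto
  qed
  have ne': "K k \<noteq> {}" for k using ne[of 1 k] by auto
  have iC: "i k \<le> C" for k
  proof (rule field_le_epsilon)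
    fix e :: real assume "e > 0"
    then show "i k \<le> C + e" using ne[of e k] le by fastforce
  qed
  have i_mono: "i k \<le> i j" if "k \<le> j" for k j
    unfolding i_def using c_anti[OF that] ne' by (intro cINF_superset_mono bdd) (auto simp: K_def)
  have "\<forall>k. \<exists>\<phi>\<in>K k. nsq (grad \<phi>) < i k + c k"
  proof
    fix k
    show "\<exists>\<phi>\<in>K k. nsq (grad \<phi>) < i k + c k"
      using cINF_less_iff[OF ne' bdd, of k "i k + c k"] c[of k] unfolding i_def by auto
  qed
  then obtain \<phi> where \<phi>: "\<And>k. \<phi> k \<in> K k" "\<And>k. nsq (grad (\<phi> k)) < i k + c k" by metis
  have t: "test (\<phi> k)" for k using \<phi>(1) by (auto simp: K_def)
  note sm = test_function_smooth[OF t]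
  note L = test_L2[OF t] L2_diff[OF test_L2(1)[OF t] u]
  \<comment> \<open>For \<open>j \<ge> k\<close> both functions lie in \<open>K k\<close>, as these
    sets shrink. \<open>K k\<close> is convex, so the midpoint has energy at least
    \<open>i k\<close>, which the parallelogram law turns into a bound on the difference of the
    gradients.\<close>
  have close: "nsq (\<lambda>x. grad (\<phi> k) x - grad (\<phi> j) x) \<le> 2 * (i j - i k) + 2 * c k + 2 * c j" if "k \<le> j" for k j
  proof -
    let ?\<psi> = "\<lambda>x. (1/2) * (\<phi> k x + \<phi> j x)"
    have "nsq (\<lambda>x. ?\<psi> x - u x) = nsq (\<lambda>x. (1/2) *\<^sub>R ((\<phi> k x - u x) + (\<phi> j x - u x)))"
      by (simp add: field_simps)
    also have "\<dots> \<le> (1/2)\<^sup>2 * (2 * nsq (\<lambda>x. \<phi> k x - u x) + 2 * nsq (\<lambda>x. \<phi> j x - u x))"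
      unfolding sqn_scaleR by (intro mult_left_mono sqn_add_le L) auto
    also have "\<dots> \<le> c k" using \<phi>(1)[of k] \<phi>(1)[of j] c_anti[OF that] by (simp add: K_def power2_eq_square)
    finally have "?\<psi> \<in> K k" 
      unfolding K_def mem_Collect_eq by (intro conjI test_function_cmult test_function_add t)
    then have "i k \<le> nsq (grad ?\<psi>)" by (rule le)
    also have "grad ?\<psi> = (\<lambda>x. (1/2) *\<^sub>R (grad (\<phi> k) x + grad (\<phi> j) x))"
      using grad_cmult[OF smooth_add[OF sm sm], of "1/2" k j] grad_add[OF sm sm, of k j] by auto
    also have "nsq \<dots> = nsq (\<lambda>x. grad (\<phi> k) x + grad (\<phi> j) x) / 4"
      unfolding sqn_scaleR by (simp add: power2_eq_square)
    finally have "i k \<le> nsq (\<lambda>x. grad (\<phi> k) x + grad (\<phi> j) x) / 4" .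
    moreover have "nsq (\<lambda>x. grad (\<phi> k) x + grad (\<phi> j) x) + nsq (\<lambda>x. grad (\<phi> k) x - grad (\<phi> j) x)
        = 2 * nsq (grad (\<phi> k)) + 2 * nsq (grad (\<phi> j))"
      by (rule sqn_parallelogram[OF L(2) L(2)])
    ultimately show ?thesis
      using \<phi>(2)[of k] \<phi>(2)[of j] unfolding right_diff_distrib by linarith
  qed
  \<comment> \<open>The minimal energies increase and stay below \<open>C\<close>; their convergence
    makes the right-hand side of \<open>close\<close> small.\<close>
  have "incseq i" using i_mono by (simp add: incseq_def)
  then obtain l where l: "i \<longlonglongrightarrow> l" using incseq_convergent[of i C] iC by blast
  obtain g where g: "g \<in> L2 \<Omega>" "(\<lambda>k. nsq (\<lambda>x. grad (\<phi> k) x - g x)) \<longlonglongrightarrow> 0"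
  proof (rule L2_complete[OF L(2)])
    fix e :: real assume e: "e > 0"
    have "(\<lambda>k. 2 * (l - i k) + 4 * c k) \<longlonglongrightarrow> 2 * (l - l) + 4 * 0" by (intro tendsto_intros l c0)
    then obtain N where N: "2 * (l - i k) + 4 * c k < e" if "k \<ge> N" for k
      using order_tendstoD(2)[of _ 0 sequentially e] e unfolding eventually_sequentially by auto
    have il: "i k \<le> l" for k using \<open>incseq i\<close> l by (rule incseq_le)
    have *: "nsq (\<lambda>x. grad (\<phi> k) x - grad (\<phi> j) x) < e" if "k \<ge> N" "k \<le> j" for k j
      using close[OF that(2)] il[of j] N[OF that(1)] c_anti[OF that(2)]
      unfolding right_diff_distrib by linarith
    show "\<exists>N. \<forall>m\<ge>N. \<forall>n\<ge>N. nsq (\<lambda>x. grad (\<phi> m) x - grad (\<phi> n) x) < e"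
      using * by (intro exI[of _ N] allI impI) (metis (no_types, lifting) nle_le norm_minus_commute Bochner_Integration.integral_cong)
  qed blast
  have lim: "(\<lambda>k. nsq (\<lambda>x. \<phi> k x - u x)) \<longlonglongrightarrow> 0"
    by (rule tendsto_sandwich[OF _ _ tendsto_const c0]) (use \<phi>(1) in \<open>auto simp: K_def\<close>)
  note * = H10I[OF t u g(1) lim g(2)]
  show "u \<in> H10 \<Omega>" by (rule *(1))
  then have "dirichlet u = nsq g" using dirichlet_AE[OF _ g(1) *(2)] by simp
  also have "\<dots> \<le> C"
  proof (rule LIMSEQ_le)
    show "(\<lambda>k. nsq (grad (\<phi> k))) \<longlonglongrightarrow> nsq g" by (rule L2_tendsto_sqn[OF L(2) g])
    show "(\<lambda>k. C + c k) \<longlonglongrightarrow> C" using tendsto_add[OF tendsto_const c0, of C] by simp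
    show "\<exists>N. \<forall>k\<ge>N. nsq (grad (\<phi> k)) \<le> C + c k" using \<phi>(2) iC by (smt (verit))
  qed
  finally show "dirichlet u \<le> C" .
qed

lemma H10_test_approx:
  assumes "u \<in> H10 \<Omega>" "e > 0"
  shows "\<exists>\<phi>. test \<phi> \<and> nsq (\<lambda>x. \<phi> x - u x) < e \<and> nsq (grad \<phi>) < dirichlet u + e"
proof -
  obtain \<phi> where \<phi>: "\<And>m. test (\<phi> m)" "(\<lambda>m. nsq (\<lambda>x. \<phi> m x - u x)) \<longlonglongrightarrow> 0"
    "(\<lambda>m. nsq (\<lambda>x. grad (\<phi> m) x - wgrad u x)) \<longlonglongrightarrow> 0" using H10E[OF assms(1)] by blast
  have "(\<lambda>m. nsq (grad (\<phi> m))) \<longlonglongrightarrow> dirichlet u"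
    by (rule L2_tendsto_sqn[OF test_L2(2)[OF \<phi>(1)] H10_L2(2)[OF assms(1)] \<phi>(3)])
  then have "\<forall>\<^sub>F m in sequentially. nsq (grad (\<phi> m)) < dirichlet u + e"
    using assms(2) by (intro order_tendstoD) auto
  moreover have "\<forall>\<^sub>F m in sequentially. nsq (\<lambda>x. \<phi> m x - u x) < e"
    by (rule order_tendstoD(2)[OF \<phi>(2) assms(2)])
  ultimately have "\<forall>\<^sub>F m in sequentially. nsq (grad (\<phi> m)) < dirichlet u + e \<and> nsq (\<lambda>x. \<phi> m x - u x) < e"
    by eventually_elim blast
  then obtain m where "nsq (grad (\<phi> m)) < dirichlet u + e \<and> nsq (\<lambda>x. \<phi> m x - u x) < e"
    unfolding eventually_sequentially by blast
  then show ?thesis using \<phi>(1) by blast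
qed

end

section \<open>Existence of minimizers\<close>

context bounded_open begin

text \<open>Transfers semicontinuity from test functions to arbitrary approximants in
  \<open>H10\<close>; the tolerances \<open>e / 4\<close> absorb the factor 2 that arises from
  squaring a sum.\<close>

lemma H10_approxI:
  assumes "u \<in> L2 \<Omega>"
    and "\<And>e. e > 0 \<Longrightarrow> \<exists>v\<in>H10 \<Omega>. nsq (\<lambda>x. v x - u x) < e \<and> dirichlet v < C + e"
  shows "u \<in> H10 \<Omega>" "dirichlet u \<le> C"
proof -
  have "\<exists>\<phi>. test \<phi> \<and> nsq (\<lambda>x. \<phi> x - u x) < e \<and> nsq (grad \<phi>) < C + e" if "e > 0" for e
  proof -
    obtain v where v: "v \<in> H10 \<Omega>" "nsq (\<lambda>x. v x - u x) < e / 4" "dirichlet v < C + e / 4"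
      using assms(2)[OF divide_pos_pos[OF \<open>e > 0\<close> zero_less_numeral]] by blast
    obtain \<phi> where \<phi>: "test \<phi>" "nsq (\<lambda>x. \<phi> x - v x) < e / 4" "nsq (grad \<phi>) < dirichlet v + e / 4"
      using H10_test_approx[OF v(1) divide_pos_pos[OF \<open>e > 0\<close> zero_less_numeral]] by blast
    have "nsq (\<lambda>x. (\<phi> x - v x) + (v x - u x)) \<le> 2 * nsq (\<lambda>x. \<phi> x - v x) + 2 * nsq (\<lambda>x. v x - u x)"
      by (intro sqn_add_le L2_diff[OF test_L2(1)[OF \<phi>(1)] H10_L2(1)[OF v(1)]] L2_diff[OF H10_L2(1)[OF v(1)] assms(1)])
    then have "nsq (\<lambda>x. \<phi> x - u x) < e" using v(2) \<phi>(2) by simp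
    then show ?thesis using \<phi> v(3) that by (intro exI[of _ \<phi>]) linarith
  qed
  from H10_lower_semicontinuous[OF assms(1) this] show "u \<in> H10 \<Omega>" "dirichlet u \<le> C" by blast+
qed

text \<open>Avoids a chain rule for weak derivatives: the absolute value is replaced by the smooth
  \<open>T\<close> below with slope at most 1, applied to test functions near \<open>u\<close>, and
  semicontinuity passes to the limit. Subtracting \<open>\<bar>a\<bar>\<close> makes the function
  vanish where \<open>u\<close> does, so compact support is preserved.\<close>

lemma H10_abs:
  assumes u: "u \<in> H10 \<Omega>"
  shows "(\<lambda>x. \<bar>u x - a\<bar> - \<bar>a\<bar>) \<in> H10 \<Omega>" (is "?w \<in> _") "dirichlet (\<lambda>x. \<bar>u x - a\<bar> - \<bar>a\<bar>) \<le> dirichlet u"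
proof -
  note [measurable] = L2_measurable[OF H10_L2(1)[OF u]]
  have w: "?w \<in> L2 \<Omega>"
    by (rule L2_bound[OF _ L2_integrable[OF H10_L2(1)[OF u]]]) (auto intro!: AE_I2 simp: abs_le_square_iff[symmetric])
  have "\<exists>\<psi>. test \<psi> \<and> nsq (\<lambda>x. \<psi> x - ?w x) < e \<and> nsq (grad \<psi>) < dirichlet u + e"
    if e: "e > 0" for e
  proof -
    \<comment> \<open>\<open>T\<close> differs from the shifted absolute value by at most
      \<open>d\<close>. This choice keeps the contribution \<open>2 * d\<^sup>2 * vol\<close> of
      that error below \<open>e / 2\<close>.\<close>
    define d where "d = sqrt (e / (8 * (vol + 1)))"
    have d: "d > 0" "2 * d\<^sup>2 * vol < e / 2"
    proof -
      show "d > 0" using e vol_nonneg unfolding d_def by (simp add: add_nonneg_pos)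
      have "2 * d\<^sup>2 * vol \<le> 2 * d\<^sup>2 * (vol + 1)" by (intro mult_left_mono) auto
      also have "\<dots> = e / 4" using e vol_nonneg unfolding d_def by (simp add: add_nonneg_pos field_simps)
      also have "\<dots> < e / 2" using e by simp
      finally show "2 * d\<^sup>2 * vol < e / 2" .
    qed
    obtain \<phi> where \<phi>: "test \<phi>" "nsq (\<lambda>x. \<phi> x - u x) < e / 4" "nsq (grad \<phi>) < dirichlet u + e / 4"
      using H10_test_approx[OF u, of "e / 4"] e by auto
    note sm = test_function_smooth[OF \<phi>(1)]
    define T where "T s = sqrt ((s - a) * (s - a) + d * d) - sqrt (a * a + d * d)" for s
    have pos: "(s - a) * (s - a) + d * d > 0" for s using d(1) by (simp add: add_nonneg_pos)
    have sqrt_le: "\<bar>x\<bar> \<le> sqrt (x * x + d * d)" "sqrt (x * x + d * d) \<le> \<bar>x\<bar> + d" for x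
    proof -
      show "\<bar>x\<bar> \<le> sqrt (x * x + d * d)" by (rule real_le_rsqrt) (simp add: power2_eq_square)
      show "sqrt (x * x + d * d) \<le> \<bar>x\<bar> + d"
        using d(1) by (intro real_le_lsqrt) (auto simp: power2_eq_square algebra_simps)
    qed
    have T_close: "\<bar>T s - (\<bar>s - a\<bar> - \<bar>a\<bar>)\<bar> \<le> d" for s
      using sqrt_le[of "s - a"] sqrt_le[of a] unfolding T_def by linarith
    have T': "(T has_real_derivative ((s - a) / sqrt ((s - a) * (s - a) + d * d))) (at s)" for s
      unfolding T_def using pos[of s] by (auto intro!: derivative_eq_intros simp: field_simps)
    have T'_le: "\<bar>(s - a) / sqrt ((s - a) * (s - a) + d * d)\<bar> \<le> 1" for s
      using sqrt_le(1)[of "s - a"] pos[of s] by (simp add: abs_divide divide_le_eq)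
    have \<psi>: "test (\<lambda>x. T (\<phi> x))"
    proof (rule test_function_supportI[OF \<phi>(1)])
      show "smooth (\<lambda>x. T (\<phi> x))" unfolding T_def
        using pos by (intro smooth_diff smooth_const smooth_sqrt smooth_add smooth_mult sm) auto
    qed (simp add: T_def)
    have "nsq (\<lambda>x. T (\<phi> x) - ?w x) \<le> (LINT x|M. 2 * d\<^sup>2 + 2 * (norm (\<phi> x - u x))\<^sup>2)"
    proof (rule integral_mono)
      note L2_integrable[OF L2_diff[OF test_L2(1)[OF \<phi>(1)] H10_L2(1)[OF u]]]
      then show "integrable M (\<lambda>x. 2 * d\<^sup>2 + 2 * (norm (\<phi> x - u x))\<^sup>2)" by simp
      show "integrable M (\<lambda>x. (norm (T (\<phi> x) - ?w x))\<^sup>2)"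
        by (intro L2_integrable L2_diff w test_L2(1) \<psi>)
      fix x
      have "\<bar>T (\<phi> x) - ?w x\<bar> \<le> d + \<bar>\<phi> x - u x\<bar>" using T_close[of "\<phi> x"] by linarith
      then have "(norm (T (\<phi> x) - ?w x))\<^sup>2 \<le> (norm (d + \<bar>\<phi> x - u x\<bar>))\<^sup>2"
        by (intro power_mono) auto
      also have "\<dots> \<le> 2 * (norm d)\<^sup>2 + 2 * (norm \<bar>\<phi> x - u x\<bar>)\<^sup>2" by (rule norm_add_sq_le)
      finally show "(norm (T (\<phi> x) - ?w x))\<^sup>2 \<le> 2 * d\<^sup>2 + 2 * (norm (\<phi> x - u x))\<^sup>2" by simp
    qed
    also have "\<dots> = 2 * d\<^sup>2 * vol + 2 * nsq (\<lambda>x. \<phi> x - u x)"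
      using L2_integrable[OF L2_diff[OF test_L2(1)[OF \<phi>(1)] H10_L2(1)[OF u]]] by (simp add: vol_def)
    also have "\<dots> < e" using d(2) \<phi>(2) by linarith
    finally have 1: "nsq (\<lambda>x. T (\<phi> x) - ?w x) < e" .
    have "nsq (grad (\<lambda>x. T (\<phi> x))) \<le> nsq (grad \<phi>)"
    proof (rule integral_mono[OF L2_integrable[OF test_L2(2)[OF \<psi>]] L2_integrable[OF test_L2(2)[OF \<phi>(1)]]])
      fix x
      show "(norm (grad (\<lambda>x. T (\<phi> x)) x))\<^sup>2 \<le> (norm (grad \<phi> x))\<^sup>2"
        unfolding grad_compose[OF sm T'] norm_scaleR
        by (intro power_mono mult_left_le_one_le[OF norm_ge_zero abs_ge_zero T'_le]) simp
    qed
    then have "nsq (grad (\<lambda>x. T (\<phi> x))) < dirichlet u + e" using \<phi>(3) e by linarith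
    then show ?thesis using 1 \<psi> by blast
  qed
  from H10_lower_semicontinuous[OF w this]
  show "?w \<in> H10 \<Omega>" "dirichlet (\<lambda>x. \<bar>u x - a\<bar> - \<bar>a\<bar>) \<le> dirichlet u" by blast+
qed

lemma dirichlet_half: "u \<in> H10 \<Omega> \<Longrightarrow> dirichlet (\<lambda>x. (1/2) * u x) = dirichlet u / 4"
  by (subst dirichlet_cmult) (simp_all add: power_divide)

lemma H10_half_combination:
  assumes "u \<in> H10 \<Omega>" "v \<in> H10 \<Omega>" "dirichlet v \<le> dirichlet u"
  shows "(\<lambda>x. (1/2) * (u x + v x)) \<in> H10 \<Omega>" "dirichlet (\<lambda>x. (1/2) * (u x + v x)) \<le> dirichlet u"
    "(\<lambda>x. (1/2) * (u x - v x)) \<in> H10 \<Omega>" "dirichlet (\<lambda>x. (1/2) * (u x - v x)) \<le> dirichlet u"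
proof -
  note p = dirichlet_parallelogram[OF assms(1,2)] H10_add(1)[OF assms(1,2)] H10_diff[OF assms(1,2)]
  show "(\<lambda>x. (1/2) * (u x + v x)) \<in> H10 \<Omega>" "(\<lambda>x. (1/2) * (u x - v x)) \<in> H10 \<Omega>"
    by (rule H10_cmult(1)[OF p(2)], rule H10_cmult(1)[OF p(3)])
  show "dirichlet (\<lambda>x. (1/2) * (u x + v x)) \<le> dirichlet u" "dirichlet (\<lambda>x. (1/2) * (u x - v x)) \<le> dirichlet u"
    using p assms(3) sqn_nonneg[of \<Omega> "wgrad (\<lambda>x. u x + v x)"] sqn_nonneg[of \<Omega> "wgrad (\<lambda>x. u x - v x)"]
    unfolding dirichlet_half[OF p(2)] dirichlet_half[OF p(3)] by linarith+
qed

text \<open>Each of the two cuts is half the sum or half the difference of a function and a shifted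
  absolute value of it. The latter has no more energy than the function, hence neither has the
  combination.\<close>

lemma H10_clamp:
  assumes "u \<in> H10 \<Omega>" "\<delta> \<ge> 0"
  shows "(\<lambda>x. max 0 (min (u x) \<delta>)) \<in> H10 \<Omega>" "dirichlet (\<lambda>x. max 0 (min (u x) \<delta>)) \<le> dirichlet u"
proof -
  have 1: "(\<lambda>x. min (u x) \<delta>) = (\<lambda>x. (1/2) * (u x - (\<bar>u x - \<delta>\<bar> - \<bar>\<delta>\<bar>)))"
    using assms(2) by (auto simp: min_def fun_eq_iff)
  note m = H10_half_combination(3,4)[OF assms(1) H10_abs[OF assms(1), of \<delta>], folded 1]
  have 2: "(\<lambda>x. max 0 (min (u x) \<delta>)) = (\<lambda>x. (1/2) * (min (u x) \<delta> + (\<bar>min (u x) \<delta> - 0\<bar> - \<bar>0\<bar>)))"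
    by (auto simp: max_def fun_eq_iff)
  note n = H10_half_combination(1,2)[OF m(1) H10_abs[OF m(1), of 0], folded 2]
  show "(\<lambda>x. max 0 (min (u x) \<delta>)) \<in> H10 \<Omega>" by (rule n(1))
  show "dirichlet (\<lambda>x. max 0 (min (u x) \<delta>)) \<le> dirichlet u" using n(2) m(2) by linarith
qed

text \<open>\<open>max\<close> and \<open>min\<close> are \<open>A + B\<close> and
  \<open>A - B\<close>, where \<open>A\<close> is half the sum and \<open>B\<close> half of
  \<open>\<bar>u - v\<bar>\<close>. The parallelogram law is used twice and is an identity; only
  passing from \<open>u - v\<close> to its absolute value may lose energy.\<close>

lemma H10_lattice:
  assumes u: "u \<in> H10 \<Omega>" and v: "v \<in> H10 \<Omega>"
  shows "(\<lambda>x. max (u x) (v x)) \<in> H10 \<Omega>" "(\<lambda>x. min (u x) (v x)) \<in> H10 \<Omega>"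
    "dirichlet (\<lambda>x. max (u x) (v x)) + dirichlet (\<lambda>x. min (u x) (v x)) \<le> dirichlet u + dirichlet v"
proof -
  let ?A = "\<lambda>x. (1/2) * (u x + v x)" and ?B = "\<lambda>x. (1/2) * (\<bar>(u x - v x) - 0\<bar> - \<bar>0\<bar>)"
  note d = H10_diff[OF u v] and s = H10_add(1)[OF u v]
  note a = H10_abs[OF d, of 0]
  have A: "?A \<in> H10 \<Omega>" and B: "?B \<in> H10 \<Omega>" by (rule H10_cmult[OF s], rule H10_cmult[OF a(1)])
  have mx: "(\<lambda>x. max (u x) (v x)) = (\<lambda>x. ?A x + ?B x)" and mn: "(\<lambda>x. min (u x) (v x)) = (\<lambda>x. ?A x - ?B x)"
    by (auto simp: max_def min_def fun_eq_iff field_simps)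
  show "(\<lambda>x. max (u x) (v x)) \<in> H10 \<Omega>" unfolding mx by (rule H10_add[OF A B])
  show "(\<lambda>x. min (u x) (v x)) \<in> H10 \<Omega>" unfolding mn by (rule H10_diff[OF A B])
  have "dirichlet (\<lambda>x. max (u x) (v x)) + dirichlet (\<lambda>x. min (u x) (v x)) = 2 * dirichlet ?A + 2 * dirichlet ?B"
    unfolding mx mn by (rule dirichlet_parallelogram[OF A B])
  then show "dirichlet (\<lambda>x. max (u x) (v x)) + dirichlet (\<lambda>x. min (u x) (v x)) \<le> dirichlet u + dirichlet v"
    using a(2) dirichlet_parallelogram[OF u v]
    unfolding dirichlet_half[OF s] dirichlet_half[OF a(1)] by linarith
qed

section \<open>The energy on functions with values in a bounded interval\<close>

definition energy :: "(real \<Rightarrow> real) \<Rightarrow> ('a \<Rightarrow> real) \<Rightarrow> real" where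
  "energy h u = dirichlet u / 2 - (LINT x|M. h (u x))"

text \<open>The bounds hold at every point and not just almost everywhere, so that suprema, infima
  and limits of sequences can be formed pointwise without null sets.\<close>

definition between :: "real \<Rightarrow> ('a \<Rightarrow> real) set" where
  "between \<delta> = {u \<in> H10 \<Omega>. \<forall>x. 0 \<le> u x \<and> u x \<le> \<delta>}"

lemma H10_0: "(\<lambda>x. 0) \<in> H10 \<Omega>"
  by (rule H10_test(1)[OF test_function_0])

lemma lipschitz_measurable:
  fixes h :: "real \<Rightarrow> real"
  assumes "L-lipschitz_on UNIV h" "u \<in> borel_measurable M" shows "(\<lambda>x. h (u x)) \<in> borel_measurable M"
  using assms(2) borel_measurable_continuous_onI[OF lipschitz_on_continuous_on[OF assms(1)]]
  by (rule measurable_compose)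

lemma lipschitz_integrable:
  fixes h :: "real \<Rightarrow> real"
  assumes h: "L-lipschitz_on UNIV h" and u: "u \<in> L2 \<Omega>" shows "integrable M (\<lambda>x. h (u x))"
proof (rule Bochner_Integration.integrable_bound)
  show "integrable M (\<lambda>x. \<bar>h 0\<bar> + L * \<bar>u x\<bar>)" using L2_imp_integrable[OF u] by simp
  show "(\<lambda>x. h (u x)) \<in> borel_measurable M" using lipschitz_measurable[OF h L2_measurable[OF u]] .
  have "\<bar>h s\<bar> \<le> \<bar>h 0\<bar> + L * \<bar>s\<bar>" for s
    using lipschitz_onD[OF h, of s 0] by (auto simp: dist_real_def)
  then show "AE x in M. norm (h (u x)) \<le> norm (\<bar>h 0\<bar> + L * \<bar>u x\<bar>)"
    using lipschitz_on_nonneg[OF h] by (auto simp: abs_of_nonneg)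
qed

lemma lipschitz_0_abs_le:
  fixes s :: real and h :: "real \<Rightarrow> real"
  assumes "L-lipschitz_on UNIV h" "h 0 = 0" shows "\<bar>h s\<bar> \<le> L * \<bar>s\<bar>"
  using lipschitz_onD[OF assms(1), of s 0] assms(2) by (simp add: dist_real_def)

lemma integral_bounded_le:
  assumes "integrable M f" "\<And>x. f x \<le> c" shows "(LINT x|M. f x) \<le> c * vol"
proof -
  have "(LINT x|M. f x) \<le> (LINT x|M. c)" using assms by (intro integral_mono) auto
  then show ?thesis by (simp add: vol_def mult.commute)
qed

text \<open>On [0, \<delta>] the potential is at most \<open>L * \<delta>\<close>. The first bound
  keeps negative energies close to 0 for small \<open>\<delta>\<close>, the second turns a
  nonpositive energy into a small norm.\<close>

lemma energy_lower_bound: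
  assumes h: "L-lipschitz_on UNIV h" "h 0 = 0" and u: "u \<in> between \<delta>"
  shows "- (L * \<delta> * vol) \<le> energy h u" "dirichlet u \<le> 2 * (energy h u + L * \<delta> * vol)"
proof -
  have "(LINT x|M. h (u x)) \<le> L * \<delta> * vol"
  proof (rule integral_bounded_le)
    show "integrable M (\<lambda>x. h (u x))"
      using u by (intro lipschitz_integrable[OF h(1)] H10_L2) (auto simp: between_def)
    fix x
    have "h (u x) \<le> L * \<bar>u x\<bar>" using lipschitz_0_abs_le[OF h, of "u x"] by linarith
    also have "\<dots> \<le> L * \<delta>" using u lipschitz_on_nonneg[OF h(1)] by (intro mult_left_mono) (auto simp: between_def)
    finally show "h (u x) \<le> L * \<delta>" .
  qed
  then show "- (L * \<delta> * vol) \<le> energy h u" "dirichlet u \<le> 2 * (energy h u + L * \<delta> * vol)"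
    unfolding energy_def using sqn_nonneg[of \<Omega> "wgrad u"] by (linarith, simp add: algebra_simps)
qed

text \<open>With values in [0, \<delta>] and finite measure, pointwise convergence gives L2
  convergence and convergence of the potential term by domination. The Dirichlet part is then
  bounded through the energies, and semicontinuity applies.\<close>

lemma energy_limit:
  assumes h: "L-lipschitz_on UNIV h"
    and v: "\<And>m. v m \<in> between \<delta>" "\<And>x. (\<lambda>m. v m x) \<longlonglongrightarrow> w x" "\<And>m. energy h (v m) \<le> c"
  shows "w \<in> between \<delta>" "energy h w \<le> c"
proof -
  have vH: "v m \<in> H10 \<Omega>" and v0: "0 \<le> v m x" and vd: "v m x \<le> \<delta>" for m x
    using v(1)[of m] by (auto simp: between_def)
  have vm: "v m \<in> borel_measurable M" for m by (rule L2_measurable[OF H10_L2(1)[OF vH]])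
  have w0: "0 \<le> w x" and wd: "w x \<le> \<delta>" for x
    using LIMSEQ_le_const[OF v(2)[of x], of 0] LIMSEQ_le_const2[OF v(2)[of x], of \<delta>] v0 vd by auto
  have wm: "w \<in> borel_measurable M"
    by (rule borel_measurable_LIMSEQ_metric[OF vm]) (use v(2) in auto)
  then have w2: "w \<in> L2 \<Omega>" using w0 wd by (intro L2_boundedI[of _ \<delta>]) auto
  have lim1: "(\<lambda>m. nsq (\<lambda>x. v m x - w x)) \<longlonglongrightarrow> (LINT x|M. 0)"
  proof (rule integral_dominated_convergence)
    show "(\<lambda>x. (norm (v m x - w x))\<^sup>2) \<in> borel_measurable M" for m using vm[of m] wm by measurable
    show "AE x in M. (\<lambda>m. (norm (v m x - w x))\<^sup>2) \<longlonglongrightarrow> 0"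
    proof (rule AE_I2)
      fix x
      have "(\<lambda>m. (norm (v m x - w x))\<^sup>2) \<longlonglongrightarrow> (norm (w x - w x))\<^sup>2" by (intro tendsto_intros v)
      then show "(\<lambda>m. (norm (v m x - w x))\<^sup>2) \<longlonglongrightarrow> 0" by simp
    qed
    show "AE x in M. norm ((norm (v m x - w x))\<^sup>2) \<le> \<delta>\<^sup>2" for m
    proof (rule AE_I2)
      fix x
      have "\<bar>v m x - w x\<bar> \<le> \<delta>" using v0[of m x] vd[of m x] w0[of x] wd[of x] by linarith
      then have "\<bar>v m x - w x\<bar>\<^sup>2 \<le> \<delta>\<^sup>2" by (intro power_mono) auto
      then show "norm ((norm (v m x - w x))\<^sup>2) \<le> \<delta>\<^sup>2" by simp
    qed
  qed auto
  have lim2: "(\<lambda>m. LINT x|M. h (v m x)) \<longlonglongrightarrow> (LINT x|M. h (w x))"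
  proof (rule integral_dominated_convergence)
    show "(\<lambda>x. h (w x)) \<in> borel_measurable M" "(\<lambda>x. h (v m x)) \<in> borel_measurable M" for m
      using lipschitz_measurable[OF h] vm wm by auto
    show "AE x in M. (\<lambda>m. h (v m x)) \<longlonglongrightarrow> h (w x)"
      using lipschitz_on_continuous_on[OF h] v(2)
      by (intro AE_I2) (auto intro: continuous_on_tendsto_compose)
    show "AE x in M. norm (h (v m x)) \<le> \<bar>h 0\<bar> + L * \<delta>" for m
    proof (rule AE_I2)
      fix x
      have "\<bar>h (v m x) - h 0\<bar> \<le> L * \<bar>v m x\<bar>" using lipschitz_onD[OF h, of "v m x" 0] by (simp add: dist_real_def)
      also have "\<dots> \<le> L * \<delta>" using v0[of m x] vd[of m x] lipschitz_on_nonneg[OF h] by (intro mult_left_mono) auto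
      finally show "norm (h (v m x)) \<le> \<bar>h 0\<bar> + L * \<delta>" by simp
    qed
  qed auto
  have "\<exists>v\<in>H10 \<Omega>. nsq (\<lambda>x. v x - w x) < e \<and> dirichlet v < 2 * (c + (LINT x|M. h (w x))) + e" if e: "e > 0" for e
  proof -
    have "\<forall>\<^sub>F m in sequentially. nsq (\<lambda>x. v m x - w x) < e"
      using lim1 e by (intro order_tendstoD(2)[of _ 0]) auto
    moreover have "\<forall>\<^sub>F m in sequentially. (LINT x|M. h (v m x)) < (LINT x|M. h (w x)) + e / 2"
      using lim2 e by (intro order_tendstoD(2)) auto
    ultimately have "\<forall>\<^sub>F m in sequentially. nsq (\<lambda>x. v m x - w x) < e \<and> (LINT x|M. h (v m x)) < (LINT x|M. h (w x)) + e / 2"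
      by eventually_elim blast
    then obtain m where "nsq (\<lambda>x. v m x - w x) < e" "(LINT x|M. h (v m x)) < (LINT x|M. h (w x)) + e / 2"
      unfolding eventually_sequentially by blast
    then show ?thesis using vH[of m] v(3)[of m] unfolding energy_def
      by (intro bexI[of _ "v m"] conjI) (auto simp: algebra_simps)
  qed
  from H10_approxI[OF w2 this] show "w \<in> between \<delta>" "energy h w \<le> c"
    using w0 wd by (auto simp: between_def energy_def)
qed

text \<open>At each point \<open>max\<close> and \<open>min\<close> take the two values of
  \<open>u\<close> and \<open>v\<close>, so the potential terms add up exactly and the Dirichlet
  inequality decides.\<close>

lemma energy_lattice:
  assumes h: "L-lipschitz_on UNIV h" and u: "u \<in> between \<delta>" and v: "v \<in> between \<delta>"
  shows "(\<lambda>x. max (u x) (v x)) \<in> between \<delta>" "(\<lambda>x. min (u x) (v x)) \<in> between \<delta>"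
    "energy h (\<lambda>x. max (u x) (v x)) + energy h (\<lambda>x. min (u x) (v x)) \<le> energy h u + energy h v"
proof -
  have uv: "u \<in> H10 \<Omega>" "v \<in> H10 \<Omega>" using u v by (auto simp: between_def)
  note l = H10_lattice[OF uv]
  show "(\<lambda>x. max (u x) (v x)) \<in> between \<delta>" "(\<lambda>x. min (u x) (v x)) \<in> between \<delta>"
    using u v l by (auto simp: between_def min_le_iff_disj le_max_iff_disj)
  note i = lipschitz_integrable[OF h H10_L2(1)]
  have "(LINT x|M. h (max (u x) (v x))) + (LINT x|M. h (min (u x) (v x))) = (LINT x|M. h (max (u x) (v x)) + h (min (u x) (v x)))"
    using i[OF l(1)] i[OF l(2)] by simp
  also have "(\<lambda>x. h (max (u x) (v x)) + h (min (u x) (v x))) = (\<lambda>x. h (u x) + h (v x))"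
    by (auto simp: max_def min_def)
  also have "(LINT x|M. h (u x) + h (v x)) = (LINT x|M. h (u x)) + (LINT x|M. h (v x))"
    using i[OF uv(1)] i[OF uv(2)] by simp
  finally show "energy h (\<lambda>x. max (u x) (v x)) + energy h (\<lambda>x. min (u x) (v x)) \<le> energy h u + energy h v"
    using l(3) unfolding energy_def by linarith
qed

text \<open>The maximum of \<open>u n\<close>, ..., \<open>u (n + m)\<close>. The supremum over
  \<open>m\<close> followed by the infimum over \<open>n\<close> gives the limes superior as two
  monotone limits, each covered by \<open>energy_limit\<close>.\<close>

primrec running_max :: "(nat \<Rightarrow> 'a \<Rightarrow> real) \<Rightarrow> nat \<Rightarrow> nat \<Rightarrow> 'a \<Rightarrow> real" where
  "running_max u n 0 = u n"
| "running_max u n (Suc m) = (\<lambda>x. max (running_max u n m x) (u (Suc (n + m)) x))"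

lemma running_max_shift: "running_max u (Suc n) m x \<le> running_max u n (Suc m) x"
  by (induction m) (auto simp: le_max_iff_disj)

text \<open>Submodularity of the energy replaces compactness: the excess energies of the terms of a
  rapidly minimising sequence add up when maxima are taken, so its limes superior is a minimiser.\<close>

lemma exists_minimizer_between:
  assumes h: "L-lipschitz_on UNIV h" "h 0 = 0" and \<delta>: "\<delta> \<ge> 0"
  shows "\<exists>u\<in>between \<delta>. \<forall>w\<in>between \<delta>. energy h u \<le> energy h w"
proof -
  define I where "I = (INF u\<in>between \<delta>. energy h u)"
  have bdd: "bdd_below (energy h ` between \<delta>)"
    using energy_lower_bound(1)[OF h] by (intro bdd_belowI2) auto
  have I: "I \<le> energy h u" if "u \<in> between \<delta>" for u
    unfolding I_def by (rule cINF_lower[OF bdd that])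
  have ne: "between \<delta> \<noteq> {}" using H10_0 \<delta> by (auto simp: between_def)
  have "\<forall>n. \<exists>u\<in>between \<delta>. energy h u < I + (1/2)^n"
  proof
    fix n
    have "I < I + (1/2)^n" by simp
    then show "\<exists>u\<in>between \<delta>. energy h u < I + (1/2)^n"
      using cINF_less_iff[OF ne bdd] unfolding I_def by blast
  qed
  then obtain u where u: "\<And>n. u n \<in> between \<delta>" "\<And>n. energy h (u n) < I + (1/2)^n" by metis
  let ?W = "running_max u"
  \<comment> \<open>A new term adds at most its own excess, because the minimum taken with it has
    energy at least \<open>I\<close>. The bound is the geometric sum of the excesses
    \<open>(1/2)^j\<close> for \<open>j\<close> from \<open>n\<close> to
    \<open>n + m\<close>.\<close>
  have W: "?W n m \<in> between \<delta> \<and> energy h (?W n m) \<le> I + 2 * (1/2)^n - (1/2)^(n + m)" for n m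
  proof (induction m)
    case 0 then show ?case using u[of n] by simp
  next
    case (Suc m)
    note l = energy_lattice[OF h(1) conjunct1[OF Suc] u(1)[of "Suc (n + m)"]]
    have p: "(1/2::real) ^ (n + m) = 2 * (1/2) ^ Suc (n + m)" by simp
    have "energy h (\<lambda>x. max (?W n m x) (u (Suc (n + m)) x)) \<le> I + 2 * (1/2)^n - (1/2) ^ Suc (n + m)"
      using l(3) I[OF l(2)] conjunct2[OF Suc] u(2)[of "Suc (n + m)"] p by linarith
    then show ?case using l(1) by (simp only: running_max.simps add_Suc_right)
  qed
  have inc: "incseq (\<lambda>m. ?W n m x)" for n x by (rule incseq_SucI) simp
  have Wd: "0 \<le> ?W n m x" "?W n m x \<le> \<delta>" for n m x using W[of n m] by (auto simp: between_def)
  define w where "w n x = (SUP m. ?W n m x)" for n x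
  have bdW: "bdd_above (range (\<lambda>m. ?W n m x))" for n x by (rule bdd_aboveI2[of _ _ \<delta>]) (rule Wd)
  have Wlim: "(\<lambda>m. ?W n m x) \<longlonglongrightarrow> w n x" for n x
    unfolding w_def by (rule LIMSEQ_incseq_SUP[OF bdW inc])
  have w: "w n \<in> between \<delta>" "energy h (w n) \<le> I + 2 * (1/2)^n" for n
  proof -
    have "energy h (?W n m) \<le> I + 2 * (1/2)^n" for m
      using W[of n m] zero_le_power[of "1/2::real" "n + m"] by linarith
    from energy_limit[OF h(1) conjunct1[OF W] Wlim this]
    show "w n \<in> between \<delta>" "energy h (w n) \<le> I + 2 * (1/2)^n" by blast+
  qed
  have dec: "decseq (\<lambda>n. w n x)" for x
  proof (rule decseq_SucI)
    fix n
    show "w (Suc n) x \<le> w n x" unfolding w_def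
    proof (rule cSUP_least)
      fix m show "?W (Suc n) m x \<le> (SUP m. ?W n m x)"
        using running_max_shift cSUP_upper[OF UNIV_I bdW] by (rule order_trans)
    qed simp
  qed
  define v where "v x = (INF n. w n x)" for x
  have vlim: "(\<lambda>n. w n x) \<longlonglongrightarrow> v x" for x
  proof -
    have "bdd_below (range (\<lambda>n. w n x))"
      using w(1) by (intro bdd_belowI2[of _ 0]) (auto simp: between_def)
    then show ?thesis unfolding v_def by (rule LIMSEQ_decseq_INF[OF _ dec])
  qed
  have v: "v \<in> between \<delta> \<and> energy h v \<le> I + 2 * (1/2)^N" for N
  proof -
    have "energy h (w (n + N)) \<le> I + 2 * (1/2)^N" for n
      using w(2)[of "n + N"] power_decreasing[of N "n + N" "1/2::real"] by linarith
    from energy_limit[OF h(1) w(1) LIMSEQ_ignore_initial_segment[OF vlim] this]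
    show ?thesis by blast
  qed
  have "(\<lambda>N. I + 2 * (1/2::real)^N) \<longlonglongrightarrow> I + 2 * 0"
    by (intro tendsto_intros LIMSEQ_power_zero) auto
  then have "energy h v \<le> I + 2 * 0" by (rule LIMSEQ_le_const) (use v in auto)
  then show ?thesis using v I by (intro bexI[of _ v] ballI) (auto intro: order_trans)
qed

text \<open>Minimality against all of \<open>H10\<close>, not only among values in [0, \<delta>],
  admits variations in both directions; these lead to an equation and not merely to a variational
  inequality.\<close>

lemma exists_minimizer:
  assumes h: "L-lipschitz_on UNIV h" "\<And>s. s \<le> 0 \<Longrightarrow> h s = 0" "\<And>s. s \<ge> \<delta> \<Longrightarrow> h s \<le> h \<delta>" and \<delta>: "\<delta> \<ge> 0"
  shows "\<exists>u\<in>between \<delta>. \<forall>w\<in>H10 \<Omega>. energy h u \<le> energy h w"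
proof -
  obtain u where u: "u \<in> between \<delta>" "\<And>w. w \<in> between \<delta> \<Longrightarrow> energy h u \<le> energy h w"
    using exists_minimizer_between[OF h(1,2) \<delta>] by auto
  have "energy h u \<le> energy h w" if w: "w \<in> H10 \<Omega>" for w
  proof -
    let ?c = "\<lambda>x. max 0 (min (w x) \<delta>)"
    note c = H10_clamp[OF w \<delta>]
    have "?c \<in> between \<delta>" using c(1) \<delta> by (auto simp: between_def)
    then have "energy h u \<le> energy h ?c" by (rule u(2))
    moreover have "(LINT x|M. h (w x)) \<le> (LINT x|M. h (?c x))"
    proof (rule integral_mono)
      show "integrable M (\<lambda>x. h (w x))" "integrable M (\<lambda>x. h (?c x))"
        using lipschitz_integrable[OF h(1)] H10_L2(1) w c(1) by auto
      show "h (w x) \<le> h (?c x)" for x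
        using h(2)[of "w x"] h(2)[of 0] h(3)[of "w x"] \<delta> by (auto simp: max_def min_def)
    qed
    ultimately show ?thesis using c(2) unfolding energy_def by linarith
  qed
  then show ?thesis using u(1) by blast
qed

end

section \<open>The Euler-Lagrange equation\<close>

lemma le_if_le_add_small:
  fixes a b c :: real
  assumes "t0 > 0" "\<And>t. 0 < t \<Longrightarrow> t < t0 \<Longrightarrow> a \<le> b + t * c"
  shows "a \<le> b"
proof (rule tendsto_lowerbound)
  show "((\<lambda>t. b + t * c) \<longlongrightarrow> b) (at_right 0)" by (auto intro!: tendsto_eq_intros)
  show "\<forall>\<^sub>F t in at_right 0. a \<le> b + t * c"
    unfolding eventually_at_right_field using assms by auto
qed simp

context bounded_open begin

text \<open>The Riesz representation, obtained by minimizing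
  \<open>nsq \<phi> / 2 - l \<phi>\<close> over test functions: a minimizing sequence is Cauchy by
  the parallelogram law, and the vanishing first variation at its limit is the claim.\<close>

lemma L2_representation:
  fixes l :: "('a \<Rightarrow> real) \<Rightarrow> real"
  assumes lin: "\<And>\<phi> \<psi> c. test \<phi> \<Longrightarrow> test \<psi> \<Longrightarrow> l (\<lambda>x. \<phi> x + c * \<psi> x) = l \<phi> + c * l \<psi>"
    and bound: "\<And>\<phi>. test \<phi> \<Longrightarrow> \<bar>l \<phi>\<bar> \<le> C * sqrt (nsq \<phi>)"
  obtains \<xi> where "\<xi> \<in> L2 \<Omega>" "\<And>\<phi>. test \<phi> \<Longrightarrow> l \<phi> = (LINT x|M. \<xi> x * \<phi> x)"
proof -
  define J where "J \<phi> = nsq \<phi> / 2 - l \<phi>" for \<phi>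
  define T where "T = {\<phi>. test \<phi>}"
  define I where "I = (INF \<phi>\<in>T. J \<phi>)"
  define c where "c k = 1 / (real k + 1)" for k
  have c: "c k > 0" for k by (simp add: c_def)
  have c_anti: "c k \<le> c j" if "j \<le> k" for j k using that by (simp add: c_def frac_le)
  have c0: "c \<longlonglongrightarrow> 0" unfolding c_def using LIMSEQ_inverse_real_of_nat by (simp add: inverse_eq_divide add.commute)
  have l0: "l (\<lambda>x. 0) = 0" using lin[OF test_function_0 test_function_0, of 1] by simp
  have lc: "l (\<lambda>x. a * \<phi> x) = a * l \<phi>" if "test \<phi>" for a \<phi>
    using lin[OF test_function_0 that, of a] l0 by simp
  have J: "- C\<^sup>2 / 2 \<le> J \<phi>" if "\<phi> \<in> T" for \<phi>
  proof -
    define s where "s = sqrt (nsq \<phi>)"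
    have "nsq \<phi> = s\<^sup>2" by (simp add: s_def)
    moreover have "l \<phi> \<le> C * s" using bound[of \<phi>] that by (auto simp: T_def s_def)
    moreover have "2 * C * s \<le> C\<^sup>2 + s\<^sup>2" by (rule sum_squares_bound)
    ultimately show ?thesis unfolding J_def by simp
  qed
  have bdd: "bdd_below (J ` T)" by (rule bdd_belowI2) (rule J)
  have IJ: "I \<le> J \<phi>" if "test \<phi>" for \<phi>
    unfolding I_def by (rule cINF_lower[OF bdd]) (simp add: T_def that)
  have ne: "T \<noteq> {}" using test_function_0 by (auto simp: T_def)
  have "\<forall>n. \<exists>\<phi>\<in>T. J \<phi> < I + c n"
  proof
    fix n
    have "I < I + c n" using c by simp
    then show "\<exists>\<phi>\<in>T. J \<phi> < I + c n"
      using cINF_less_iff[OF ne bdd] unfolding I_def by blast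
  qed
  then obtain \<phi> where \<phi>: "\<And>n. \<phi> n \<in> T" "\<And>n. J (\<phi> n) < I + c n" by metis
  have t: "test (\<phi> n)" for n using \<phi>(1) by (simp add: T_def)
  note L = test_L2(1)[OF t]
  have close: "nsq (\<lambda>x. \<phi> k x - \<phi> j x) \<le> 4 * c k + 4 * c j" for k j
  proof -
    let ?\<psi> = "\<lambda>x. (1/2) * \<phi> k x + (1/2) * \<phi> j x"
    have "I \<le> J ?\<psi>" by (intro IJ test_function_add test_function_cmult t)
    moreover have "l ?\<psi> = l (\<phi> k) / 2 + l (\<phi> j) / 2"
      by (subst lin[OF test_function_cmult[OF t] t]) (subst lc[OF t], simp)
    moreover have "nsq ?\<psi> = nsq (\<lambda>x. \<phi> k x + \<phi> j x) / 4"
      using sqn_scaleR[of \<Omega> "1/2" "\<lambda>x. \<phi> k x + \<phi> j x"] by (simp add: power_divide add_divide_distrib)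
    ultimately show ?thesis
      using sqn_parallelogram[OF L L, of k j] \<phi>(2)[of k] \<phi>(2)[of j] unfolding J_def by simp
  qed
  obtain \<xi> where \<xi>: "\<xi> \<in> L2 \<Omega>" "(\<lambda>k. nsq (\<lambda>x. \<phi> k x - \<xi> x)) \<longlonglongrightarrow> 0"
  proof (rule L2_complete[OF L])
    fix e :: real assume e: "e > 0"
    obtain N where N: "c N < e / 8"
      using order_tendstoD(2)[OF c0, of "e / 8"] e unfolding eventually_sequentially by auto
    have "nsq (\<lambda>x. \<phi> m x - \<phi> n x) < e" if "m \<ge> N" "n \<ge> N" for m n
      using close[of m n] c_anti[OF that(1)] c_anti[OF that(2)] N by linarith
    then show "\<exists>N. \<forall>m\<ge>N. \<forall>n\<ge>N. nsq (\<lambda>x. \<phi> m x - \<phi> n x) < e" by blast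
  qed blast
  show ?thesis
  proof (rule that[OF \<xi>(1)])
    fix \<psi> assume \<psi>: "test \<psi>"
    define a q where "a = (LINT x|M. \<xi> x * \<psi> x) - l \<psi>" and "q = nsq \<psi>"
    have q: "q \<ge> 0" by (simp add: q_def)
    have quad: "0 \<le> s * a + s\<^sup>2 * q / 2" for s
    proof -
      have "- c n \<le> s * ((LINT x|M. \<phi> n x * \<psi> x) - l \<psi>) + s\<^sup>2 * q / 2" for n
      proof -
        have "I \<le> J (\<lambda>x. \<phi> n x + s * \<psi> x)" by (intro IJ test_function_add test_function_cmult t \<psi>)
        moreover have "nsq (\<lambda>x. \<phi> n x + s * \<psi> x) = nsq (\<phi> n) + 2 * s * (LINT x|M. \<phi> n x * \<psi> x) + s\<^sup>2 * q"
          using sqn_add[OF L L2_scaleR[OF test_L2(1)[OF \<psi>]], of n s, unfolded sqn_scaleR]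
          by (simp add: q_def mult.left_commute)
        ultimately show ?thesis using \<phi>(2)[of n] lin[OF t \<psi>, of n s] unfolding J_def
          by (simp add: algebra_simps)
      qed
      moreover have "(\<lambda>n. - c n) \<longlonglongrightarrow> - 0" by (intro tendsto_intros c0)
      moreover have "(\<lambda>n. LINT x|M. \<phi> n x \<bullet> \<psi> x) \<longlonglongrightarrow> (LINT x|M. \<xi> x \<bullet> \<psi> x)"
        by (rule L2_tendsto_inner[OF L \<xi>(1) test_L2(1)[OF \<psi>] test_L2(1)[OF \<psi>] \<xi>(2)]) simp
      then have "(\<lambda>n. s * ((LINT x|M. \<phi> n x * \<psi> x) - l \<psi>) + s\<^sup>2 * q / 2) \<longlonglongrightarrow> s * a + s\<^sup>2 * q / 2"
        unfolding a_def by (intro tendsto_intros) simp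
      ultimately have "- 0 \<le> s * a + s\<^sup>2 * q / 2" by (intro LIMSEQ_le) auto
      then show ?thesis by simp
    qed
    have "a = 0"
    proof (rule ccontr)
      assume "a \<noteq> 0"
      \<comment> \<open>Taking \<open>s = - y\<close> gives the quadratic the value
        \<open>- y\<^sup>2 * (q / 2 + 1)\<close>; the added 1 in the denominator permits
        \<open>q = 0\<close>.\<close>
      define y where "y = a / (q + 1)"
      have a: "a = y * (q + 1)" using q by (simp add: y_def)
      have "0 \<le> (- y) * a + (- y)\<^sup>2 * q / 2" by (rule quad)
      also have "\<dots> = - (y\<^sup>2 * (q / 2 + 1))" by (simp add: a algebra_simps power2_eq_square)
      also have "\<dots> < 0" using q a \<open>a \<noteq> 0\<close> by auto
      finally show False by simp
    qed
    then show "l \<psi> = (LINT x|M. \<xi> x * \<psi> x)" by (simp add: a_def)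
  qed
qed

text \<open>The increment of the potential stays unexpanded because \<open>h\<close> need not be
  differentiable; \<open>t\<close> may have either sign.\<close>

lemma first_variation:
  assumes h: "L-lipschitz_on UNIV h" and u: "u \<in> H10 \<Omega>" and min: "\<And>w. w \<in> H10 \<Omega> \<Longrightarrow> energy h u \<le> energy h w"
    and v: "v \<in> H10 \<Omega>"
  shows "(LINT x|M. h (u x + t * v x) - h (u x)) \<le> t * (LINT x|M. wgrad u x \<bullet> wgrad v x) + t\<^sup>2 * dirichlet v / 2"
proof -
  have w: "(\<lambda>x. u x + t * v x) \<in> H10 \<Omega>" by (intro H10_add H10_cmult u v)
  have "(LINT x|M. h (u x + t * v x) - h (u x)) = (LINT x|M. h (u x + t * v x)) - (LINT x|M. h (u x))"
    by (intro Bochner_Integration.integral_diff lipschitz_integrable[OF h] H10_L2 w u)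
  then show ?thesis using min[OF w] dirichlet_add[OF u v, of t] unfolding energy_def by (simp add: add_divide_distrib)
qed

text \<open>Dividing by \<open>t\<close> and letting it tend to 0 leaves the Lipschitz bound on the
  potential; the directions \<open>v\<close> and \<open>- v\<close> together bound the absolute
  value. The right-hand side involves \<open>v\<close> but not its gradient, which is the source of
  continuity in L2.\<close>

lemma first_variation_bound:
  assumes h: "L-lipschitz_on UNIV h" and u: "u \<in> H10 \<Omega>" and min: "\<And>w. w \<in> H10 \<Omega> \<Longrightarrow> energy h u \<le> energy h w"
    and v: "v \<in> H10 \<Omega>"
  shows "\<bar>LINT x|M. wgrad u x \<bullet> wgrad v x\<bar> \<le> L * (LINT x|M. \<bar>v x\<bar>)"
proof -
  have lower: "- (L * (LINT x|M. \<bar>v x\<bar>)) \<le> (LINT x|M. wgrad u x \<bullet> wgrad v x)" if v: "v \<in> H10 \<Omega>" for v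
  proof (rule le_if_le_add_small[of 1])
    fix t :: real assume t: "0 < t" "t < 1"
    have w: "(\<lambda>x. u x + t * v x) \<in> H10 \<Omega>" by (intro H10_add H10_cmult u v)
    have iv: "integrable M v" using L2_imp_integrable[OF H10_L2(1)[OF v]] .
    have "(LINT x|M. - (t * L) * \<bar>v x\<bar>) \<le> (LINT x|M. h (u x + t * v x) - h (u x))"
    proof (rule integral_mono)
      show "integrable M (\<lambda>x. - (t * L) * \<bar>v x\<bar>)" using iv by simp
      show "integrable M (\<lambda>x. h (u x + t * v x) - h (u x))"
        by (intro Bochner_Integration.integrable_diff lipschitz_integrable[OF h] H10_L2 w u)
      show "- (t * L) * \<bar>v x\<bar> \<le> h (u x + t * v x) - h (u x)" for x
        using lipschitz_onD[OF h, of "u x + t * v x" "u x"] t(1) by (simp add: dist_real_def abs_mult mult_ac)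
    qed
    then have "t * (- (L * (LINT x|M. \<bar>v x\<bar>))) \<le> t * ((LINT x|M. wgrad u x \<bullet> wgrad v x) + t * (dirichlet v / 2))"
      using first_variation[OF h u min v, of t] by (simp add: algebra_simps power2_eq_square)
    then show "- (L * (LINT x|M. \<bar>v x\<bar>)) \<le> (LINT x|M. wgrad u x \<bullet> wgrad v x) + t * (dirichlet v / 2)"
      using mult_le_cancel_left_pos[OF t(1)] by blast
  qed simp
  have "(LINT x|M. wgrad u x \<bullet> wgrad (\<lambda>x. (-1) * v x) x) = (LINT x|M. - (wgrad u x \<bullet> wgrad v x))"
    using H10_cmult(2)[OF v, of "-1"] L2_inner_integrable[OF H10_L2(2)[OF u] H10_L2(2)[OF v]]
      L2_inner_integrable[OF H10_L2(2)[OF u] H10_L2(2)[OF H10_cmult(1)[OF v, of "-1"]]]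
    by (intro integral_cong_AE) (auto dest: borel_measurable_integrable elim!: eventually_mono)
  then show ?thesis using lower[OF v] lower[OF H10_cmult(1)[OF v, of "-1"]] by simp
qed

lemma wgrad_inner_test:
  assumes "u \<in> H10 \<Omega>" "test \<phi>"
  shows "(LINT x|M. wgrad u x \<bullet> wgrad \<phi> x) = (LINT x|M. wgrad u x \<bullet> grad \<phi> x)"
  using H10_test[OF assms(2)] assms(1)
    L2_inner_integrable[OF H10_L2(2)[OF assms(1)] H10_L2(2)[OF H10_test(1)[OF assms(2)]]]
    L2_inner_integrable[OF H10_L2(2)[OF assms(1)] test_L2(2)[OF assms(2)]]
  by (intro integral_cong_AE) (auto dest: borel_measurable_integrable elim!: eventually_mono)

lemma Euler_Lagrange:
  assumes h: "L-lipschitz_on UNIV h" and u: "u \<in> H10 \<Omega>" and min: "\<And>w. w \<in> H10 \<Omega> \<Longrightarrow> energy h u \<le> energy h w"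
  obtains \<xi> where "\<xi> \<in> L2 \<Omega>"
    "\<And>v. v \<in> H10 \<Omega> \<Longrightarrow> (LINT x|M. wgrad u x \<bullet> wgrad v x) = (LINT x|M. \<xi> x * v x)"
proof -
  define l where "l \<phi> = (LINT x|M. wgrad u x \<bullet> grad \<phi> x)" for \<phi>
  note iu = L2_inner_integrable[OF H10_L2(2)[OF u]]
  obtain \<xi> where \<xi>: "\<xi> \<in> L2 \<Omega>" "\<And>\<phi>. test \<phi> \<Longrightarrow> l \<phi> = (LINT x|M. \<xi> x * \<phi> x)"
  \<comment> \<open>The factor \<open>sqrt vol\<close> comes from estimating the L1 norm by the L2
    norm.\<close>
  proof (rule L2_representation[of l "L * sqrt vol"])
    fix \<phi> \<psi> c assume t: "test \<phi>" "test \<psi>"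
    note sm = test_function_smooth[OF t(1)] test_function_smooth[OF t(2)]
    have "grad (\<lambda>x. \<phi> x + c * \<psi> x) = (\<lambda>x. grad \<phi> x + c *\<^sub>R grad \<psi> x)"
      using grad_add[OF sm(1) smooth_mult[OF smooth_const sm(2)]] grad_cmult[OF sm(2)] by auto
    then show "l (\<lambda>x. \<phi> x + c * \<psi> x) = l \<phi> + c * l \<psi>"
      using iu[OF test_L2(2)[OF t(1)]] iu[OF test_L2(2)[OF t(2)]] by (simp add: l_def inner_add_right)
  next
    fix \<phi> assume t: "test \<phi>"
    have one: "(\<lambda>x. 1::real) \<in> L2 \<Omega>" by (rule L2_boundedI[of _ 1]) auto
    have abs: "(\<lambda>x. \<bar>\<phi> x\<bar>) \<in> L2 \<Omega>" using test_L2(1)[OF t] by (auto simp: L2_def)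
    have "(LINT x|M. \<bar>\<phi> x\<bar>) \<le> sqrt (nsq \<phi>) * sqrt vol"
      using L2_Cauchy_Schwarz[OF abs one] by (simp add: vol_def)
    then have "L * (LINT x|M. \<bar>\<phi> x\<bar>) \<le> L * sqrt vol * sqrt (nsq \<phi>)"
      using mult_left_mono[OF _ lipschitz_on_nonneg[OF h]] by (fastforce simp: mult_ac)
    then show "\<bar>l \<phi>\<bar> \<le> L * sqrt vol * sqrt (nsq \<phi>)"
      using first_variation_bound[OF h u min H10_test(1)[OF t]] wgrad_inner_test[OF u t] unfolding l_def by linarith
  qed blast
  show ?thesis
  proof (rule that[OF \<xi>(1)])
    fix v assume v: "v \<in> H10 \<Omega>"
    obtain \<phi> where \<phi>: "\<And>m. test (\<phi> m)" "(\<lambda>m. nsq (\<lambda>x. \<phi> m x - v x)) \<longlonglongrightarrow> 0"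
      "(\<lambda>m. nsq (\<lambda>x. grad (\<phi> m) x - wgrad v x)) \<longlonglongrightarrow> 0" using H10E[OF v] by blast
    have "(\<lambda>m. LINT x|M. wgrad u x \<bullet> grad (\<phi> m) x) \<longlonglongrightarrow> (LINT x|M. wgrad u x \<bullet> wgrad v x)"
      by (rule L2_tendsto_inner[OF _ _ _ _ _ \<phi>(3)]) (use u v H10_L2 test_L2 \<phi>(1) in auto)
    moreover have "(\<lambda>m. LINT x|M. \<xi> x \<bullet> \<phi> m x) \<longlonglongrightarrow> (LINT x|M. \<xi> x \<bullet> v x)"
      by (rule L2_tendsto_inner[OF _ _ _ _ _ \<phi>(2)]) (use v \<xi>(1) H10_L2 test_L2 \<phi>(1) in auto)
    then have "(\<lambda>m. l (\<phi> m)) \<longlonglongrightarrow> (LINT x|M. \<xi> x * v x)" by (simp add: \<xi>(2)[OF \<phi>(1)])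
    ultimately show "(LINT x|M. wgrad u x \<bullet> wgrad v x) = (LINT x|M. \<xi> x * v x)"
      unfolding l_def by (rule LIMSEQ_unique)
  qed
qed

text \<open>Moving \<open>u\<close> by \<open>- s * t * \<phi>\<close> with
  \<open>\<phi> \<ge> 0\<close> compares \<open>s * \<xi>\<close> with quotients of
  \<open>h\<close>; the sign \<open>s\<close> covers the upper and the lower bound at once.
  Quotients at scales below \<open>r\<close> suffice because \<open>\<phi>\<close> is bounded and
  \<open>t\<close> tends to 0.\<close>

lemma Euler_Lagrange_bounds:
  assumes h: "L-lipschitz_on UNIV h" and u: "u \<in> H10 \<Omega>" and min: "\<And>w. w \<in> H10 \<Omega> \<Longrightarrow> energy h u \<le> energy h w"
    and \<xi>: "\<xi> \<in> L2 \<Omega>" "\<And>v. v \<in> H10 \<Omega> \<Longrightarrow> (LINT x|M. wgrad u x \<bullet> wgrad v x) = (LINT x|M. \<xi> x * v x)"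
    and b: "b \<in> L2 \<Omega>" and r: "r > 0" and s: "s = 1 \<or> s = -1"
    and quot: "\<And>x \<sigma>. 0 < \<sigma> \<Longrightarrow> \<sigma> < r \<Longrightarrow> h (u x) - h (u x - s * \<sigma>) \<le> \<sigma> * b x"
  shows "AE x in M. s * \<xi> x \<le> b x"
proof -
  have i: "integrable M (\<lambda>x. b x - s * \<xi> x)"
    using L2_imp_integrable[OF b] L2_imp_integrable[OF \<xi>(1)] by simp
  have "AE x in M. b x - s * \<xi> x \<ge> 0"
  proof (rule AE_nonneg_if_test_nonneg[OF open_dom i])
    fix \<phi> assume \<phi>: "test \<phi>" "\<And>x. \<phi> x \<ge> (0::real)"
    note H = H10_test(1)[OF \<phi>(1)]
    note ib = L2_mult_integrable[OF b test_L2(1)[OF \<phi>(1)]] L2_mult_integrable[OF \<xi>(1) test_L2(1)[OF \<phi>(1)]]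
    obtain C where C: "C \<ge> 0" "\<And>x. \<bar>\<phi> x\<bar> \<le> C" using test_function_bounded[OF \<phi>(1)] by metis
    have "s * (LINT x|M. \<xi> x * \<phi> x) \<le> (LINT x|M. b x * \<phi> x)"
    proof (rule le_if_le_add_small)
      show "r / (C + 1) > 0" using r C(1) by simp
      fix t :: real assume t: "0 < t" "t < r / (C + 1)"
      have w: "(\<lambda>x. u x + (- s * t) * \<phi> x) \<in> H10 \<Omega>" by (intro H10_add H10_cmult u H)
      have "(LINT x|M. - t * (b x * \<phi> x)) \<le> (LINT x|M. h (u x + (- s * t) * \<phi> x) - h (u x))"
      proof (rule integral_mono)
        show "integrable M (\<lambda>x. - t * (b x * \<phi> x))" using ib(1) by simp
        show "integrable M (\<lambda>x. h (u x + (- s * t) * \<phi> x) - h (u x))"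
          by (intro Bochner_Integration.integrable_diff lipschitz_integrable[OF h] H10_L2 w u)
        fix x
        show "- t * (b x * \<phi> x) \<le> h (u x + (- s * t) * \<phi> x) - h (u x)"
        proof (cases "\<phi> x = 0")
          case False
          then have "0 < t * \<phi> x" using \<phi>(2)[of x] t(1) by simp
          moreover have "t * \<phi> x < r"
          proof -
            have "t * \<phi> x \<le> t * (C + 1)" using C(2)[of x] t(1) by (intro mult_left_mono) auto
            also have "\<dots> < r" using t(2) C(1) by (simp add: pos_less_divide_eq)
            finally show ?thesis .
          qed
          ultimately show ?thesis using quot[of "t * \<phi> x" x] by (simp add: algebra_simps)
        qed simp
      qed
      moreover have "(- s * t)\<^sup>2 = t\<^sup>2" using s by auto
      ultimately have "- t * (LINT x|M. b x * \<phi> x) \<le> (- s * t) * (LINT x|M. \<xi> x * \<phi> x) + t\<^sup>2 * dirichlet \<phi> / 2"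
        using first_variation[OF h u min H, of "- s * t"] \<xi>(2)[OF H] ib(1) by simp
      then have "t * (s * (LINT x|M. \<xi> x * \<phi> x)) \<le> t * (LINT x|M. b x * \<phi> x) + t\<^sup>2 * dirichlet \<phi> / 2"
        by (simp add: mult_ac)
      also have "\<dots> = t * ((LINT x|M. b x * \<phi> x) + t * (dirichlet \<phi> / 2))"
        unfolding distrib_left by (simp add: power2_eq_square[of t])
      finally show "s * (LINT x|M. \<xi> x * \<phi> x) \<le> (LINT x|M. b x * \<phi> x) + t * (dirichlet \<phi> / 2)"
        using mult_le_cancel_left_pos[OF t(1)] by blast
    qed
    then show "0 \<le> (LINT x|M. (b x - s * \<xi> x) * \<phi> x)"
      using ib by (simp add: left_diff_distrib mult.assoc)
  qed
  then show ?thesis by eventually_elim simp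
qed

end

section \<open>One-sided slopes and the Clarke gradient\<close>

text \<open>Clarke's directional derivative before the limit in the scale \<open>r\<close>. For
  Lipschitz \<open>f\<close> and fixed \<open>r > 0\<close> it is a real number, bounded and
  measurable in \<open>s\<close>, so its composition with \<open>u\<close> can serve as the bound in
  \<open>Euler_Lagrange_bounds\<close>.\<close>

definition slope_sup :: "(real \<Rightarrow> real) \<Rightarrow> real \<Rightarrow> real \<Rightarrow> real \<Rightarrow> real" where
  "slope_sup f v r s = (SUP (z, \<tau>) \<in> ball s r \<times> {0<..<r}. (f (z + \<tau> * v) - f z) / \<tau>)"

lemma lipschitz_quotient_abs_le:
  fixes f :: "real \<Rightarrow> real"
  assumes "L-lipschitz_on UNIV f" "\<tau> > 0"
  shows "\<bar>(f (z + \<tau> * v) - f z) / \<tau>\<bar> \<le> L * \<bar>v\<bar>"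
  using lipschitz_onD[OF assms(1), of "z + \<tau> * v" z] assms(2)
  by (simp add: dist_real_def abs_divide divide_le_eq abs_mult mult_ac)

lemmas lipschitz_quotient_le = lipschitz_quotient_abs_le[THEN abs_le_D1]

lemma slope_sup_bdd:
  assumes "L-lipschitz_on UNIV f"
  shows "bdd_above ((\<lambda>(z, \<tau>). (f (z + \<tau> * v) - f z) / \<tau>) ` (ball s r \<times> {0<..<r}))"
  using lipschitz_quotient_le[OF assms] by (intro bdd_aboveI2[where M="L * \<bar>v\<bar>"]) auto

lemma slope_sup_upper:
  assumes "L-lipschitz_on UNIV f" "\<bar>z - s\<bar> < r" "0 < \<tau>" "\<tau> < r"
  shows "(f (z + \<tau> * v) - f z) / \<tau> \<le> slope_sup f v r s"
  unfolding slope_sup_def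
  by (rule cSUP_upper2[OF slope_sup_bdd[OF assms(1)], of "(z, \<tau>)"])
    (use assms in \<open>auto simp: dist_real_def abs_minus_commute\<close>)

lemma slope_sup_least:
  assumes "r > 0" "\<And>z \<tau>. \<bar>z - s\<bar> < r \<Longrightarrow> 0 < \<tau> \<Longrightarrow> \<tau> < r \<Longrightarrow> (f (z + \<tau> * v) - f z) / \<tau> \<le> c"
  shows "slope_sup f v r s \<le> c"
  unfolding slope_sup_def
proof (rule cSUP_least)
  have "(s, r / 2) \<in> ball s r \<times> {0<..<r}" using assms(1) by auto
  then show "ball s r \<times> {0<..<r} \<noteq> {}" by blast
qed (use assms(2) in \<open>auto simp: dist_real_def abs_minus_commute\<close>)

lemma slope_sup_abs_le:
  assumes "L-lipschitz_on UNIV f" "r > 0"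
  shows "\<bar>slope_sup f v r s\<bar> \<le> L * \<bar>v\<bar>"
proof -
  have "slope_sup f v r s \<le> L * \<bar>v\<bar>"
    by (rule slope_sup_least[OF assms(2)]) (rule lipschitz_quotient_le[OF assms(1)])
  moreover have "- (L * \<bar>v\<bar>) \<le> slope_sup f v r s"
  proof -
    have "- (L * \<bar>v\<bar>) \<le> (f (s + (r/2) * v) - f s) / (r/2)"
      using lipschitz_quotient_abs_le[OF assms(1), of "r/2" s v] assms(2) unfolding abs_le_iff by linarith
    also have "\<dots> \<le> slope_sup f v r s"
      by (rule slope_sup_upper[OF assms(1)]) (use assms(2) in auto)
    finally show ?thesis .
  qed
  ultimately show ?thesis by linarith
qed

lemma slope_sup_mono:
  assumes "L-lipschitz_on UNIV f" "0 < r" "r \<le> r'"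
  shows "slope_sup f v r s \<le> slope_sup f v r' s"
  by (rule slope_sup_least[OF assms(2)]) (use assms in \<open>auto intro!: slope_sup_upper\<close>)

text \<open>Lower semicontinuity: a quotient above \<open>c\<close> with base point \<open>z\<close>
  serves all \<open>s\<close> in the open ball around \<open>z\<close>, so superlevel sets are
  unions of balls.\<close>

lemma slope_sup_measurable:
  assumes "L-lipschitz_on UNIV f" "r > 0"
  shows "slope_sup f v r \<in> borel_measurable borel"
proof (rule borel_measurableI_greater)
  fix c
  let ?Q = "\<lambda>(z, \<tau>). (f (z + \<tau> * v) - f z) / \<tau>"
  have "slope_sup f v r s > c \<longleftrightarrow> (\<exists>z \<tau>. \<bar>z - s\<bar> < r \<and> 0 < \<tau> \<and> \<tau> < r \<and> (f (z + \<tau> * v) - f z) / \<tau> > c)" for s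
  proof
    assume "slope_sup f v r s > c"
    then show "\<exists>z \<tau>. \<bar>z - s\<bar> < r \<and> 0 < \<tau> \<and> \<tau> < r \<and> (f (z + \<tau> * v) - f z) / \<tau> > c"
      using slope_sup_least[OF assms(2), of s f v c] by (meson not_less)
  qed (use slope_sup_upper[OF assms(1), of _ s r _ v] in fastforce)
  then have "{s \<in> space borel. c < slope_sup f v r s} =
      (\<Union>z. \<Union>\<tau>\<in>{\<tau>. 0 < \<tau> \<and> \<tau> < r \<and> (f (z + \<tau> * v) - f z) / \<tau> > c}. ball z r)"
    by (auto simp: dist_real_def)
  moreover have "open \<dots>" by blast
  ultimately show "{s \<in> space borel. c < slope_sup f v r s} \<in> sets borel" by simp
qed

text \<open>The forward quotient from \<open>s\<close> and the backward one from
  \<open>s + r/2\<close> cancel. In the limit this makes the interval from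
  \<open>- slope_inf f (-1) s\<close> to \<open>slope_inf f 1 s\<close> nonempty.\<close>

lemma slope_sup_opposite:
  assumes "L-lipschitz_on UNIV f" "r > 0"
  shows "0 \<le> slope_sup f 1 r s + slope_sup f (-1) r s"
proof -
  have "(f (s + (r/2) * 1) - f s) / (r/2) \<le> slope_sup f 1 r s"
    by (rule slope_sup_upper[OF assms(1)]) (use assms in auto)
  moreover have "(f ((s + r/2) + (r/2) * (-1)) - f (s + r/2)) / (r/2) \<le> slope_sup f (-1) r s"
    by (rule slope_sup_upper[OF assms(1)]) (use assms in auto)
  moreover have "(f (s + (r/2) * 1) - f s) / (r/2) + (f ((s + r/2) + (r/2) * (-1)) - f (s + r/2)) / (r/2) = 0"
    by (simp add: add_divide_distrib[symmetric])
  ultimately show ?thesis by linarith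
qed

section \<open>From slopes at fixed scales to Clarke gradients\<close>

lemma eventually_nhds_at_right_real:
  "eventually P (nhds (s::real) \<times>\<^sub>F at_right 0) \<longleftrightarrow>
     (\<exists>r>0. \<forall>z \<tau>. \<bar>z - s\<bar> < r \<longrightarrow> 0 < \<tau> \<longrightarrow> \<tau> < (r::real) \<longrightarrow> P (z, \<tau>))"
proof
  assume "eventually P (nhds s \<times>\<^sub>F at_right 0)"
  then obtain Pf Pg where *: "eventually Pf (nhds s)" "eventually Pg (at_right 0)" "\<And>x y. Pf x \<Longrightarrow> Pg y \<Longrightarrow> P (x, y)"
    unfolding eventually_prod_filter by blast
  obtain a where a: "a > 0" "\<And>z. \<bar>z - s\<bar> < a \<Longrightarrow> Pf z"
    using *(1) unfolding eventually_nhds_metric dist_real_def by blast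
  obtain b where b: "b > 0" "\<And>\<tau>. 0 < \<tau> \<Longrightarrow> \<tau> < b \<Longrightarrow> Pg \<tau>"
    using *(2) unfolding eventually_at_right_field by blast
  show "\<exists>r>0. \<forall>z \<tau>. \<bar>z - s\<bar> < r \<longrightarrow> 0 < \<tau> \<longrightarrow> \<tau> < r \<longrightarrow> P (z, \<tau>)"
    using a b *(3) by (intro exI[of _ "min a b"]) auto
next
  assume "\<exists>r>0. \<forall>z \<tau>. \<bar>z - s\<bar> < r \<longrightarrow> 0 < \<tau> \<longrightarrow> \<tau> < r \<longrightarrow> P (z, \<tau>)"
  then obtain r where r: "r > 0" "\<And>z \<tau>. \<bar>z - s\<bar> < r \<Longrightarrow> 0 < \<tau> \<Longrightarrow> \<tau> < r \<Longrightarrow> P (z, \<tau>)" by blast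
  have "eventually (\<lambda>z. \<bar>z - s\<bar> < r) (nhds s)"
    unfolding eventually_nhds_metric dist_real_def using r(1) by blast
  moreover have "eventually (\<lambda>\<tau>. 0 < \<tau> \<and> \<tau> < r) (at_right 0)"
    unfolding eventually_at_right_field using r(1) by blast
  ultimately show "eventually P (nhds s \<times>\<^sub>F at_right 0)"
    unfolding eventually_prod_filter using r(2) by blast
qed

text \<open>On the line every nonzero direction \<open>w\<close> is a positive multiple of 1 or -1,
  and its quotients are those in direction \<open>sgn w\<close>, multiplied by
  \<open>\<bar>w\<bar>\<close> and taken with a rescaled step.\<close>

lemma clarke_gradientI:
  assumes f: "L-lipschitz_on UNIV f"
    and \<xi>: "\<And>r. r > 0 \<Longrightarrow> \<xi> \<le> slope_sup f 1 r s" "\<And>r. r > 0 \<Longrightarrow> - \<xi> \<le> slope_sup f (-1) r s"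
  shows "\<xi> \<in> clarke_gradient f s"
  unfolding clarke_gradient_def
proof (intro CollectI allI)
  fix w
  show "ereal (\<xi> * w) \<le> clarke_deriv f s w"
  proof (cases "w = 0")
    case True
    \<comment> \<open>In direction 0 all quotients are 0, but their limes superior is 0 only because
      the filter is proper.\<close>
    have "nhds s \<times>\<^sub>F at_right (0::real) \<noteq> bot" by (simp add: prod_filter_eq_bot)
    then show ?thesis unfolding clarke_deriv_def True by (simp add: case_prod_beta' Limsup_const zero_ereal_def)
  next
    case False
    show ?thesis
    proof (rule ccontr)
      assume "\<not> ereal (\<xi> * w) \<le> clarke_deriv f s w"
      then obtain c where c: "clarke_deriv f s w < ereal c" "ereal c < ereal (\<xi> * w)"
        using ereal_dense2[of "clarke_deriv f s w" "ereal (\<xi> * w)"] by (auto simp: not_le)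
      from Limsup_lessD[OF c(1)[unfolded clarke_deriv_def]]
      obtain r where r: "r > 0" "\<And>z \<tau>. \<bar>z - s\<bar> < r \<Longrightarrow> 0 < \<tau> \<Longrightarrow> \<tau> < r \<Longrightarrow> (f (z + \<tau> * w) - f z) / \<tau> < c"
        unfolding eventually_nhds_at_right_real by auto
      \<comment> \<open>A step \<open>\<sigma>\<close> in direction \<open>sgn w\<close> is a step
        \<open>\<sigma> / \<bar>w\<bar>\<close> in direction \<open>w\<close>; both this step and
        the distance to \<open>s\<close> must stay below \<open>r\<close>.\<close>
      define r' where "r' = min r (r * \<bar>w\<bar>)"
      have r': "r' > 0" "r' \<le> r" "r' \<le> r * \<bar>w\<bar>" using r(1) False by (auto simp: r'_def)
      have "slope_sup f (sgn w) r' s \<le> c / \<bar>w\<bar>"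
      proof (rule slope_sup_least[OF r'(1)])
        fix z \<sigma> assume z: "\<bar>z - s\<bar> < r'" and \<sigma>: "0 < \<sigma>" "\<sigma> < r'"
        have "(f (z + \<sigma> / \<bar>w\<bar> * w) - f z) / (\<sigma> / \<bar>w\<bar>) < c"
          using z \<sigma> r' False by (intro r(2)) (auto simp: divide_less_eq)
        moreover have "\<sigma> / \<bar>w\<bar> * w = \<sigma> * sgn w" using False by (simp add: sgn_if)
        ultimately have "(f (z + \<sigma> * sgn w) - f z) / (\<sigma> / \<bar>w\<bar>) < c" by simp
        then show "(f (z + \<sigma> * sgn w) - f z) / \<sigma> \<le> c / \<bar>w\<bar>"
          using False \<sigma>(1) by (simp add: field_simps)
      qed
      moreover have "\<xi> * sgn w \<le> slope_sup f (sgn w) r' s"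
        using \<xi>[OF r'(1)] False by (auto simp: sgn_if)
      ultimately have "\<xi> * sgn w * \<bar>w\<bar> \<le> c / \<bar>w\<bar> * \<bar>w\<bar>" by (intro mult_right_mono) auto
      then have "\<xi> * w \<le> c" using False by (simp add: mult.assoc sgn_mult_abs)
      then show False using c(2) by simp
    qed
  qed
qed

text \<open>Clarke's directional derivative as a real number: for Lipschitz \<open>f\<close>,
  \<open>slope_sup\<close> shrinks with \<open>r\<close>, so the infimum is the limit at 0.\<close>

definition slope_inf :: "(real \<Rightarrow> real) \<Rightarrow> real \<Rightarrow> real \<Rightarrow> real" where
  "slope_inf f v s = (INF r\<in>{0<..}. slope_sup f v r s)"

lemma slope_inf_lower:
  assumes "L-lipschitz_on UNIV f" "r > 0" shows "slope_inf f v s \<le> slope_sup f v r s"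
proof -
  have "bdd_below ((\<lambda>r. slope_sup f v r s) ` {0<..})"
    using slope_sup_abs_le[OF assms(1)] by (intro bdd_belowI2[of _ "- (L * \<bar>v\<bar>)"]) (auto simp: abs_le_iff minus_le_iff)
  then show ?thesis unfolding slope_inf_def using assms(2) by (intro cINF_lower) auto
qed

lemma slope_inf_greatest: "(\<And>r. r > 0 \<Longrightarrow> c \<le> slope_sup f v r s) \<Longrightarrow> c \<le> slope_inf f v s"
  unfolding slope_inf_def by (rule cINF_greatest) auto

lemma slope_inf_tendsto:
  assumes "L-lipschitz_on UNIV f"
  shows "((\<lambda>r. slope_sup f v r s) \<longlongrightarrow> slope_inf f v s) (at_right 0)"
proof (rule tendstoI)
  fix e :: real assume "e > 0"
  then have "\<not> slope_inf f v s + e \<le> slope_inf f v s" by simp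
  then obtain r where r: "r > 0" "slope_sup f v r s < slope_inf f v s + e"
    using slope_inf_greatest[of "slope_inf f v s + e" f v s] by (meson not_le)
  have "dist (slope_sup f v r' s) (slope_inf f v s) < e" if "0 < r'" "r' < r" for r'
    using slope_inf_lower[OF assms that(1), of v s] slope_sup_mono[OF assms that(1), of r v s] that r
    by (simp add: dist_real_def)
  then show "\<forall>\<^sub>F r in at_right 0. dist (slope_sup f v r s) (slope_inf f v s) < e"
    unfolding eventually_at_right_field using r(1) by blast
qed

lemma slope_inf_opposite:
  assumes "L-lipschitz_on UNIV f" shows "0 \<le> slope_inf f 1 s + slope_inf f (-1) s"
proof (rule tendsto_lowerbound)
  show "((\<lambda>r. slope_sup f 1 r s + slope_sup f (-1) r s) \<longlongrightarrow> slope_inf f 1 s + slope_inf f (-1) s) (at_right 0)"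
    by (intro tendsto_intros slope_inf_tendsto[OF assms])
  show "\<forall>\<^sub>F r in at_right 0. 0 \<le> slope_sup f 1 r s + slope_sup f (-1) r s"
    unfolding eventually_at_right_field using slope_sup_opposite[OF assms] by (intro exI[of _ 1]) auto
qed simp

lemma slope_inf_in_clarke_gradient:
  assumes f: "L-lipschitz_on UNIV f" and "- slope_inf f (-1) s \<le> \<xi>" "\<xi> \<le> slope_inf f 1 s"
  shows "\<xi> \<in> clarke_gradient f s"
  by (rule clarke_gradientI[OF f])
    (use slope_inf_lower[OF f, of _ 1 s] slope_inf_lower[OF f, of _ "-1" s] assms(2,3) in \<open>force+\<close>)

text \<open>The limit places \<open>\<xi>\<close> in the sum of an interval inside the gradient of
  \<open>f\<close> and \<open>\<mu>\<close> times one inside that of \<open>g\<close>. The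
  hypotheses use only the scales \<open>1 / (n + 1)\<close>, so countably many almost-everywhere
  statements can supply them.\<close>

lemma clarke_gradient_sum_mem:
  assumes f: "L-lipschitz_on UNIV f" and g: "L'-lipschitz_on UNIV g" and \<mu>: "\<mu> \<ge> 0" and r0: "r0 > 0"
    and up: "\<And>n. 1 / (real n + 1) < r0 \<Longrightarrow> \<xi> \<le> slope_sup f 1 (1 / (real n + 1)) s + \<mu> * slope_sup g 1 (1 / (real n + 1)) s"
    and low: "\<And>n. 1 / (real n + 1) < r0 \<Longrightarrow> - \<xi> \<le> slope_sup f (-1) (1 / (real n + 1)) s + \<mu> * slope_sup g (-1) (1 / (real n + 1)) s"
  shows "\<exists>a\<in>clarke_gradient f s. \<exists>b\<in>clarke_gradient g s. \<xi> = a + \<mu> * b"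
proof -
  have t: "filterlim (\<lambda>n. 1 / (real n + 1)) (at_right 0) sequentially"
  proof (rule tendsto_imp_filterlim_at_right)
    show "(\<lambda>n. 1 / (real n + 1)) \<longlonglongrightarrow> 0"
      using LIMSEQ_inverse_real_of_nat by (simp add: inverse_eq_divide add.commute)
    show "\<forall>\<^sub>F n in sequentially. 0 < 1 / (real n + 1)" by (rule always_eventually) auto
  qed
  have small: "\<forall>\<^sub>F n in sequentially. 1 / (real n + 1) < r0"
    using filterlim_compose[OF filterlim_ident t] r0
    by (intro order_tendstoD(2)[of _ 0]) (auto simp: filterlim_at)
  have lim: "(\<lambda>n. slope_sup f v (1 / (real n + 1)) s + \<mu> * slope_sup g v (1 / (real n + 1)) s)
      \<longlonglongrightarrow> slope_inf f v s + \<mu> * slope_inf g v s" for v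
    by (intro tendsto_intros filterlim_compose[OF slope_inf_tendsto[OF f] t] filterlim_compose[OF slope_inf_tendsto[OF g] t])
  have u: "\<xi> \<le> slope_inf f 1 s + \<mu> * slope_inf g 1 s"
    by (rule tendsto_lowerbound[OF lim]) (use small in eventually_elim, use up in auto)
  have l: "- \<xi> \<le> slope_inf f (-1) s + \<mu> * slope_inf g (-1) s"
    by (rule tendsto_lowerbound[OF lim]) (use small in eventually_elim, use low in auto)
  define A1 B1 A2 B2 where "A1 = - slope_inf f (-1) s" and "B1 = slope_inf f 1 s"
    and "A2 = - slope_inf g (-1) s" and "B2 = slope_inf g 1 s"
  have AB: "A1 \<le> B1" "A2 \<le> B2"
    using slope_inf_opposite[OF f, of s] slope_inf_opposite[OF g, of s] by (auto simp: A1_def A2_def B1_def B2_def)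
  have \<xi>: "A1 + \<mu> * A2 \<le> \<xi>" "\<xi> \<le> B1 + \<mu> * B2" using u l by (auto simp: A1_def A2_def B1_def B2_def)
  have "\<exists>a b. A1 \<le> a \<and> a \<le> B1 \<and> A2 \<le> b \<and> b \<le> B2 \<and> \<xi> = a + \<mu> * b"
  proof (cases "\<mu> = 0")
    case True
    then show ?thesis using \<xi> AB by (intro exI[of _ \<xi>] exI[of _ A2]) auto
  next
    case False
    \<comment> \<open>As much as possible is taken from the interval of \<open>f\<close> while
      leaving at least \<open>\<mu> * A2\<close>; the rest, divided by \<open>\<mu>\<close>, lies in
      the interval of \<open>g\<close>.\<close>
    define a where "a = min B1 (\<xi> - \<mu> * A2)"
    have "A2 \<le> (\<xi> - a) / \<mu>" "(\<xi> - a) / \<mu> \<le> B2"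
      using False \<mu> \<xi> mult_left_mono[OF AB(2) \<mu>] by (auto simp: a_def min_def field_simps)
    then show ?thesis using \<xi> AB(1) False
      by (intro exI[of _ a] exI[of _ "(\<xi> - a) / \<mu>"]) (auto simp: a_def)
  qed
  then show ?thesis
    using slope_inf_in_clarke_gradient[OF f, of s] slope_inf_in_clarke_gradient[OF g, of s]
    unfolding A1_def B1_def A2_def B2_def by blast
qed

lemma clarke_gradient_cong:
  assumes "open U" "s \<in> U" "\<And>z. z \<in> U \<Longrightarrow> f z = g z"
  shows "clarke_gradient f s = clarke_gradient g s"
proof -
  obtain e where e: "e > 0" "\<And>z. \<bar>z - s\<bar> < e \<Longrightarrow> z \<in> U"
    using assms(1,2) unfolding open_dist dist_real_def by blast
  have "clarke_deriv f s v = clarke_deriv g s v" for v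
    unfolding clarke_deriv_def
  proof (rule Limsup_eq, unfold eventually_nhds_at_right_real, intro exI conjI allI impI)
    \<comment> \<open>Keeps both \<open>z\<close> and \<open>z + \<tau> * v\<close> within distance
      \<open>e\<close> of \<open>s\<close>.\<close>
    define r where "r = e / (2 * (\<bar>v\<bar> + 1))"
    have r: "r * (\<bar>v\<bar> + 1) = e / 2" by (simp add: r_def field_simps)
    show "r > 0" using e(1) by (simp add: r_def)
    fix z \<tau> :: real assume z: "\<bar>z - s\<bar> < r" and \<tau>: "0 < \<tau>" "\<tau> < r"
    have "r \<le> r * (\<bar>v\<bar> + 1)" using \<open>r > 0\<close> by simp
    then have 1: "\<bar>z - s\<bar> < e / 2" using z r by linarith
    have "\<bar>\<tau> * v\<bar> \<le> r * (\<bar>v\<bar> + 1)" using \<tau> by (simp add: abs_mult mult_mono)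
    then have "\<bar>\<tau> * v\<bar> \<le> e / 2" using r by simp
    then have "\<bar>z + \<tau> * v - s\<bar> < e" using 1 by linarith
    then have "f (z + \<tau> * v) = g (z + \<tau> * v)" "f z = g z" using assms(3) e 1 by auto
    then show "(case (z, \<tau>) of (z, \<tau>) \<Rightarrow> ereal ((f (z + \<tau> * v) - f z) / \<tau>)) =
      (case (z, \<tau>) of (z, \<tau>) \<Rightarrow> ereal ((g (z + \<tau> * v) - g z) / \<tau>))" by simp
  qed
  then show ?thesis by (simp add: clarke_gradient_def)
qed

text \<open>The Clarke derivative in direction 1 belongs to the gradient and is therefore negative.
  Being an infimum over scales, it is approached from above: at some positive scale all quotients
  already lie below a negative constant, which is uniform decrease near \<open>s\<close>.\<close>

lemma max_clarke_negD:
  assumes f: "L-lipschitz_on UNIV f" and neg: "max_clarke f s < 0"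
  obtains r c where "r > 0" "c > 0" "\<And>z \<tau>. \<bar>z - s\<bar> < r \<Longrightarrow> 0 < \<tau> \<Longrightarrow> \<tau> < r \<Longrightarrow> f (z + \<tau>) - f z \<le> - c * \<tau>"
proof -
  \<comment> \<open>\<open>max_clarke\<close> is a real supremum, so it dominates this element only
    once the gradient is known to be bounded above; \<open>L\<close> is such a bound.\<close>
  have "slope_inf f 1 s \<in> clarke_gradient f s"
    by (rule slope_inf_in_clarke_gradient[OF f]) (use slope_inf_opposite[OF f, of s] in auto)
  moreover have "bdd_above (clarke_gradient f s)"
  proof (rule bdd_aboveI)
    fix \<xi> assume "\<xi> \<in> clarke_gradient f s"
    then have "ereal (\<xi> * 1) \<le> clarke_deriv f s 1" unfolding clarke_gradient_def by blast
    also have "\<dots> \<le> ereal L"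
      unfolding clarke_deriv_def
    proof (rule Limsup_bounded, unfold eventually_nhds_at_right_real, intro exI conjI allI impI)
      fix z \<tau> :: real assume "0 < \<tau>"
      then show "(case (z, \<tau>) of (z, \<tau>) \<Rightarrow> ereal ((f (z + \<tau> * 1) - f z) / \<tau>)) \<le> ereal L"
        using lipschitz_quotient_le[OF f, of \<tau> z 1] by simp
    qed (rule zero_less_one)
    finally show "\<xi> \<le> L" by simp
  qed
  ultimately have "slope_inf f 1 s \<le> max_clarke f s" unfolding max_clarke_def by (rule cSup_upper)
  then have "\<not> 0 \<le> slope_inf f 1 s" using neg by simp
  then obtain r where r: "r > 0" "slope_sup f 1 r s < 0"
    using slope_inf_greatest[of 0 f 1 s] by (meson not_le)
  show ?thesis
  proof (rule that[of r "- slope_sup f 1 r s"])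
    fix z \<tau> assume "\<bar>z - s\<bar> < r" "0 < \<tau>" "\<tau> < r"
    then show "f (z + \<tau>) - f z \<le> - (- slope_sup f 1 r s) * \<tau>"
      using slope_sup_upper[OF f, of z s r \<tau> 1] by (simp add: pos_divide_le_eq)
  qed (use r in auto)
qed

text \<open>Local Lipschitz bounds become a single one on the compact interval [0, 1], and clamping
  the argument extends it to the line. Clamping at 0 also realizes the extension by 0, as
  \<open>F 0 = 0\<close>.\<close>

lemma locally_lipschitz_truncation:
  fixes F :: "real \<Rightarrow> real"
  assumes F: "locally_lipschitz_on {0..} F" and "F 0 = 0"
  defines "f \<equiv> \<lambda>s. F (max 0 (min s 1))"
  obtains L where "L-lipschitz_on UNIV f" "\<And>s. s \<le> 0 \<Longrightarrow> f s = 0" "\<And>s. s < 1 \<Longrightarrow> f s = zero_ext F s"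
proof -
  have loc: "local_lipschitz {0::real} {0..1} (\<lambda>t. F)"
  proof (rule local_lipschitzI)
    fix t x :: real assume "x \<in> {0..1}"
    then have "x \<in> {0..}" by simp
    then obtain r L where "r > 0" "L-lipschitz_on ({0..} \<inter> cball x r) F"
      using F unfolding locally_lipschitz_on_def by blast
    then show "\<exists>u>0. \<exists>L. \<forall>t\<in>cball t u \<inter> {0}. L-lipschitz_on (cball x u \<inter> {0..1}) F"
      by (intro exI[of _ r] conjI exI[of _ L] ballI) (auto intro: lipschitz_on_subset)
  qed
  obtain L where L: "L-lipschitz_on {0..1} F"
    by (rule local_lipschitz_compact_implies_lipschitz[OF loc]) auto
  have "L-lipschitz_on UNIV f"
  proof (rule lipschitz_onI[OF _ lipschitz_on_nonneg[OF L]])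
    fix x y :: real
    have "dist (f x) (f y) \<le> L * dist (max 0 (min x 1)) (max 0 (min y 1))"
      unfolding f_def by (rule lipschitz_onD[OF L]) auto
    also have "\<dots> \<le> L * dist x y"
      using lipschitz_on_nonneg[OF L] by (intro mult_left_mono) (auto simp: dist_real_def)
    finally show "dist (f x) (f y) \<le> L * dist x y" .
  qed
  then show ?thesis
    using assms(2) by (intro that) (auto simp: f_def zero_ext_def max_def min_def)
qed

section \<open>Small solutions\<close>

lemma zero_ext_eq: "(\<And>s. s \<le> 0 \<Longrightarrow> f s = 0) \<Longrightarrow> zero_ext f = f"
  by (auto simp: zero_ext_def fun_eq_iff)

lemma weak_solution_cong:
  assumes "weak_solution \<Omega> F G \<mu> u" "\<And>x. x \<in> \<Omega> \<Longrightarrow> u x \<in> U" "open U"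
    "\<And>s. s \<in> U \<Longrightarrow> zero_ext F s = zero_ext F' s" "\<And>s. s \<in> U \<Longrightarrow> zero_ext G s = zero_ext G' s"
  shows "weak_solution \<Omega> F' G' \<mu> u"
proof -
  have eq: "clarke_gradient (zero_ext F) (u x) = clarke_gradient (zero_ext F') (u x)"
    "clarke_gradient (zero_ext G) (u x) = clarke_gradient (zero_ext G') (u x)" if "x \<in> \<Omega>" for x
    by (rule clarke_gradient_cong[OF assms(3) assms(2)[OF that] assms(4)], assumption,
        rule clarke_gradient_cong[OF assms(3) assms(2)[OF that] assms(5)], assumption)
  have "(AE x in lebesgue_on \<Omega>. \<exists>a \<in> clarke_gradient (zero_ext F) (u x).
           \<exists>b \<in> clarke_gradient (zero_ext G) (u x). \<xi> x = a + \<mu> * b) \<longleftrightarrow>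
        (AE x in lebesgue_on \<Omega>. \<exists>a \<in> clarke_gradient (zero_ext F') (u x).
           \<exists>b \<in> clarke_gradient (zero_ext G') (u x). \<xi> x = a + \<mu> * b)" for \<xi>
    by (rule AE_cong) (simp add: eq)
  then show ?thesis using assms(1) unfolding weak_solution_def by simp
qed

lemma lipschitz_add_cmult:
  fixes f g :: "real \<Rightarrow> real"
  assumes f: "L-lipschitz_on UNIV f" and g: "L-lipschitz_on UNIV g" and \<mu>: "0 \<le> \<mu>" "\<mu> \<le> 1"
  shows "(2 * L)-lipschitz_on UNIV (\<lambda>s. f s + \<mu> * g s)"
proof (rule lipschitz_onI)
  fix x y :: real
  have "\<bar>(f x + \<mu> * g x) - (f y + \<mu> * g y)\<bar> = \<bar>(f x - f y) + \<mu> * (g x - g y)\<bar>" by (simp add: algebra_simps)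
  also have "\<dots> \<le> \<bar>f x - f y\<bar> + \<mu> * \<bar>g x - g y\<bar>"
    using abs_triangle_ineq[of "f x - f y" "\<mu> * (g x - g y)"] \<mu>(1) by (simp add: abs_mult)
  also have "\<mu> * \<bar>g x - g y\<bar> \<le> 1 * \<bar>g x - g y\<bar>" using \<mu> by (intro mult_right_mono) auto
  finally show "dist (f x + \<mu> * g x) (f y + \<mu> * g y) \<le> 2 * L * dist x y"
    using lipschitz_onD[OF f, of x y] lipschitz_onD[OF g, of x y] by (simp add: dist_real_def)
qed (use lipschitz_on_nonneg[OF f] in simp)

lemma lipschitz_truncate:
  fixes h :: "real \<Rightarrow> real"
  assumes h: "L-lipschitz_on UNIV h" shows "L-lipschitz_on UNIV (\<lambda>s. h (min s \<eta>))"
proof (rule lipschitz_onI[OF _ lipschitz_on_nonneg[OF h]])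
  fix x y :: real
  have "dist (h (min x \<eta>)) (h (min y \<eta>)) \<le> L * dist (min x \<eta>) (min y \<eta>)"
    by (rule lipschitz_onD[OF h]) auto
  also have "\<dots> \<le> L * dist x y"
    using lipschitz_on_nonneg[OF h] by (intro mult_left_mono) (auto simp: dist_real_def)
  finally show "dist (h (min x \<eta>)) (h (min y \<eta>)) \<le> L * dist x y" .
qed

context bounded_open begin

lemma energy_cong_AE:
  assumes h: "L-lipschitz_on UNIV h" and "u \<in> H10 \<Omega>" "v \<in> H10 \<Omega>" "AE x in M. u x = v x"
  shows "energy h u = energy h v"
proof -
  have "(LINT x|M. h (u x)) = (LINT x|M. h (v x))"
    using assms(4) lipschitz_integrable[OF h H10_L2(1)[OF assms(2)]] lipschitz_integrable[OF h H10_L2(1)[OF assms(3)]]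
    by (intro integral_cong_AE) (auto dest: borel_measurable_integrable elim!: eventually_mono)
  then show ?thesis
    unfolding energy_def using dirichlet_cong(2)[OF assms(2) H10_L2(1)[OF assms(3)] assms(4)] by simp
qed

lemma slope_sup_compose_L2:
  assumes "L-lipschitz_on UNIV f" "r > 0" "u \<in> borel_measurable M"
  shows "(\<lambda>x. slope_sup f v r (u x)) \<in> L2 \<Omega>"
  using measurable_compose[OF assms(3) slope_sup_measurable[OF assms(1,2)]] slope_sup_abs_le[OF assms(1,2)]
  by (intro L2_boundedI[of _ "L * \<bar>v\<bar>"]) auto

lemma truncated_solution:
  assumes f: "L-lipschitz_on UNIV f" "\<And>s. s \<le> 0 \<Longrightarrow> f s = 0"
    and g: "L-lipschitz_on UNIV g" "\<And>s. s \<le> 0 \<Longrightarrow> g s = 0"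
    and \<mu>: "0 \<le> \<mu>" "\<mu> \<le> 1" and \<delta>: "0 < \<delta>" "\<delta> < \<eta>"
    and dec: "\<And>t. \<delta> \<le> t \<Longrightarrow> t \<le> \<eta> \<Longrightarrow> f t + \<mu> * g t \<le> f \<delta> + \<mu> * g \<delta>"
  shows "\<exists>u\<in>between \<delta>. weak_solution \<Omega> f g \<mu> u \<and>
    (\<forall>w\<in>between \<eta>. energy (\<lambda>s. f s + \<mu> * g s) u \<le> energy (\<lambda>s. f s + \<mu> * g s) w)"
proof -
  define H where "H s = f s + \<mu> * g s" for s
  define h where "h s = H (min s \<eta>)" for s
  have HL: "(2 * L)-lipschitz_on UNIV H"
    unfolding H_def by (rule lipschitz_add_cmult[OF f(1) g(1) \<mu>])
  have hL: "(2 * L)-lipschitz_on UNIV h" unfolding h_def by (rule lipschitz_truncate[OF HL])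
  have h0: "h s = 0" if "s \<le> 0" for s using that \<delta> f(2) g(2) by (simp add: h_def H_def)
  have hdec: "h s \<le> h \<delta>" if "s \<ge> \<delta>" for s
    using dec[of "min s \<eta>"] that \<delta> by (simp add: h_def H_def)
  obtain u where u: "u \<in> between \<delta>" and umin: "\<And>w. w \<in> H10 \<Omega> \<Longrightarrow> energy h u \<le> energy h w"
    using exists_minimizer[OF hL h0 hdec] \<delta> by auto
  have uH: "u \<in> H10 \<Omega>" and ub: "0 \<le> u x" "u x \<le> \<delta>" for x using u by (auto simp: between_def)
  have um: "u \<in> borel_measurable M" by (rule L2_measurable[OF H10_L2(1)[OF uH]])
  have eq: "energy h w = energy H w" if "w \<in> between \<eta>" for w
    using that unfolding energy_def between_def by (simp add: h_def)
  have "u \<in> between \<eta>" using uH ub(1) order_trans[OF ub(2), of \<eta>] \<delta> unfolding between_def by auto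
  then have emin: "energy H u \<le> energy H w" if "w \<in> between \<eta>" for w
    using eq umin that by (simp add: between_def flip: eq)
  obtain \<xi> where \<xi>: "\<xi> \<in> L2 \<Omega>"
    "\<And>v. v \<in> H10 \<Omega> \<Longrightarrow> (LINT x|M. wgrad u x \<bullet> wgrad v x) = (LINT x|M. \<xi> x * v x)"
    using Euler_Lagrange[OF hL uH umin] by blast
  have bound: "AE x in M. s * \<xi> x \<le> slope_sup f s r (u x) + \<mu> * slope_sup g s r (u x)"
    if s: "s = 1 \<or> s = -1" and r: "0 < r" "r < \<eta> - \<delta>" for s r
  proof (rule Euler_Lagrange_bounds[OF hL uH umin \<xi> _ r(1) s])
    show "(\<lambda>x. slope_sup f s r (u x) + \<mu> * slope_sup g s r (u x)) \<in> L2 \<Omega>"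
      using L2_add[OF slope_sup_compose_L2[OF f(1) r(1) um] L2_scaleR[OF slope_sup_compose_L2[OF g(1) r(1) um]], of s \<mu> s]
      by simp
    fix x \<sigma> assume \<sigma>: "0 < \<sigma>" "\<sigma> < r"
    have "\<bar>(u x - s * \<sigma>) - u x\<bar> < r" using s \<sigma> by auto
    note q = slope_sup_upper[OF f(1) this \<sigma>, of s] slope_sup_upper[OF g(1) this \<sigma>, of s]
    have shift: "(u x - s * \<sigma>) + \<sigma> * s = u x" by simp
    have q1: "f (u x) - f (u x - s * \<sigma>) \<le> \<sigma> * slope_sup f s r (u x)"
      "g (u x) - g (u x - s * \<sigma>) \<le> \<sigma> * slope_sup g s r (u x)"
      using q \<sigma>(1) unfolding shift by (auto simp: pos_divide_le_eq mult.commute)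
    have "h (u x) = H (u x)" "h (u x - s * \<sigma>) = H (u x - s * \<sigma>)"
      using ub(2)[of x] \<delta> \<sigma> r s unfolding h_def by (auto simp: min_def)
    then show "h (u x) - h (u x - s * \<sigma>) \<le> \<sigma> * (slope_sup f s r (u x) + \<mu> * slope_sup g s r (u x))"
      using q1(1) mult_left_mono[OF q1(2) \<mu>(1)] by (simp add: H_def algebra_simps)
  qed
  \<comment> \<open>The exceptional null set depends on the scale; restricting to countably many
    scales leaves a single null set.\<close>
  have all: "AE x in M. \<forall>n. 1 / (real n + 1) < \<eta> - \<delta> \<longrightarrow>
      \<xi> x \<le> slope_sup f 1 (1 / (real n + 1)) (u x) + \<mu> * slope_sup g 1 (1 / (real n + 1)) (u x) \<and>
      - \<xi> x \<le> slope_sup f (-1) (1 / (real n + 1)) (u x) + \<mu> * slope_sup g (-1) (1 / (real n + 1)) (u x)"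
    unfolding AE_all_countable
  proof
    fix n
    show "AE x in M. 1 / (real n + 1) < \<eta> - \<delta> \<longrightarrow>
      \<xi> x \<le> slope_sup f 1 (1 / (real n + 1)) (u x) + \<mu> * slope_sup g 1 (1 / (real n + 1)) (u x) \<and>
      - \<xi> x \<le> slope_sup f (-1) (1 / (real n + 1)) (u x) + \<mu> * slope_sup g (-1) (1 / (real n + 1)) (u x)"
    proof (cases "1 / (real n + 1) < \<eta> - \<delta>")
      case True
      have p: "0 < 1 / (real n + 1)" by simp
      show ?thesis
        using bound[of 1, OF _ p True] bound[of "-1", OF _ p True] by simp
    qed simp
  qed
  have incl: "AE x in M. \<exists>a\<in>clarke_gradient f (u x). \<exists>b\<in>clarke_gradient g (u x). \<xi> x = a + \<mu> * b"
    using all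
  proof eventually_elim
    case (elim x)
    show ?case by (rule clarke_gradient_sum_mem[OF f(1) g(1) \<mu>(1), of "\<eta> - \<delta>"]) (use elim \<delta> in auto)
  qed
  have zero: "zero_ext f = f" "zero_ext g = g" using f(2) g(2) by (auto intro: zero_ext_eq)
  have "weak_solution \<Omega> f g \<mu> u"
    unfolding weak_solution_def zero
    using uH ub(1) incl \<xi> L2_mult_integrable[OF \<xi>(1) H10_L2(1)] L2_measurable[OF \<xi>(1)]
    by (intro conjI bexI[of _ \<xi>] ballI) auto
  then show ?thesis using u emin unfolding H_def by blast
qed

text \<open>A bump divided by its minimum over a smaller closed ball is at least 1 there, and
  clamping flattens it to 1. Since clamping stays within \<open>H10\<close>, no smooth cutoff is
  built.\<close>

lemma exists_plateau:
  assumes "\<Omega> \<noteq> {}"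
  shows "\<exists>\<phi>\<in>between 1. \<exists>B\<in>sets M. measure M B > 0 \<and> (\<forall>x\<in>B. \<phi> x = 1)"
proof -
  obtain a where "a \<in> \<Omega>" using assms by blast
  then obtain r where r: "r > 0" "cball a r \<subseteq> \<Omega>" using open_dom open_contains_cball by blast
  obtain \<psi> where \<psi>: "test \<psi>" "\<And>x. \<psi> x > 0 \<longleftrightarrow> x \<in> ball a r"
    using test_function_bump[OF r(2,1)] by blast
  let ?B = "cball a (r / 2)"
  have sub: "?B \<subseteq> \<Omega>" using r by auto
  obtain z where z: "z \<in> ?B" "\<And>x. x \<in> ?B \<Longrightarrow> \<psi> z \<le> \<psi> x"
    using continuous_attains_inf[OF compact_cball _ test_function_continuous(1)[OF \<psi>(1)], of a "r / 2"] r(1) by auto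
  have c: "\<psi> z > 0" using z(1) r(1) \<psi>(2) by auto
  let ?\<phi> = "\<lambda>x. max 0 (min ((1 / \<psi> z) * \<psi> x) 1)"
  have "?\<phi> \<in> H10 \<Omega>" by (intro H10_clamp(1) H10_cmult(1) H10_test(1) \<psi>(1)) simp
  then have 1: "?\<phi> \<in> between 1" by (auto simp: between_def)
  have 2: "?\<phi> x = 1" if "x \<in> ?B" for x
    using z(2)[OF that] c by (simp add: max_def min_def field_simps)
  have 3: "?B \<in> sets M" using sub dom_sets by (simp add: sets_restrict_space_iff)
  have 4: "measure M ?B > 0"
    using sub dom_sets r(1) by (simp add: measure_restrict_space content_cball_pos)
  show ?thesis by (intro bexI[OF _ 1] bexI[OF _ 3] conjI ballI 2 4)
qed

text \<open>The oscillation supplies single heights \<open>s\<close> with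
  \<open>f s \<ge> m * s\<^sup>2\<close>; between 0 and \<open>s\<close> only the quadratic lower
  bound is known. A plateau at exactly this height collects the gain, and elsewhere at most
  \<open>K * s\<^sup>2\<close> per unit volume is lost. The Dirichlet energy also scales like
  \<open>s\<^sup>2\<close>, so a large \<open>m\<close> decides.\<close>

lemma exists_negative_energy:
  assumes f: "L-lipschitz_on UNIV f" "f 0 = 0"
    and lower: "K \<ge> 0" "s0 > 0" "\<And>s. 0 < s \<Longrightarrow> s < s0 \<Longrightarrow> - K * s\<^sup>2 \<le> f s"
    and osc: "\<And>m \<epsilon>. \<epsilon> > 0 \<Longrightarrow> \<exists>s. 0 < s \<and> s < \<epsilon> \<and> m * s\<^sup>2 \<le> f s"
    and "\<Omega> \<noteq> {}" "\<delta> > 0"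
  shows "\<exists>w\<in>between \<delta>. energy f w < 0"
proof -
  obtain \<phi> B where \<phi>: "\<phi> \<in> between 1" and B: "B \<in> sets M" "measure M B > 0" "\<And>x. x \<in> B \<Longrightarrow> \<phi> x = 1"
    using exists_plateau[OF \<open>\<Omega> \<noteq> {}\<close>] by blast
  have \<phi>H: "\<phi> \<in> H10 \<Omega>" and \<phi>b: "0 \<le> \<phi> x" "\<phi> x \<le> 1" for x using \<phi> by (auto simp: between_def)
  \<comment> \<open>Makes the gain on \<open>B\<close> exceed the Dirichlet term and the loss by 1
    in units of \<open>s\<^sup>2\<close>, so that the energy of \<open>s * \<phi>\<close> is at most
    \<open>- s\<^sup>2\<close>.\<close>
  define m where "m = (dirichlet \<phi> / 2 + K * vol + 1) / measure M B"
  have m0: "m \<ge> 0" unfolding m_def using lower(1) vol_nonneg by simp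
  have mB: "m * measure M B = dirichlet \<phi> / 2 + K * vol + 1" using B(2) by (simp add: m_def)
  obtain s where s: "0 < s" "s < min s0 \<delta>" "m * s\<^sup>2 \<le> f s" using osc[of "min s0 \<delta>" m] lower(2) \<open>\<delta> > 0\<close> by auto
  let ?w = "\<lambda>x. s * \<phi> x"
  have wH: "?w \<in> H10 \<Omega>" by (rule H10_cmult(1)[OF \<phi>H])
  have wb: "0 \<le> ?w x" "?w x \<le> s" for x
    using \<phi>b[of x] s(1) by (auto simp: mult_left_le)
  have w: "?w \<in> between \<delta>" unfolding between_def using wH wb order_trans[OF wb(2), of \<delta>] s(2) by auto
  have "(LINT x|M. s\<^sup>2 * (m * indicator B x - K)) \<le> (LINT x|M. f (?w x))"
  proof (rule integral_mono)
    show "integrable M (\<lambda>x. s\<^sup>2 * (m * indicator B x - K))"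
      using B(1) by (intro integrable_mult_right Bochner_Integration.integrable_diff integrable_const)
        (auto simp: emeasure_eq_measure)
    show "integrable M (\<lambda>x. f (?w x))" by (rule lipschitz_integrable[OF f(1) H10_L2(1)[OF wH]])
    fix x
    show "s\<^sup>2 * (m * indicator B x - K) \<le> f (?w x)"
    proof (cases "x \<in> B")
      case True
      have "s\<^sup>2 * (m - K) \<le> m * s\<^sup>2" using lower(1) by (simp add: algebra_simps)
      then show ?thesis using True B(3) s(3) by simp
    next
      case False
      have "- (K * s\<^sup>2) \<le> f (?w x)"
      proof (cases "\<phi> x = 0")
        case True then show ?thesis using f(2) lower(1) by simp
      next
        case False
        then have "0 < ?w x" using \<phi>b(1)[of x] s(1) by simp
        moreover have "?w x < s0" using wb(2)[of x] s(2) by linarith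
        ultimately have "- K * (?w x)\<^sup>2 \<le> f (?w x)" by (rule lower(3))
        moreover have "K * (?w x)\<^sup>2 \<le> K * s\<^sup>2" using wb[of x] lower(1) by (intro mult_left_mono power_mono) auto
        ultimately show ?thesis by simp
      qed
      then show ?thesis using False by (simp add: mult.commute)
    qed
  qed
  also have "(LINT x|M. s\<^sup>2 * (m * indicator B x - K)) = s\<^sup>2 * (m * measure M B - K * vol)"
    using B(1) sets.sets_into_space[OF B(1)]
    by (simp add: vol_def emeasure_eq_measure mult.commute Int_absorb2)
  also have "\<dots> = s\<^sup>2 * (dirichlet \<phi> / 2 + 1)" unfolding mB by simp
  finally have "energy f ?w \<le> s\<^sup>2 * dirichlet \<phi> / 2 - s\<^sup>2 * (dirichlet \<phi> / 2 + 1)"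
    unfolding energy_def dirichlet_cmult[OF \<phi>H] by simp
  also have "\<dots> = - s\<^sup>2" by (simp add: distrib_left)
  also have "\<dots> < 0" using s(1) by simp
  finally show ?thesis using w by blast
qed

text \<open>The two-sided control of the energy, with \<open>\<kappa>\<close> independent of
  \<open>\<mu>\<close>, is what later tells solutions obtained for different
  \<open>\<epsilon>\<close> apart.\<close>

lemma small_solution:
  assumes f: "L-lipschitz_on UNIV f" "\<And>s. s \<le> 0 \<Longrightarrow> f s = 0"
    and g: "L-lipschitz_on UNIV g" "\<And>s. s \<le> 0 \<Longrightarrow> g s = 0"
    and desc: "\<And>\<epsilon>. \<epsilon> > 0 \<Longrightarrow> \<exists>\<delta> \<eta> c. 0 < \<delta> \<and> \<delta> < \<eta> \<and> \<eta> < \<epsilon> \<and> 0 < c \<and>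
        (\<forall>t. \<delta> \<le> t \<longrightarrow> t \<le> \<eta> \<longrightarrow> f t - f \<delta> \<le> - c * (t - \<delta>))"
    and lower: "K \<ge> 0" "s0 > 0" "\<And>s. 0 < s \<Longrightarrow> s < s0 \<Longrightarrow> - K * s\<^sup>2 \<le> f s"
    and osc: "\<And>m \<epsilon>. \<epsilon> > 0 \<Longrightarrow> \<exists>s. 0 < s \<and> s < \<epsilon> \<and> m * s\<^sup>2 \<le> f s"
    and ne: "\<Omega> \<noteq> {}" and \<epsilon>: "\<epsilon> > 0"
  shows "\<exists>\<kappa>>0. \<exists>\<mu>0>0. \<forall>\<mu>\<in>{0..\<mu>0}. \<exists>u. weak_solution \<Omega> f g \<mu> u \<and> (\<exists>\<delta><\<epsilon>. u \<in> between \<delta>) \<and>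
    H10_norm \<Omega> u < \<epsilon> \<and> - \<epsilon> < energy (\<lambda>s. f s + \<mu> * g s) u \<and> energy (\<lambda>s. f s + \<mu> * g s) u \<le> - \<kappa>"
proof -
  have L: "L \<ge> 0" by (rule lipschitz_on_nonneg[OF f(1)])
  \<comment> \<open>\<open>f + \<mu> * g\<close> has Lipschitz constant \<open>2 * L\<close>, so a
    nonpositive energy bounds the Dirichlet energy by \<open>4 * L * \<delta> * vol\<close>, which
    is strictly below \<open>A * \<delta>\<close>.\<close>
  define A where "A = 4 * L * vol + 1"
  have A: "A \<ge> 1" using L vol_nonneg by (simp add: A_def)
  \<comment> \<open>The three entries serve the bound on the values, the lower bound on the energy
    and the square of the \<open>H10\<close> norm.\<close>
  define \<epsilon>1 where "\<epsilon>1 = min \<epsilon> (min (\<epsilon> / A) (\<epsilon>\<^sup>2 / A))"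
  have "\<epsilon>1 > 0" using \<epsilon> A by (simp add: \<epsilon>1_def)
  then obtain \<delta> \<eta> c where \<delta>: "0 < \<delta>" "\<delta> < \<eta>" "\<eta> < \<epsilon>1" "0 < c"
    "\<And>t. \<delta> \<le> t \<Longrightarrow> t \<le> \<eta> \<Longrightarrow> f t - f \<delta> \<le> - c * (t - \<delta>)" using desc by blast
  have "\<delta> < \<epsilon>1" using \<delta> by simp
  then have \<delta>\<epsilon>: "\<delta> < \<epsilon>" "A * \<delta> < \<epsilon>" "A * \<delta> < \<epsilon>\<^sup>2"
    using A by (auto simp: \<epsilon>1_def pos_less_divide_eq mult.commute)
  obtain w where w: "w \<in> between \<eta>" "energy f w < 0"
    using exists_negative_energy[OF f(1) f(2)[OF order_refl] lower osc ne, of \<eta>] \<delta> by auto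
  \<comment> \<open>\<open>w\<close> is chosen for \<open>\<mu> = 0\<close>. Half of the depth of
    its energy is reserved for the perturbation by \<open>\<mu> * g\<close>; the other half remains
    as a level uniform in \<open>\<mu>\<close>.\<close>
  define \<kappa> where "\<kappa> = - energy f w / 2"
  have \<kappa>: "\<kappa> > 0" using w by (simp add: \<kappa>_def)
  \<comment> \<open>The entries give \<open>\<mu> \<le> 1\<close>, keep \<open>\<mu> * L\<close>
    within the rate of decrease \<open>c\<close>, and let the perturbation raise the energy of
    \<open>w\<close> by at most \<open>\<kappa>\<close>. The added 1s exclude vanishing
    denominators.\<close>
  define \<mu>0 where "\<mu>0 = min 1 (min (c / (L + 1)) (\<kappa> / (L * \<eta> * vol + 1)))"
  have pos: "L * \<eta> * vol + 1 > 0" using L \<delta> vol_nonneg by (simp add: add_nonneg_pos)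
  have \<mu>0: "\<mu>0 > 0" using L \<delta> \<kappa> pos by (simp add: \<mu>0_def)
  have "\<exists>u. weak_solution \<Omega> f g \<mu> u \<and> (\<exists>\<delta><\<epsilon>. u \<in> between \<delta>) \<and> H10_norm \<Omega> u < \<epsilon> \<and>
      - \<epsilon> < energy (\<lambda>s. f s + \<mu> * g s) u \<and> energy (\<lambda>s. f s + \<mu> * g s) u \<le> - \<kappa>"
    if "\<mu> \<in> {0..\<mu>0}" for \<mu>
  proof -
    have \<mu>: "0 \<le> \<mu>" "\<mu> \<le> 1" "\<mu> * (L + 1) \<le> c" "\<mu> * (L * \<eta> * vol + 1) \<le> \<kappa>"
      using that L pos by (auto simp: \<mu>0_def pos_le_divide_eq)
    let ?H = "\<lambda>s. f s + \<mu> * g s"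
    have HL: "(2 * L)-lipschitz_on UNIV ?H" by (rule lipschitz_add_cmult[OF f(1) g(1) \<mu>(1,2)])
    have "?H t \<le> ?H \<delta>" if t: "\<delta> \<le> t" "t \<le> \<eta>" for t
    proof -
      have "g t - g \<delta> \<le> L * (t - \<delta>)" using lipschitz_onD[OF g(1), of t \<delta>] t by (simp add: dist_real_def)
      then have "\<mu> * (g t - g \<delta>) \<le> \<mu> * (L * (t - \<delta>))" using \<mu>(1) by (rule mult_left_mono)
      also have "\<dots> = (\<mu> * L) * (t - \<delta>)" by simp
      also have "\<dots> \<le> c * (t - \<delta>)" using \<mu>(1,3) t by (intro mult_right_mono) (auto simp: distrib_left)
      finally show ?thesis using \<delta>(5)[OF t] by (simp add: algebra_simps)
    qed
    from truncated_solution[OF f g \<mu>(1,2) \<delta>(1,2) this]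
    obtain u where u: "u \<in> between \<delta>" "weak_solution \<Omega> f g \<mu> u" "energy ?H u \<le> energy ?H w" using w(1) by blast
    have wH: "w \<in> H10 \<Omega>" and wb: "0 \<le> w x" "w x \<le> \<eta>" for x using w(1) by (auto simp: between_def)
    note iw = lipschitz_integrable[OF f(1) H10_L2(1)[OF wH]] lipschitz_integrable[OF g(1) H10_L2(1)[OF wH]]
    have "(LINT x|M. - g (w x)) \<le> L * \<eta> * vol"
    proof (rule integral_bounded_le)
      fix x
      have "- g (w x) \<le> L * \<bar>w x\<bar>" using lipschitz_0_abs_le[OF g(1) g(2)[OF order_refl], of "w x"] by linarith
      also have "\<dots> \<le> L * \<eta>" using wb[of x] L by (intro mult_left_mono) auto
      finally show "- g (w x) \<le> L * \<eta>" .
    qed (use iw in simp)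
    then have "\<mu> * - (LINT x|M. g (w x)) \<le> \<mu> * (L * \<eta> * vol)" using \<mu>(1) by (intro mult_left_mono) auto
    also have "\<dots> \<le> \<kappa>" using \<mu>(1,4) by (simp add: distrib_left)
    finally have "\<mu> * - (LINT x|M. g (w x)) \<le> \<kappa>" .
    moreover have "energy ?H w = energy f w - \<mu> * (LINT x|M. g (w x))"
      using iw unfolding energy_def by simp
    ultimately have eu: "energy ?H u \<le> - \<kappa>" using u(3) by (simp add: \<kappa>_def)
    have H0: "?H 0 = 0" using f(2) g(2) by simp
    note b = energy_lower_bound[OF HL H0 u(1)]
    have "2 * L * \<delta> * vol \<ge> 0" using L \<delta>(1) vol_nonneg by simp
    then have Ad: "4 * L * \<delta> * vol < A * \<delta>" "2 * L * \<delta> * vol \<le> 4 * L * \<delta> * vol"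
      using \<delta>(1) by (auto simp: A_def algebra_simps)
    have "- \<epsilon> < energy ?H u" using b(1) Ad \<delta>\<epsilon> by linarith
    moreover have "dirichlet u < \<epsilon>\<^sup>2" using b(2) eu \<kappa> Ad(1) \<delta>\<epsilon>(3) by (simp add: algebra_simps)
    then have "H10_norm \<Omega> u < \<epsilon>" unfolding H10_norm_def using \<epsilon> by (intro real_less_lsqrt) auto
    ultimately show ?thesis using u(1,2) eu \<delta>\<epsilon>(1) by blast
  qed
  then show ?thesis using \<kappa> \<mu>0 by blast
qed

lemma Linf_norm_between_le:
  assumes "u \<in> between \<delta>" shows "Linf_norm \<Omega> u \<le> ereal \<delta>"
  unfolding Linf_norm_def
proof (rule esssup_I)
  have "u \<in> borel_measurable M" using assms H10_L2(1) L2_measurable unfolding between_def by blast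
  then show "(\<lambda>x. ereal \<bar>u x\<bar>) \<in> borel_measurable M" by measurable
  show "AE x in M. ereal \<bar>u x\<bar> \<le> ereal \<delta>" using assms by (auto simp: between_def)
qed

end

section \<open>Solutions at successive energy levels\<close>

theorem theorem2p2:
  fixes \<Omega> :: "(real ^ 'n) set" and p :: real and F G :: "real \<Rightarrow> real"
  assumes dim: "CARD('n) \<ge> 2"
    and Omega: "open \<Omega>" "connected \<Omega>" "\<Omega> \<noteq> {}" "bounded \<Omega>"
    and p: "0 < p" "p < 1"
    and F_lip: "locally_lipschitz_on {0..} F"
    and G_lip: "locally_lipschitz_on {0..} G"
    and F_0: "F 0 = 0"
    and F_liminf: "- \<infinity> < Liminf (at_right 0) (\<lambda>s. ereal (F s / s\<^sup>2))"
    and F_limsup: "Limsup (at_right 0) (\<lambda>s. ereal (F s / s\<^sup>2)) = \<infinity>"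
    and l_0: "Liminf (at_right 0) (\<lambda>s. ereal (max_clarke (zero_ext F) s / s)) < 0"
    and G_0: "G 0 = 0"
    and G_growth: "\<exists>c_lower c_upper :: real.
      ereal c_lower = Liminf (at_right 0) (\<lambda>s. ereal (min_clarke (zero_ext G) s / s powr p)) \<and>
      Liminf (at_right 0) (\<lambda>s. ereal (min_clarke (zero_ext G) s / s powr p))
        \<le> Limsup (at_right 0) (\<lambda>s. ereal (max_clarke (zero_ext G) s / s powr p)) \<and>
      Limsup (at_right 0) (\<lambda>s. ereal (max_clarke (zero_ext G) s / s powr p)) = ereal c_upper"
  shows "\<forall>k::nat. k \<ge> 1 \<longrightarrow> (\<exists>\<mu>\<^sub>k>0. \<forall>\<mu>\<in>{0..\<mu>\<^sub>k}. \<exists>u :: nat \<Rightarrow> real ^ 'n \<Rightarrow> real.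
     (\<forall>i\<in>{1..k}. weak_solution \<Omega> F G \<mu> (u i)) \<and>
     (\<forall>i\<in>{1..k}. \<forall>j\<in>{1..k}. i \<noteq> j \<longrightarrow> \<not> (AE x in lebesgue_on \<Omega>. u i x = u j x)) \<and>
     (\<forall>i\<in>{1..k}. H10_norm \<Omega> (u i) < 1 / real i \<and> Linf_norm \<Omega> (u i) < ereal (1 / real i)))"
proof -
  interpret bounded_open \<Omega> by unfold_locales (rule Omega)+
  define f g where "f = (\<lambda>s. F (max 0 (min s 1)))" and "g = (\<lambda>s. G (max 0 (min s 1)))"
  obtain L1 where L1: "L1-lipschitz_on UNIV f" "\<And>s. s \<le> 0 \<Longrightarrow> f s = 0" "\<And>s. s < 1 \<Longrightarrow> f s = zero_ext F s"
    unfolding f_def by (rule locally_lipschitz_truncation[OF F_lip F_0]) blast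
  obtain L2 where L2: "L2-lipschitz_on UNIV g" "\<And>s. s \<le> 0 \<Longrightarrow> g s = 0" "\<And>s. s < 1 \<Longrightarrow> g s = zero_ext G s"
    unfolding g_def by (rule locally_lipschitz_truncation[OF G_lip G_0]) blast
  define L where "L = max L1 L2"
  have f: "L-lipschitz_on UNIV f" and g: "L-lipschitz_on UNIV g"
    using L1(1) L2(1) by (auto simp: L_def intro: lipschitz_on_mono)
  have fF: "f s = F s" if "0 < s" "s < 1" for s using L1(3)[OF that(2)] that by (simp add: zero_ext_def)
  have desc: "\<exists>\<delta> \<eta> c. 0 < \<delta> \<and> \<delta> < \<eta> \<and> \<eta> < \<epsilon> \<and> 0 < c \<and>
      (\<forall>t. \<delta> \<le> t \<longrightarrow> t \<le> \<eta> \<longrightarrow> f t - f \<delta> \<le> - c * (t - \<delta>))" if \<epsilon>: "\<epsilon> > 0" for \<epsilon>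
  proof -
    \<comment> \<open>A negative limes inferior yields only points arbitrarily close to 0 with
      negative \<open>max_clarke\<close>; \<open>max_clarke_negD\<close> enlarges such a point to an
      interval of decrease.\<close>
    have "\<not> (\<forall>\<^sub>F s in at_right 0. 0 \<le> ereal (max_clarke (zero_ext F) s / s))"
      using Liminf_bounded[of 0 "\<lambda>s. ereal (max_clarke (zero_ext F) s / s)" "at_right 0"] l_0 by auto
    then obtain s where s: "0 < s" "s < min \<epsilon> 1" "\<not> 0 \<le> ereal (max_clarke (zero_ext F) s / s)"
      unfolding eventually_at_right_field using \<epsilon> by (metis min_less_iff_conj zero_less_one)
    have "clarke_gradient f s = clarke_gradient (zero_ext F) s"
      by (rule clarke_gradient_cong[of "{..<1}"]) (use L1(3) s in auto)
    then have "max_clarke f s < 0"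
      using s(1,3) by (simp add: max_clarke_def not_le divide_less_0_iff)
    then obtain r c where rc: "r > 0" "c > 0" "\<And>z \<tau>. \<bar>z - s\<bar> < r \<Longrightarrow> 0 < \<tau> \<Longrightarrow> \<tau> < r \<Longrightarrow> f (z + \<tau>) - f z \<le> - c * \<tau>"
      using max_clarke_negD[OF f] by metis
    define \<eta> where "\<eta> = s + min (r / 2) ((\<epsilon> - s) / 2)"
    have "f t - f s \<le> - c * (t - s)" if "s \<le> t" "t \<le> \<eta>" for t
    proof (cases "t = s")
      case False
      have "t - s \<le> r / 2" using that(2) unfolding \<eta>_def by linarith
      then have "t - s < r" using rc(1) by linarith
      then show ?thesis using rc(3)[of s "t - s"] rc(1) that False by simp
    qed simp
    moreover have "s < \<eta>" using s(2) rc(1) by (simp add: \<eta>_def)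
    moreover have "\<eta> \<le> s + (\<epsilon> - s) / 2"
      unfolding \<eta>_def by (intro add_left_mono min.cobounded2)
    then have "\<eta> < \<epsilon>" using s(2) by (simp add: field_simps)
    ultimately show ?thesis using s(1) rc(2) by blast
  qed
  \<comment> \<open>Any real number below the limes inferior will do; \<open>max 0 (- C)\<close> is
    then a nonnegative constant for the quadratic lower bound.\<close>
  obtain C where "ereal C < Liminf (at_right 0) (\<lambda>s. ereal (F s / s\<^sup>2))"
    using ereal_dense2[OF F_liminf] by auto
  from less_LiminfD[OF this] obtain b where b: "b > 0" "\<And>s. 0 < s \<Longrightarrow> s < b \<Longrightarrow> C < F s / s\<^sup>2"
    unfolding eventually_at_right_field by auto
  have lower: "- max 0 (- C) * s\<^sup>2 \<le> f s" if s: "0 < s" "s < min b 1" for s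
  proof -
    have "- max 0 (- C) * s\<^sup>2 \<le> C * s\<^sup>2" by (intro mult_right_mono) auto
    also have "\<dots> < F s" using b(2)[of s] s by (simp add: pos_less_divide_eq)
    finally show ?thesis using fF[of s] s by simp
  qed
  have osc: "\<exists>s. 0 < s \<and> s < \<epsilon> \<and> m * s\<^sup>2 \<le> f s" if \<epsilon>: "\<epsilon> > 0" for m \<epsilon>
  proof -
    have "\<not> (\<forall>\<^sub>F s in at_right 0. ereal (F s / s\<^sup>2) \<le> ereal m)"
      using Limsup_bounded[of "\<lambda>s. ereal (F s / s\<^sup>2)" "ereal m" "at_right 0"] F_limsup by auto
    then obtain s where s: "0 < s" "s < min \<epsilon> 1" "\<not> ereal (F s / s\<^sup>2) \<le> ereal m"
      unfolding eventually_at_right_field using \<epsilon> by (metis min_less_iff_conj zero_less_one)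
    then have "m * s\<^sup>2 < F s" by (simp add: not_le pos_less_divide_eq)
    then show ?thesis using s fF[of s] by (intro exI[of _ s]) auto
  qed
  have pos: "max 0 (- C) \<ge> 0" "min b 1 > 0" using b(1) by auto
  let ?E = "\<lambda>\<mu>. energy (\<lambda>s. f s + \<mu> * g s)"
  have small: "\<exists>\<kappa>>0. \<exists>\<mu>0>0. \<forall>\<mu>\<in>{0..\<mu>0}. \<exists>u. weak_solution \<Omega> f g \<mu> u \<and> (\<exists>\<delta><\<epsilon>. u \<in> between \<delta>) \<and>
    H10_norm \<Omega> u < \<epsilon> \<and> - \<epsilon> < ?E \<mu> u \<and> ?E \<mu> u \<le> - \<kappa>" if "\<epsilon> > 0" for \<epsilon>
    by (rule small_solution[OF f _ g _ _ pos _ _ Omega(3) that]) (fact L1(2) L2(2) desc lower osc)+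
  have EL: "?E \<mu> u = ?E \<mu> v" if "\<mu> \<in> {0..1}" "u \<in> H10 \<Omega>" "v \<in> H10 \<Omega>" "AE x in M. u x = v x" for \<mu> u v
    using that lipschitz_add_cmult[OF f g] by (intro energy_cong_AE) auto
  \<comment> \<open>The induction carries a common energy level \<open>- \<kappa>\<close> for the
    solutions found so far, with \<open>\<kappa>\<close> fixed before \<open>\<mu>\<close>, so that
    the next solution can be placed above it.\<close>
  let ?S = "\<lambda>k \<mu> \<kappa> (u :: nat \<Rightarrow> real ^ 'n \<Rightarrow> real).
     (\<forall>i\<in>{1..k::nat}. weak_solution \<Omega> F G \<mu> (u i) \<and> ?E \<mu> (u i) \<le> - \<kappa> \<and>
        H10_norm \<Omega> (u i) < 1 / real i \<and> Linf_norm \<Omega> (u i) < ereal (1 / real i)) \<and>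
     (\<forall>i\<in>{1..k}. \<forall>j\<in>{1..k}. i \<noteq> j \<longrightarrow> \<not> (AE x in M. u i x = u j x))"
  have main: "\<exists>\<kappa>>0. \<exists>\<mu>\<^sub>k>0. \<mu>\<^sub>k \<le> 1 \<and> (\<forall>\<mu>\<in>{0..\<mu>\<^sub>k}. \<exists>u. ?S k \<mu> \<kappa> u)" for k
  proof (induction k)
    case 0
    show ?case by (intro exI[of _ 1] conjI) auto
  next
    case (Suc k)
    then obtain \<kappa> \<mu>\<^sub>k where IH: "\<kappa> > 0" "\<mu>\<^sub>k > 0" "\<mu>\<^sub>k \<le> 1"
      "\<forall>\<mu>\<in>{0..\<mu>\<^sub>k}. \<exists>u. ?S k \<mu> \<kappa> u" by blast
    \<comment> \<open>The entry \<open>\<kappa>\<close> puts the energy of the new solution strictly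
      above those of the earlier ones; \<open>1 / real (Suc k)\<close> gives both norm
      estimates.\<close>
    define \<epsilon> where "\<epsilon> = min \<kappa> (1 / real (Suc k))"
    have \<epsilon>: "\<epsilon> > 0" "\<epsilon> \<le> \<kappa>" "\<epsilon> \<le> 1 / real (Suc k)" "\<epsilon> \<le> 1" using IH(1) by (auto simp: \<epsilon>_def min_le_iff_disj)
    obtain \<kappa>' \<mu>' where new: "\<kappa>' > 0" "\<mu>' > 0"
      "\<forall>\<mu>\<in>{0..\<mu>'}. \<exists>u. weak_solution \<Omega> f g \<mu> u \<and> (\<exists>\<delta><\<epsilon>. u \<in> between \<delta>) \<and>
        H10_norm \<Omega> u < \<epsilon> \<and> - \<epsilon> < ?E \<mu> u \<and> ?E \<mu> u \<le> - \<kappa>'"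
      using small[OF \<epsilon>(1)] by blast
    have "\<exists>u. ?S (Suc k) \<mu> (min \<kappa> \<kappa>') u"
      if \<mu>: "\<mu> \<in> {0..min \<mu>\<^sub>k \<mu>'}" for \<mu>
    proof -
      have \<mu>1: "\<mu> \<in> {0..1}" using \<mu> IH(3) by auto
      have m: "\<mu> \<in> {0..\<mu>\<^sub>k}" "\<mu> \<in> {0..\<mu>'}" using \<mu> by auto
      obtain u where "?S k \<mu> \<kappa> u"
        using bspec[OF IH(4) m(1)] by blast
      note u = conjunct1[OF this, rule_format] conjunct2[OF this, rule_format]
      obtain v \<delta> where v: "weak_solution \<Omega> f g \<mu> v" "\<delta> < \<epsilon>" "v \<in> between \<delta>"
        "H10_norm \<Omega> v < \<epsilon>" "- \<epsilon> < ?E \<mu> v" "?E \<mu> v \<le> - \<kappa>'" using bspec[OF new(3) m(2)] by blast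
      \<comment> \<open>Values of \<open>v\<close> are at most
        \<open>\<delta> < \<epsilon> \<le> 1\<close>, where the truncations agree with the
        extensions of \<open>F\<close> and \<open>G\<close> by 0, and Clarke gradients are
        local.\<close>
      have vF: "weak_solution \<Omega> F G \<mu> v"
        by (rule weak_solution_cong[OF v(1), of "{..<1}"])
          (use v(2,3) \<epsilon>(4) L1(3) L2(3) zero_ext_eq[OF L1(2)] zero_ext_eq[OF L2(2)] in \<open>auto simp: between_def intro: le_less_trans\<close>)
      have Linf: "Linf_norm \<Omega> v < ereal (1 / real (Suc k))"
        using Linf_norm_between_le[OF v(3)] v(2) \<epsilon>(3) by (auto intro: le_less_trans)
      have H10: "H10_norm \<Omega> v < 1 / real (Suc k)" using v(4) \<epsilon>(3) by linarith
      \<comment> \<open>Energies do not change under modification on null sets, so different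
        energies exclude even equality almost everywhere.\<close>
      have diff: "\<not> (AE x in M. u i x = v x)" if i: "i \<in> {1..k}" for i
      proof
        assume "AE x in M. u i x = v x"
        then have "?E \<mu> (u i) = ?E \<mu> v"
          using u(1)[OF i] vF by (intro EL[OF \<mu>1]) (auto simp: weak_solution_def)
        then show False using u(1)[OF i] v(5) \<epsilon>(2) by linarith
      qed
      let ?w = "u(Suc k := v)"
      have old: "i \<in> {1..k}" "?w i = u i" if "i \<in> {1..Suc k}" "i \<noteq> Suc k" for i using that by auto
      have "weak_solution \<Omega> F G \<mu> (?w i) \<and> ?E \<mu> (?w i) \<le> - min \<kappa> \<kappa>' \<and>
        H10_norm \<Omega> (?w i) < 1 / real i \<and> Linf_norm \<Omega> (?w i) < ereal (1 / real i)" if i: "i \<in> {1..Suc k}" for i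
      proof (cases "i = Suc k")
        case True
        then show ?thesis using vF v(6) Linf H10 by simp
      next
        case False
        then show ?thesis using u(1)[OF old(1)[OF i False]] unfolding old(2)[OF i False] by auto
      qed
      moreover have "\<not> (AE x in M. ?w i x = ?w j x)" if ij: "i \<in> {1..Suc k}" "j \<in> {1..Suc k}" "i \<noteq> j" for i j
      proof -
        consider "i = Suc k" "j \<noteq> Suc k" | "i \<noteq> Suc k" "j = Suc k" | "i \<noteq> Suc k" "j \<noteq> Suc k"
          using ij(3) by blast
        then show ?thesis
        proof cases
          case 1
          then show ?thesis using diff[OF old(1)[OF ij(2) 1(2)]] by (simp add: eq_commute)
        next
          case 2
          then show ?thesis using diff[OF old(1)[OF ij(1) 2(1)]] by simp
        next
          case 3
          then show ?thesis using u(2)[OF old(1)[OF ij(1) 3(1)] old(1)[OF ij(2) 3(2)] ij(3)] by simp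
        qed
      qed
      ultimately show ?thesis by blast
    qed
    then show ?case using IH new
      by (intro exI[of _ "min \<kappa> \<kappa>'"] conjI exI[of _ "min \<mu>\<^sub>k \<mu>'"]) (auto simp: min_le_iff_disj)
  qed
  show ?thesis
  proof (intro allI impI)
    fix k :: nat
    obtain \<kappa> \<mu>\<^sub>k where \<mu>\<^sub>k: "\<mu>\<^sub>k > 0" "\<forall>\<mu>\<in>{0..\<mu>\<^sub>k}. \<exists>u. ?S k \<mu> \<kappa> u"
      using main[of k] by blast
    show "\<exists>\<mu>\<^sub>k>0. \<forall>\<mu>\<in>{0..\<mu>\<^sub>k}. \<exists>u :: nat \<Rightarrow> real ^ 'n \<Rightarrow> real.
     (\<forall>i\<in>{1..k}. weak_solution \<Omega> F G \<mu> (u i)) \<and>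
     (\<forall>i\<in>{1..k}. \<forall>j\<in>{1..k}. i \<noteq> j \<longrightarrow> \<not> (AE x in lebesgue_on \<Omega>. u i x = u j x)) \<and>
     (\<forall>i\<in>{1..k}. H10_norm \<Omega> (u i) < 1 / real i \<and> Linf_norm \<Omega> (u i) < ereal (1 / real i))"
      by (intro exI[of _ \<mu>\<^sub>k] conjI ballI \<mu>\<^sub>k(1), drule bspec[OF \<mu>\<^sub>k(2)]) blast
  qed
qed

end
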